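(* Let $\{B(t)\}_{t\ge 0}$ be a standard Brownian motion, $S(t):=\max_{0\le u\le t}B(u)$, and $\mathcal A:=\int_0^1 S(t)\,\mathrm dt$. Let $\mathcal M$ be a positive random variable with distribution given by $\mathbb P(\mathcal M>x)=\mathbb E\,e^{-x^{3/2}\mathcal A}$, $x>0$. Then $\mathcal M$ has a continuous density function given by, for $x>0$, \begin{align*} f_{\mathcal M}(x) &=\frac{3^{1/2}\Gamma(1/3)}{2^{5/6}\pi}\sum_{n=0}^\infty(-1)^n\frac{\Gamma(1+n/2)\,\Gamma(4/3+n/2)}{\Gamma(7/6+n/2)\,n!}\Bigl(\frac23\Bigr)^{n/2}x^{3n/2+1/2}\\ &=\frac{2^{1/2}}{\pi^{1/2}}\,x^{1/2}\;{}_2F_2\Bigl(\tfrac43,1;\tfrac76,\tfrac12;\tfrac{x^3}{6}\Bigr)-\frac58\,x^2\;{}_1F_1\Bigl(\tfrac{11}6;\tfrac53;\tfrac{x^3}6\Bigr). \end{align*}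
   Context: ${}_pF_q(\alpha_1,\dots,\alpha_p;\beta_1,\dots,\beta_q;z)=\sum_{n\ge0}\frac{(\alpha_1)_n\cdots(\alpha_p)_n}{(\beta_1)_n\cdots(\beta_q)_n}\frac{z^n}{n!}$ is the generalized hypergeometric series, where $(\alpha)_n=\alpha(\alpha+1)\cdots(\alpha+n-1)$. *)

theory Defs
  imports "HOL-Probability.Probability"
begin

definition standard_brownian_motion :: "'a measure \<Rightarrow> (real \<Rightarrow> 'a \<Rightarrow> real) \<Rightarrow> bool" where
  "standard_brownian_motion P B \<longleftrightarrow>
     prob_space P \<and>
     (\<forall>t\<ge>0. B t \<in> borel_measurable P) \<and>
     (AE \<omega> in P. B 0 \<omega> = 0) \<and>
     (\<forall>(n::nat) t. 0 \<le> t 0 \<and> strict_mono_on {..n} t \<longrightarrow>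
        prob_space.indep_vars P (\<lambda>_. borel) (\<lambda>i \<omega>. B (t (Suc i)) \<omega> - B (t i) \<omega>) {..<n}) \<and>
     (\<forall>s t. 0 \<le> s \<and> s < t \<longrightarrow>
        distributed P lborel (\<lambda>\<omega>. B t \<omega> - B s \<omega>)
          (\<lambda>x. ennreal (normal_density 0 (sqrt (t - s)) x))) \<and>
     (\<forall>\<omega>\<in>space P. continuous_on {0..} (\<lambda>t. B t \<omega>))"

(* For a path that is continuous on [0,t] the supremum is attained, so it is the maximum. *)
definition running_max :: "(real \<Rightarrow> 'a \<Rightarrow> real) \<Rightarrow> real \<Rightarrow> 'a \<Rightarrow> real" where
  "running_max B t \<omega> = (SUP u\<in>{0..t}. B u \<omega>)"

definition area_running_max :: "(real \<Rightarrow> 'a \<Rightarrow> real) \<Rightarrow> 'a \<Rightarrow> real" where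
  "area_running_max B \<omega> = (LBINT t:{0..1}. running_max B t \<omega>)"

(* The library's fps_hypergeo as bs c is the formal series with n-th coefficient
   (prod of pochhammer a n for a in as) * c^n / ((prod of pochhammer b n for b in bs) * n!). *)
definition hypergeometric :: "real list \<Rightarrow> real list \<Rightarrow> real \<Rightarrow> real" where
  "hypergeometric as bs z = eval_fps (fps_hypergeo as bs 1) z"

end

(* Let S be the running maximum of B and A its integral over [0,1]. For th continuous, nonnegative
   and vanishing for large arguments, with antiderivative V, the variable
     exp (V(S_T) - th(S_T) (S_T - B_T) - 1/2 int_0^T th(S_t)^2 dt)
   has expectation 1: it is the limit of exponential martingales of Gaussian random walks, after a
   summation by parts that uses that S - B vanishes whenever S increases. Taking for th the function
   sqrt (2 (1 + l s)), cut off above x, gives the expectation of exp (- int (1 + l S)) up to the first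
   passage above x. Integrating over x and using Brownian scaling,
     E int_0^oo exp (- t - l t^(3/2) A) dt = int_0^oo exp (- v) (1 + a l v)^(-2/3) dv,   a = 3 / (2 sqrt 2).
   So e^(3/2) A has the law of a e g, where e and g are independent of each other and of A, e is
   standard exponential and g is Gamma(2/3) distributed. This gives the moments of A, hence an entire
   series for P(M > x) = E exp (- x^(3/2) A), which is differentiated termwise; splitting it into even
   and odd terms gives the two hypergeometric functions. *)

theory Submission
  imports Defs
begin

section \<open>Running maxima of paths and their discretisations\<close>

text \<open>Summation by parts removes the increments of B from the exponent before the mesh tends
  to 0, so all limits are pathwise and no stochastic integral occurs. The function th is chosen so
  that th^2 / 2 is the rate 1 + l s. Its antiderivative is V(x) = 2 sqrt 2 / (3 l) ((1 + l x)^(3/2)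
  - 1), and V(x) = v means 1 + l x = (1 + a l v)^(2/3): this is the origin of a. The integration
  over x carries the weight l / (1 + l x)^2, whose tail 1 / (1 + l s) cancels the factor 1 + l S
  that arises when exp (- int (1 + l S)) is differentiated. The power -2/3 becomes a law because (1
  + c)^(-2/3) is the Laplace transform of Gamma(2/3). The summand 1 in the rate pays twice: it
  supplies the exponential time e, and it bounds by exp (- T) the error of working on a finite
  interval [0, T]. Scaling compares two different Brownian motions, so it needs that the law of A is
  the same for all of them; this is read off from the discretisation.\<close>

definition path_max :: "(real \<Rightarrow> real) \<Rightarrow> real \<Rightarrow> real" where
  "path_max b t = (SUP u\<in>{0..t}. b u)"

primrec smax :: "(nat \<Rightarrow> real) \<Rightarrow> nat \<Rightarrow> real" where
  "smax y 0 = y 0"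
| "smax y (Suc j) = max (smax y j) (y (Suc j))"

lemma smax_ge: "i \<le> j \<Longrightarrow> y i \<le> smax y j"
  by (induction j) (auto simp: le_Suc_eq le_max_iff_disj)

lemma smax_le: "(\<And>i. i \<le> j \<Longrightarrow> y i \<le> c) \<Longrightarrow> smax y j \<le> c"
  by (induction j) auto

lemma smax_cong: "(\<And>i. i \<le> j \<Longrightarrow> y i = z i) \<Longrightarrow> smax y j = smax z j"
  by (induction j) auto

text \<open>On a step where the maximum stays put, the contribution of the increment of
  \<open>y\<close> is exactly the change of the boundary term. On a step where it grows, the new
  \<open>smax\<close> is the new \<open>y\<close>, so the new boundary term is 0. This discrete form
  of S - B vanishing where S increases carries no error term.\<close>

lemma smax_abel:
  "(\<Sum>j<n. th (smax y j) * (y (Suc j) - y j)) =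
   (\<Sum>j<n. th (smax y j) * (smax y (Suc j) - smax y j)) - th (smax y n) * (smax y n - y n)"
  for th :: "real \<Rightarrow> real"
proof (induction n)
  case (Suc n)
  show ?case
  proof (cases "y (Suc n) \<le> smax y n")
    case True
    then show ?thesis using Suc by (simp add: max_absorb1 algebra_simps)
  next
    case False
    then show ?thesis using Suc by (simp add: max_absorb2 algebra_simps)
  qed
qed simp

text \<open>Local errors add up to \<open>e\<close> times the total length, while the increments of
  \<open>V\<close> telescope. It serves Riemann sums, with \<open>x\<close> the grid times, and
  Stieltjes sums, with \<open>x\<close> the discrete maxima.\<close>

lemma sum_approx_antiderivative:
  fixes a x :: "nat \<Rightarrow> real" and V :: "real \<Rightarrow> real"
  assumes "\<And>j. j < n \<Longrightarrow>
    \<bar>a j * (x (Suc j) - x j) - (V (x (Suc j)) - V (x j))\<bar> \<le> e * (x (Suc j) - x j)"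
  shows "\<bar>(\<Sum>j<n. a j * (x (Suc j) - x j)) - (V (x n) - V (x 0))\<bar> \<le> e * (x n - x 0)"
  using assms
proof (induction n)
  case (Suc n)
  have "\<bar>(\<Sum>j<n. a j * (x (Suc j) - x j)) - (V (x n) - V (x 0))\<bar> \<le> e * (x n - x 0)"
    using Suc by simp
  moreover have "\<bar>a n * (x (Suc n) - x n) - (V (x (Suc n)) - V (x n))\<bar> \<le> e * (x (Suc n) - x n)"
    using Suc.prems by simp
  ultimately show ?case by (simp add: algebra_simps abs_le_iff)
qed simp

section \<open>Continuity of the running maximum of a path, and its grid approximation\<close>

lemma path_max_bdd:
  fixes b :: "real \<Rightarrow> real"
  assumes "continuous_on {0..} b"
  shows "bdd_above (b ` {0..t})"
proof -
  have "compact (b ` {0..t})"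
    by (intro compact_continuous_image continuous_on_subset[OF assms]) auto
  then show ?thesis by (intro bounded_imp_bdd_above compact_imp_bounded)
qed

lemma path_max_ge:
  assumes "continuous_on {0..} b" "0 \<le> u" "u \<le> t"
  shows "b u \<le> path_max b t"
  unfolding path_max_def using assms by (intro cSUP_upper path_max_bdd) auto

lemma path_max_le:
  assumes "0 \<le> t" "\<And>u. 0 \<le> u \<Longrightarrow> u \<le> t \<Longrightarrow> b u \<le> c"
  shows "path_max b t \<le> c"
  unfolding path_max_def using assms by (intro cSUP_least) auto

lemma path_max_mono:
  assumes "continuous_on {0..} b" "0 \<le> s" "s \<le> t"
  shows "path_max b s \<le> path_max b t"
  using assms by (intro path_max_le path_max_ge) auto

lemma path_max_0 [simp]: "path_max b 0 = b 0"
  by (simp add: path_max_def)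

text \<open>Transfers a modulus of continuity from \<open>b\<close> to \<open>path_max b\<close>:
  times up to \<open>s\<close> are covered by \<open>path_max b s\<close>, and at later times the
  path exceeds \<open>b s\<close>, hence also \<open>path_max b s\<close>, by at most
  \<open>e\<close>.\<close>

lemma path_max_diff_le:
  assumes b: "continuous_on {0..} b" and "0 \<le> s" "s \<le> t"
    and e: "\<And>u. s \<le> u \<Longrightarrow> u \<le> t \<Longrightarrow> b u \<le> b s + e" and "0 \<le> e"
  shows "path_max b t \<le> path_max b s + e"
proof (rule path_max_le)
  fix u assume u: "0 \<le> u" "u \<le> t"
  show "b u \<le> path_max b s + e"
  proof (cases "u \<le> s")
    case True
    then show ?thesis using path_max_ge[OF b, of u s] u assms(5) by simp
  next
    case False
    then show ?thesis using e[of u] path_max_ge[OF b, of s s] u assms(2) by simp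
  qed
qed (use assms in auto)

lemma path_max_continuous:
  assumes b: "continuous_on {0..} b"
  shows "continuous_on {0..} (path_max b)"
proof -
  have "continuous_on {0..T} (path_max b)" for T
  proof -
    have "uniformly_continuous_on {0..T} b"
      by (intro compact_uniformly_continuous continuous_on_subset[OF b]) auto
    show ?thesis
    proof (rule uniformly_continuous_imp_continuous, unfold uniformly_continuous_on_def, safe)
      fix e :: real assume e: "e > 0"
      then obtain d where d: "d > 0" "\<And>u v. u \<in> {0..T} \<Longrightarrow> v \<in> {0..T} \<Longrightarrow> dist v u < d \<Longrightarrow> dist (b v) (b u) < e/2"
        using \<open>uniformly_continuous_on {0..T} b\<close> unfolding uniformly_continuous_on_def
        by (meson half_gt_zero)
      have *: "dist (path_max b t) (path_max b s) < e" if "0 \<le> s" "s \<le> t" "t \<le> T" "t - s < d" for s t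
      proof -
        have "path_max b t \<le> path_max b s + e/2"
        proof (rule path_max_diff_le[OF b])
          fix u assume "s \<le> u" "u \<le> t"
          then have "dist (b u) (b s) < e/2" using that by (intro d) (auto simp: dist_real_def)
          then show "b u \<le> b s + e/2" unfolding dist_real_def by linarith
        qed (use that e in auto)
        then show ?thesis using path_max_mono[OF b, of s t] that e by (auto simp: dist_real_def)
      qed
      show "\<exists>d>0. \<forall>x\<in>{0..T}. \<forall>x'\<in>{0..T}. dist x' x < d \<longrightarrow> dist (path_max b x') (path_max b x) < e"
      proof (intro exI conjI ballI impI)
        fix s t assume st: "s \<in> {0..T}" "t \<in> {0..T}" "dist t s < d"
        show "dist (path_max b t) (path_max b s) < e"
        proof (cases "s \<le> t")
          case True then show ?thesis using *[of s t] st by (auto simp: dist_real_def)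
        next
          case False then show ?thesis using *[of t s] st by (auto simp: dist_real_def)
        qed
      qed (use d in auto)
    qed
  qed
  note c = this
  show ?thesis
    unfolding continuous_on_eq_continuous_within
  proof
    fix x :: real assume x: "x \<in> {0..}"
    have "continuous (at x within {0..x+1}) (path_max b)"
      using c[of "x+1"] x by (auto simp: continuous_on_eq_continuous_within)
    moreover have "at x within {0..x+1} = at x within {0..}"
      using x by (intro at_within_nhd[of _ "{..<x+1}"]) auto
    ultimately show "continuous (at x within {0..}) (path_max b)"
      by (simp add: continuous_within)
  qed
qed

text \<open>The mesh is \<open>T / (n + 1)\<close>, so that no division by zero can occur.\<close>

definition grid :: "(real \<Rightarrow> real) \<Rightarrow> real \<Rightarrow> nat \<Rightarrow> nat \<Rightarrow> real" where
  "grid b T n j = b (real j * (T / real (Suc n)))"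

lemma grid_mult_le: "0 \<le> T \<Longrightarrow> j \<le> Suc n \<Longrightarrow> real j * (T / real (Suc n)) \<le> T"
  using mult_right_mono[of "real j" "real (Suc n)" "T / real (Suc n)"] by simp

text \<open>With h the mesh, \<open>smax\<close> at index j sees only grid times up to j h, yet it
  is compared with the maximum at any time of the cell from j h to (j + 1) h. The Riemann sums need
  the whole cell, the Stieltjes sums its right end.\<close>

lemma smax_grid_approx:
  assumes b: "continuous_on {0..} b" and T: "0 < T" and e: "0 < e"
  shows "\<forall>\<^sub>F n in sequentially. \<forall>j\<le>Suc n. \<forall>t. real j * (T / real (Suc n)) \<le> t \<and>
     t \<le> real (Suc j) * (T / real (Suc n)) \<and> t \<le> T \<longrightarrow>
     smax (grid b T n) j \<le> path_max b t \<and> path_max b t \<le> smax (grid b T n) j + e"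
proof -
  have "uniformly_continuous_on {0..T} b"
    by (intro compact_uniformly_continuous continuous_on_subset[OF b]) auto
  then obtain d where d: "d > 0" "\<And>u v. u \<in> {0..T} \<Longrightarrow> v \<in> {0..T} \<Longrightarrow> dist v u < d \<Longrightarrow> dist (b v) (b u) < e"
    using e unfolding uniformly_continuous_on_def by metis
  have "(\<lambda>n. T / real (Suc n)) \<longlonglongrightarrow> 0"
    by (rule LIMSEQ_Suc) (rule lim_const_over_n)
  then have "\<forall>\<^sub>F n in sequentially. T / real (Suc n) < d"
    using d(1) by (rule order_tendstoD)
  then show ?thesis
  proof eventually_elim
    case (elim n)
    define h where "h = T / real (Suc n)"
    have h: "0 < h" "h < d" using T elim by (auto simp: h_def)
    have hT: "real i * h \<le> T" if "i \<le> Suc n" for i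
      using grid_mult_le[of T i n] T that by (simp add: h_def)
    show ?case
    proof (intro allI impI, fold h_def, elim conjE)
      fix j t assume j: "j \<le> Suc n" and t: "real j * h \<le> t" "t \<le> real (Suc j) * h" "t \<le> T"
      have t0: "0 \<le> t" using t h by (meson mult_nonneg_nonneg of_nat_0_le_iff order.trans less_imp_le)
      have "smax (grid b T n) j \<le> path_max b t"
      proof (rule smax_le)
        fix i assume i: "i \<le> j"
        then have "real i * h \<le> real j * h" using h by (intro mult_right_mono) auto
        then have "real i * h \<le> t" using t by linarith
        then show "grid b T n i \<le> path_max b t"
          unfolding grid_def h_def[symmetric] using h by (intro path_max_ge[OF b]) auto
      qed
      moreover have "path_max b t \<le> smax (grid b T n) j + e"
      proof (rule path_max_le[OF t0])
        fix u assume u: "0 \<le> u" "u \<le> t"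
        \<comment> \<open>The grid index just below \<open>u\<close>, capped at \<open>j\<close>:
          for u = (j + 1) h the floor would be j + 1, a grid point that \<open>smax\<close> at
          \<open>j\<close> does not cover.\<close>
        define i where "i = min j (nat \<lfloor>u/h\<rfloor>)"
        have fl: "real (nat \<lfloor>u/h\<rfloor>) * h \<le> u" "u < (real (nat \<lfloor>u/h\<rfloor>) + 1) * h"
          using h u by (auto simp flip: pos_le_divide_eq pos_divide_less_eq)
        have i: "real i * h \<le> u \<and> u \<le> (real i + 1) * h"
        proof (cases "nat \<lfloor>u/h\<rfloor> \<le> j")
          case True
          then show ?thesis using fl by (auto simp: i_def min_absorb2)
        next
          case False
          then have "real j * h \<le> real (nat \<lfloor>u/h\<rfloor>) * h" using h by (intro mult_right_mono) auto
          then have "real j * h \<le> u" using fl by linarith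
          then show ?thesis using fl False t u by (auto simp: i_def min_absorb1 algebra_simps)
        qed
        have "dist (b u) (b (real i * h)) < e"
          using i h u t by (intro d(2)) (auto simp: dist_real_def algebra_simps intro!: mult_nonneg_nonneg)
        then have "b u \<le> grid b T n i + e" by (auto simp: dist_real_def grid_def h_def)
        also have "\<dots> \<le> smax (grid b T n) j + e"
          using smax_ge[of i j "grid b T n"] by (simp add: i_def)
        finally show "b u \<le> smax (grid b T n) j + e" .
      qed
      ultimately show "smax (grid b T n) j \<le> path_max b t \<and> path_max b t \<le> smax (grid b T n) j + e" by simp
    qed
  qed
qed

lemma smax_grid_tendsto:
  assumes b: "continuous_on {0..} b" and T: "0 < T"
  shows "(\<lambda>n. smax (grid b T n) (Suc n)) \<longlonglongrightarrow> path_max b T"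
proof (rule LIMSEQ_I)
  fix r :: real assume "r > 0"
  then have "\<forall>\<^sub>F n in sequentially. norm (smax (grid b T n) (Suc n) - path_max b T) < r"
  proof -
    assume r: "r > 0"
    show ?thesis using smax_grid_approx[OF b T half_gt_zero[OF r]]
    proof eventually_elim
      case (elim n)
      then show ?case using r T by (auto dest!: spec[of _ "Suc n"] spec[of _ T] simp: field_simps)
    qed
  qed
  then show "\<exists>no. \<forall>n\<ge>no. norm (smax (grid b T n) (Suc n) - path_max b T) < r"
    by (simp add: eventually_sequentially)
qed

lemma smax_grid_range:
  assumes b: "continuous_on {0..} b" and T: "0 < T" and j: "j \<le> Suc n"
  shows "b 0 \<le> smax (grid b T n) j" "smax (grid b T n) j \<le> path_max b T"
proof -
  show "b 0 \<le> smax (grid b T n) j" using smax_ge[of 0 j "grid b T n"] by (simp add: grid_def)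
  show "smax (grid b T n) j \<le> path_max b T"
  proof (rule smax_le)
    fix i assume "i \<le> j"
    then show "grid b T n i \<le> path_max b T"
      unfolding grid_def using grid_mult_le[of T i n] T j by (intro path_max_ge[OF b]) auto
  qed
qed

text \<open>The indefinite integral of the integrand takes the role of the antiderivative. On each
  cell the integrand is within \<open>e\<close> of its sample, since both arguments lie in
  \<open>{b 0..path_max b T}\<close>, where \<phi> is uniformly continuous.\<close>

lemma riemann_smax_tendsto:
  fixes \<phi> :: "real \<Rightarrow> real"
  assumes b: "continuous_on {0..} b" and T: "0 < T" and \<phi>: "continuous_on UNIV \<phi>"
  shows "(\<lambda>n. \<Sum>j<Suc n. \<phi> (smax (grid b T n) j) * (T / real (Suc n)))
    \<longlonglongrightarrow> integral {0..T} (\<lambda>t. \<phi> (path_max b t))"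
proof (rule LIMSEQ_I)
  fix r :: real assume r: "r > 0"
  define e where "e = r / (2 * T)"
  have e: "e > 0" using r T by (simp add: e_def)
  have "uniformly_continuous_on {b 0..path_max b T} \<phi>"
    by (intro compact_uniformly_continuous continuous_on_subset[OF \<phi>]) auto
  then obtain d where d: "d > 0" "\<And>u v. u \<in> {b 0..path_max b T} \<Longrightarrow> v \<in> {b 0..path_max b T} \<Longrightarrow> dist v u < d \<Longrightarrow> dist (\<phi> v) (\<phi> u) < e"
    using e unfolding uniformly_continuous_on_def by metis
  define F where "F = (\<lambda>t. \<phi> (path_max b t))"
  have F: "continuous_on {0..} F"
    unfolding F_def using continuous_on_compose2[OF \<phi> path_max_continuous[OF b]] by auto
  have Fi: "F integrable_on {u..v}" if "0 \<le> u" for u v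
    by (intro integrable_continuous_real continuous_on_subset[OF F]) (use that in auto)
  have "\<forall>\<^sub>F n in sequentially. norm ((\<Sum>j<Suc n. \<phi> (smax (grid b T n) j) * (T / real (Suc n))) - integral {0..T} F) < r"
    using smax_grid_approx[OF b T half_gt_zero[OF d(1)]]
  proof eventually_elim
    case (elim n)
    define h where "h = T / real (Suc n)"
    have h: "0 < h" using T by (auto simp: h_def)
    have hT: "real i * h \<le> T" if "i \<le> Suc n" for i
      using grid_mult_le[of T i n] T that by (simp add: h_def)
    have "\<bar>(\<Sum>j<Suc n. \<phi> (smax (grid b T n) j) * (real (Suc j) * h - real j * h)) -
        (integral {0..real (Suc n) * h} F - integral {0..real 0 * h} F)\<bar> \<le> e * (real (Suc n) * h - real 0 * h)"
    proof (rule sum_approx_antiderivative[where x = "\<lambda>j. real j * h" and V = "\<lambda>t. integral {0..t} F"])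
      fix j assume j: "j < Suc n"
      define u v where "u = real j * h" and "v = real (Suc j) * h"
      have uv: "0 \<le> u" "u \<le> v" "v \<le> T" using hT[of "Suc j"] j h by (auto simp: u_def v_def algebra_simps)
      have split: "integral {0..v} F - integral {0..u} F = integral {u..v} F"
        using Henstock_Kurzweil_Integration.integral_combine[of 0 u v F] uv Fi[of 0] by simp
      have bnd: "\<bar>F t - \<phi> (smax (grid b T n) j)\<bar> \<le> e" if "t \<in> {u..v}" for t
      proof -
        have 1: "smax (grid b T n) j \<le> path_max b t \<and> path_max b t \<le> smax (grid b T n) j + d/2"
          using elim[rule_format, of j t] that uv j unfolding h_def[symmetric] by (auto simp: u_def v_def)
        have "dist (\<phi> (path_max b t)) (\<phi> (smax (grid b T n) j)) < e"
          using smax_grid_range[OF b T, of j n] path_max_mono[OF b, of t T] path_max_mono[OF b, of 0 t] 1 j that uv d(1)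
          by (intro d(2)) (auto simp: dist_real_def)
        then show ?thesis by (simp add: F_def dist_real_def)
      qed
      have "\<bar>integral {u..v} (\<lambda>t. F t - \<phi> (smax (grid b T n) j))\<bar> \<le> e * (v - u)"
        using integral_bound[of u v "\<lambda>t. F t - \<phi> (smax (grid b T n) j)" e] uv bnd
          continuous_on_diff[OF continuous_on_subset[OF F, of "{u..v}"] continuous_on_const] by auto
      moreover have "integral {u..v} (\<lambda>t. F t - \<phi> (smax (grid b T n) j)) = integral {u..v} F - \<phi> (smax (grid b T n) j) * (v - u)"
        using Fi[of u v] uv by (subst integral_diff) (auto simp: mult.commute)
      ultimately show "\<bar>\<phi> (smax (grid b T n) j) * (real (Suc j) * h - real j * h) -
          (integral {0..real (Suc j) * h} F - integral {0..real j * h} F)\<bar> \<le> e * (real (Suc j) * h - real j * h)"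
        using split unfolding u_def[symmetric] v_def[symmetric] by linarith
    qed
    moreover have "real (Suc j) * h - real j * h = h" for j by (simp add: algebra_simps)
    moreover have "real (Suc n) * h = T" by (simp add: h_def)
    moreover have "integral {0..0} F = 0" by simp
    ultimately have "\<bar>(\<Sum>j<Suc n. \<phi> (smax (grid b T n) j) * h) - integral {0..T} F\<bar> \<le> e * T"
      by (simp only: of_nat_0 mult_zero_left diff_zero)
    also have "\<dots> < r" using r T by (simp add: e_def)
    finally show ?case by (simp add: h_def)
  qed
  then show "\<exists>no. \<forall>n\<ge>no. norm ((\<Sum>j<Suc n. \<phi> (smax (grid b T n) j) * (T / real (Suc n))) - integral {0..T} (\<lambda>t. \<phi> (path_max b t))) < r"
    by (simp add: eventually_sequentially F_def)
qed

text \<open>The running maximum is continuous and nondecreasing, so the chain rule holds without a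
  second-order term. On the grid, the jumps of \<open>smax\<close> become uniformly small, and the
  mean value theorem replaces the increment of \<open>V\<close> by \<open>th\<close> at an
  intermediate point.\<close>

lemma stieltjes_smax_tendsto:
  fixes th V :: "real \<Rightarrow> real"
  assumes b: "continuous_on {0..} b" and T: "0 < T" and th: "continuous_on UNIV th"
    and V: "\<And>x. (V has_real_derivative th x) (at x)"
  shows "(\<lambda>n. \<Sum>j<Suc n. th (smax (grid b T n) j) * (smax (grid b T n) (Suc j) - smax (grid b T n) j))
    \<longlonglongrightarrow> V (path_max b T) - V (b 0)"
proof -
  define X where "X = (\<lambda>n. (\<Sum>j<Suc n. th (smax (grid b T n) j) * (smax (grid b T n) (Suc j) - smax (grid b T n) j))
     - (V (smax (grid b T n) (Suc n)) - V (smax (grid b T n) 0)))"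
  have "X \<longlonglongrightarrow> 0"
  proof (rule LIMSEQ_I)
    fix r :: real assume r: "r > 0"
    \<comment> \<open>The summand 1 keeps \<open>K\<close> positive when the path never rises above
      its start.\<close>
    define K where "K = path_max b T - b 0 + 1"
    have K: "K > 0" using path_max_mono[OF b, of 0 T] T by (simp add: K_def)
    define e where "e = r / (2 * K)"
    have e: "e > 0" using r K by (simp add: e_def)
    have "uniformly_continuous_on {b 0..path_max b T} th"
      by (intro compact_uniformly_continuous continuous_on_subset[OF th]) auto
    then obtain d where d: "d > 0" "\<And>u v. u \<in> {b 0..path_max b T} \<Longrightarrow> v \<in> {b 0..path_max b T} \<Longrightarrow> dist v u < d \<Longrightarrow> dist (th v) (th u) < e"
      using e unfolding uniformly_continuous_on_def by metis
    have "\<forall>\<^sub>F n in sequentially. norm (X n - 0) < r"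
      using smax_grid_approx[OF b T half_gt_zero[OF d(1)]]
    proof eventually_elim
      case (elim n)
      define h where "h = T / real (Suc n)"
      have h: "0 < h" using T by (auto simp: h_def)
      let ?x = "smax (grid b T n)"
      have "\<bar>(\<Sum>j<Suc n. th (?x j) * (?x (Suc j) - ?x j)) - (V (?x (Suc n)) - V (?x 0))\<bar> \<le> e * (?x (Suc n) - ?x 0)"
      proof (rule sum_approx_antiderivative)
        fix j assume j: "j < Suc n"
        have hT: "real (Suc j) * h \<le> T"
          using grid_mult_le[of T "Suc j" n] T j by (simp add: h_def)
        \<comment> \<open>Consecutive discrete maxima are both compared with \<open>path_max\<close>
          at the right end of the cell, which bounds their difference by d/2.\<close>
        have "?x j \<le> path_max b (real (Suc j) * h) \<and> path_max b (real (Suc j) * h) \<le> ?x j + d/2"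
          using elim[rule_format, of j "real (Suc j) * h"] hT j h unfolding h_def[symmetric] by (auto simp: algebra_simps)
        moreover have "?x (Suc j) \<le> path_max b (real (Suc j) * h)"
          using elim[rule_format, of "Suc j" "real (Suc j) * h"] hT j h unfolding h_def[symmetric] by (auto simp: algebra_simps)
        ultimately have close: "?x (Suc j) \<le> ?x j + d/2" by simp
        have mono: "?x j \<le> ?x (Suc j)" by simp
        show "\<bar>th (?x j) * (?x (Suc j) - ?x j) - (V (?x (Suc j)) - V (?x j))\<bar> \<le> e * (?x (Suc j) - ?x j)"
        proof (cases "?x j = ?x (Suc j)")
          case False
          then have lt: "?x j < ?x (Suc j)" using mono by linarith
          obtain z where z: "?x j < z" "z < ?x (Suc j)" "V (?x (Suc j)) - V (?x j) = (?x (Suc j) - ?x j) * th z"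
            using MVT2[OF lt, of V th] V by auto
          have "dist (th z) (th (?x j)) < e"
            using z close d(1) smax_grid_range[OF b T, of j n] smax_grid_range[OF b T, of "Suc j" n] j
            by (intro d(2)) (auto simp: dist_real_def simp del: smax.simps)
          then have "\<bar>th (?x j) - th z\<bar> \<le> e" by (simp add: dist_real_def abs_minus_commute)
          then have "\<bar>th (?x j) - th z\<bar> * \<bar>?x (Suc j) - ?x j\<bar> \<le> e * (?x (Suc j) - ?x j)"
            using lt by (intro mult_mono) auto
          then show ?thesis unfolding z(3) by (simp add: abs_mult[symmetric] algebra_simps del: smax.simps)
        qed simp
      qed
      also have "\<dots> \<le> e * K"
        using smax_grid_range[OF b T, of "Suc n" n] smax_grid_range[OF b T, of 0 n] e
        by (intro mult_left_mono) (auto simp: K_def simp del: smax.simps)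
      also have "\<dots> < r" using r K by (simp add: e_def)
      finally show ?case by (simp add: X_def del: smax.simps)
    qed
    then show "\<exists>no. \<forall>n\<ge>no. norm (X n - 0) < r" by (simp add: eventually_sequentially)
  qed
  moreover have "(\<lambda>n. V (smax (grid b T n) (Suc n))) \<longlonglongrightarrow> V (path_max b T)"
    by (rule isCont_tendsto_compose[OF DERIV_isCont[OF V] smax_grid_tendsto[OF b T]])
  then have "(\<lambda>n. V (smax (grid b T n) (Suc n)) - V (b 0)) \<longlonglongrightarrow> V (path_max b T) - V (b 0)"
    by (intro tendsto_intros)
  ultimately have "(\<lambda>n. X n + (V (smax (grid b T n) (Suc n)) - V (b 0))) \<longlonglongrightarrow> 0 + (V (path_max b T) - V (b 0))"
    by (rule tendsto_add)
  then show ?thesis by (simp add: X_def grid_def del: smax.simps(2))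
qed

section \<open>Exponential martingales of Gaussian random walks\<close>

definition gauss :: "real \<Rightarrow> real measure" where
  "gauss s = density lborel (\<lambda>x. ennreal (normal_density 0 s x))"

lemma sets_gauss [measurable_cong, simp]: "sets (gauss s) = sets borel"
  by (simp add: gauss_def)

lemma space_gauss [simp]: "space (gauss s) = UNIV"
  by (simp add: gauss_def)

lemma prob_space_gauss: "0 < s \<Longrightarrow> prob_space (gauss s)"
  unfolding gauss_def by (rule prob_space_normal_density)

text \<open>Completing the square: the tilt by exp (c y) moves the mean to s^2 c, and the subtracted
  term is the normalisation.\<close>

lemma nn_integral_exp_gauss:
  assumes s: "0 < s"
  shows "(\<integral>\<^sup>+y. ennreal (exp (c * y - s\<^sup>2/2 * c\<^sup>2)) \<partial>gauss s) = 1"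
proof -
  have "normal_density 0 s y * exp (c * y - s\<^sup>2/2 * c\<^sup>2) = normal_density (s\<^sup>2 * c) s y" for y
  proof -
    have "-(y\<^sup>2) / (2 * s\<^sup>2) + (c * y - s\<^sup>2/2 * c\<^sup>2) = -((y - s\<^sup>2 * c)\<^sup>2) / (2 * s\<^sup>2)"
      using s by (simp add: field_simps power2_eq_square)
    then show ?thesis
      unfolding normal_density_def by (simp add: exp_add[symmetric])
  qed
  then have "(\<integral>\<^sup>+y. ennreal (exp (c * y - s\<^sup>2/2 * c\<^sup>2)) \<partial>gauss s)
      = (\<integral>\<^sup>+y. ennreal (normal_density (s\<^sup>2 * c) s y) \<partial>lborel)"
    unfolding gauss_def by (subst nn_integral_density) (auto simp: ennreal_mult[symmetric])
  also have "\<dots> = ennreal (\<integral>y. normal_density (s\<^sup>2 * c) s y \<partial>lborel)"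
    using s by (intro nn_integral_eq_integral) auto
  finally show ?thesis using s by simp
qed

text \<open>The coefficient \<open>c n\<close> depends only on coordinates below \<open>n\<close>.
  Integrating out coordinate \<open>n\<close> with the others fixed is therefore a Gaussian integral
  with constant \<open>c n\<close>, equal to 1, and \<open>n\<close> drops by one.\<close>

lemma nn_integral_exp_martingale:
  fixes c :: "nat \<Rightarrow> (nat \<Rightarrow> real) \<Rightarrow> real"
  assumes s: "0 < s"
    and c_meas: "\<And>j n. j \<le> n \<Longrightarrow> c j \<in> borel_measurable (PiM {..<n} (\<lambda>_. borel))"
    and c_pred: "\<And>i j \<omega> y. j \<le> i \<Longrightarrow> c j (fun_upd \<omega> i y) = c j \<omega>"
  shows "(\<integral>\<^sup>+\<omega>. ennreal (exp (\<Sum>j<n. c j \<omega> * \<omega> j - s\<^sup>2/2 * (c j \<omega>)\<^sup>2)) \<partial>PiM {..<n} (\<lambda>_. gauss s)) = 1"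
proof (induction n)
  case 0
  interpret P: prob_space "PiM {..<0::nat} (\<lambda>_. gauss s)"
    by (rule prob_space_PiM) (simp add: prob_space_gauss s)
  show ?case using P.emeasure_space_1 by simp
next
  case (Suc n)
  interpret prob_space "gauss s" using s by (rule prob_space_gauss)
  interpret product_sigma_finite "\<lambda>_::nat. gauss s" by standard
  have [measurable_cong]: "sets (PiM {..<m} (\<lambda>_. gauss s)) = sets (PiM {..<m} (\<lambda>_. borel))" for m :: nat
    by (rule sets_PiM_cong) auto
  let ?E = "\<lambda>n \<omega>. \<Sum>j<n. c j \<omega> * \<omega> j - s\<^sup>2/2 * (c j \<omega>)\<^sup>2"
  have E_meas: "?E m \<in> borel_measurable (PiM {..<m} (\<lambda>_. gauss s))" for m
  proof (intro borel_measurable_sum borel_measurable_diff borel_measurable_times borel_measurable_power borel_measurable_const)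
    fix j assume j: "j \<in> {..<m}"
    then have "c j \<in> borel_measurable (PiM {..<m} (\<lambda>_. borel))" by (intro c_meas) auto
    then show "c j \<in> borel_measurable (PiM {..<m} (\<lambda>_. gauss s))" "c j \<in> borel_measurable (PiM {..<m} (\<lambda>_. gauss s))"
      by measurable
    show "(\<lambda>\<omega>. \<omega> j) \<in> borel_measurable (PiM {..<m} (\<lambda>_. gauss s))"
      using j by measurable
  qed
  have ins: "{..<Suc n} = insert n {..<n}" by auto
  have "(\<integral>\<^sup>+\<omega>. ennreal (exp (?E (Suc n) \<omega>)) \<partial>PiM {..<Suc n} (\<lambda>_. gauss s)) =
    (\<integral>\<^sup>+\<omega>. (\<integral>\<^sup>+y. ennreal (exp (?E (Suc n) (fun_upd \<omega> n y))) \<partial>gauss s) \<partial>PiM {..<n} (\<lambda>_. gauss s))"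
  proof -
    have "(\<lambda>\<omega>. ennreal (exp (?E (Suc n) \<omega>))) \<in> borel_measurable (PiM {..<Suc n} (\<lambda>_. gauss s))"
      using E_meas[of "Suc n"] by measurable
    then show ?thesis unfolding ins by (intro product_nn_integral_insert) (auto simp flip: ins)
  qed
  also have "\<dots> = (\<integral>\<^sup>+\<omega>. ennreal (exp (?E n \<omega>)) \<partial>PiM {..<n} (\<lambda>_. gauss s))"
  proof (rule nn_integral_cong)
    fix \<omega> :: "nat \<Rightarrow> real"
    have "?E (Suc n) (fun_upd \<omega> n y) = ?E n \<omega> + (c n \<omega> * y - s\<^sup>2/2 * (c n \<omega>)\<^sup>2)" for y
      by (simp add: c_pred)
    then have "(\<integral>\<^sup>+y. ennreal (exp (?E (Suc n) (fun_upd \<omega> n y))) \<partial>gauss s)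
      = (\<integral>\<^sup>+y. ennreal (exp (?E n \<omega>)) * ennreal (exp (c n \<omega> * y - s\<^sup>2/2 * (c n \<omega>)\<^sup>2)) \<partial>gauss s)"
      by (simp only: exp_add ennreal_mult exp_ge_zero)
    also have "\<dots> = ennreal (exp (?E n \<omega>))"
      by (subst nn_integral_cmult) (use nn_integral_exp_gauss[OF s, of "c n \<omega>"] in auto)
    finally show "(\<integral>\<^sup>+y. ennreal (exp (?E (Suc n) (fun_upd \<omega> n y))) \<partial>gauss s) = ennreal (exp (?E n \<omega>))" .
  qed
  finally show ?case using Suc.IH by simp
qed

definition psum :: "(nat \<Rightarrow> real) \<Rightarrow> nat \<Rightarrow> real" where
  "psum \<omega> i = (\<Sum>k<i. \<omega> k)"

lemma smax_psum_measurable: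
  assumes "j \<le> n"
  shows "(\<lambda>\<omega>. smax (psum \<omega>) j) \<in> borel_measurable (PiM {..<n} (\<lambda>_. borel))"
proof -
  have p: "(\<lambda>\<omega>. psum \<omega> i) \<in> borel_measurable (PiM {..<n} (\<lambda>_. borel))" if "i \<le> n" for i
    unfolding psum_def
    by (intro borel_measurable_sum measurable_component_singleton) (use that in auto)
  show ?thesis using assms
  proof (induction j)
    case (Suc j)
    then show ?case using p[of "Suc j"] by simp
  qed (simp add: p)
qed

text \<open>Predictability: partial sums up to index \<open>j\<close> use only coordinates below
  \<open>j\<close>, so a function of this maximum is fixed before the increment with index
  \<open>j\<close> is seen.\<close>

lemma smax_psum_upd: "j \<le> i \<Longrightarrow> smax (psum (fun_upd \<omega> i y)) j = smax (psum \<omega>) j"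
  by (intro smax_cong) (simp add: psum_def)

section \<open>Gaussian random walks embedded in a Brownian path\<close>

locale brownian_motion = prob_space P for P :: "'a measure" +
  fixes B :: "real \<Rightarrow> 'a \<Rightarrow> real"
  assumes standard: "standard_brownian_motion P B"
begin

lemma B_measurable [measurable]: "0 \<le> t \<Longrightarrow> B t \<in> borel_measurable P"
  using standard by (auto simp: standard_brownian_motion_def)

lemma B_start: "AE \<omega> in P. B 0 \<omega> = 0"
  using standard by (auto simp: standard_brownian_motion_def)

lemma B_continuous: "\<omega> \<in> space P \<Longrightarrow> continuous_on {0..} (\<lambda>t. B t \<omega>)"
  using standard by (auto simp: standard_brownian_motion_def)

text \<open>Restricted to \<open>{..<Suc n}\<close> because the points of the product space are
  extensional functions.\<close>

definition increments :: "real \<Rightarrow> nat \<Rightarrow> 'a \<Rightarrow> nat \<Rightarrow> real" where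
  "increments T n \<omega> = (\<lambda>j\<in>{..<Suc n}. B (real (Suc j) * (T / real (Suc n))) \<omega> - B (real j * (T / real (Suc n))) \<omega>)"

lemma increments_measurable [measurable]:
  assumes "0 < T"
  shows "increments T n \<in> measurable P (PiM {..<Suc n} (\<lambda>_. borel))"
  unfolding increments_def
  by (intro measurable_restrict borel_measurable_diff B_measurable) (use assms in auto)

lemma distr_increments:
  assumes T: "0 < T"
  shows "distr P (PiM {..<Suc n} (\<lambda>_. borel)) (increments T n) = PiM {..<Suc n} (\<lambda>_. gauss (sqrt (T / real (Suc n))))"
proof -
  define h where "h = T / real (Suc n)"
  have h: "h > 0" using T by (simp add: h_def)
  define t where "t = (\<lambda>j. real j * h)"
  let ?X = "\<lambda>i \<omega>. B (t (Suc i)) \<omega> - B (t i) \<omega>"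
  have t0: "0 \<le> t j" for j using h by (simp add: t_def)
  have tS: "t j < t (Suc j)" for j using h by (simp add: t_def)
  have m: "?X i \<in> borel_measurable P" for i using t0 by measurable
  have "strict_mono_on {..Suc n} t" using h by (auto simp: strict_mono_on_def t_def)
  then have ind: "indep_vars (\<lambda>_. borel) ?X {..<Suc n}"
    using standard t0 unfolding standard_brownian_motion_def by blast
  have d: "distr P borel (?X i) = gauss (sqrt h)" for i
  proof -
    have "distributed P lborel (?X i) (\<lambda>x. ennreal (normal_density 0 (sqrt (t (Suc i) - t i)) x))"
      using standard t0 tS unfolding standard_brownian_motion_def by blast
    moreover have "t (Suc i) - t i = h" by (simp add: t_def algebra_simps)
    ultimately have "distr P lborel (?X i) = gauss (sqrt h)"
      by (simp add: distributed_def gauss_def)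
    then show ?thesis by (simp cong: distr_cong)
  qed
  have "distr P (PiM {..<Suc n} (\<lambda>_. borel)) (\<lambda>\<omega>. \<lambda>i\<in>{..<Suc n}. ?X i \<omega>) = PiM {..<Suc n} (\<lambda>i. distr P borel (?X i))"
    using indep_vars_iff_distr_eq_PiM'[where M'="\<lambda>_. borel" and X = ?X and I="{..<Suc n}"] m ind by auto
  then show ?thesis unfolding d by (simp add: increments_def[abs_def] h_def t_def)
qed

lemma nn_integral_increments:
  assumes "0 < T" and [measurable]: "F \<in> borel_measurable (PiM {..<Suc n} (\<lambda>_. borel))"
  shows "(\<integral>\<^sup>+\<omega>. F (increments T n \<omega>) \<partial>P) = (\<integral>\<^sup>+\<omega>. F \<omega> \<partial>PiM {..<Suc n} (\<lambda>_. gauss (sqrt (T / real (Suc n)))))"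
  using assms(1) by (subst distr_increments[symmetric]) (auto simp: nn_integral_distr)

text \<open>Increments telescope from \<open>B 0\<close>, which vanishes only almost everywhere;
  hence the same for the conclusion.\<close>

lemma smax_grid_increments:
  assumes T: "0 < T"
  shows "AE \<omega> in P. \<forall>j\<le>Suc n. grid (\<lambda>t. B t \<omega>) T n j = psum (increments T n \<omega>) j \<and>
     smax (grid (\<lambda>t. B t \<omega>) T n) j = smax (psum (increments T n \<omega>)) j"
  using B_start
proof eventually_elim
  case (elim \<omega>)
  have g: "grid (\<lambda>t. B t \<omega>) T n j = psum (increments T n \<omega>) j" if "j \<le> Suc n" for j
    using that
  proof (induction j)
    case 0
    then show ?case using elim by (simp add: grid_def psum_def)
  next
    case (Suc j)
    then show ?case by (simp add: psum_def grid_def increments_def)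
  qed
  then show ?case by (auto intro!: smax_cong)
qed

text \<open>The final value of the exponential martingale of the walk on the grid: steps have
  variance T / (n + 1), and \<open>th\<close> is evaluated at the maximum before each step, which
  makes the integrand predictable.\<close>

definition expmart :: "(real \<Rightarrow> real) \<Rightarrow> real \<Rightarrow> nat \<Rightarrow> 'a \<Rightarrow> real" where
  "expmart th T n \<omega> = (let g = grid (\<lambda>t. B t \<omega>) T n in
     exp (\<Sum>j<Suc n. th (smax g j) * (g (Suc j) - g j) - T / real (Suc n) / 2 * (th (smax g j))\<^sup>2))"

lemma grid_measurable [measurable]:
  "0 < T \<Longrightarrow> (\<lambda>\<omega>. grid (\<lambda>t. B t \<omega>) T n j) \<in> borel_measurable P"
  unfolding grid_def by measurable

lemma smax_grid_measurable [measurable]: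
  "0 < T \<Longrightarrow> (\<lambda>\<omega>. smax (grid (\<lambda>t. B t \<omega>) T n) j) \<in> borel_measurable P"
  by (induction j) auto

lemma expmart_measurable [measurable]:
  assumes [measurable]: "th \<in> borel_measurable borel" and "0 < T"
  shows "expmart th T n \<in> borel_measurable P"
proof -
  note [measurable] = grid_measurable[OF \<open>0 < T\<close>] smax_grid_measurable[OF \<open>0 < T\<close>]
  show ?thesis unfolding expmart_def[abs_def] Let_def by measurable
qed

lemma nn_integral_expmart:
  assumes [measurable]: "th \<in> borel_measurable borel" and T: "0 < T"
  shows "(\<integral>\<^sup>+\<omega>. ennreal (expmart th T n \<omega>) \<partial>P) = 1"
proof -
  define h where "h = T / real (Suc n)"
  have h: "h > 0" using T by (simp add: h_def)
  let ?c = "\<lambda>j \<omega>. th (smax (psum \<omega>) j)"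
  let ?F = "\<lambda>\<omega>. ennreal (exp (\<Sum>j<Suc n. ?c j \<omega> * \<omega> j - (sqrt h)\<^sup>2/2 * (?c j \<omega>)\<^sup>2))"
  have c_meas: "?c j \<in> borel_measurable (PiM {..<m} (\<lambda>_. borel))" if "j \<le> m" for j m
    using smax_psum_measurable[OF that] by measurable
  have F_meas: "?F \<in> borel_measurable (PiM {..<Suc n} (\<lambda>_. borel))"
  proof -
    have "(\<lambda>\<omega>. \<Sum>j<Suc n. ?c j \<omega> * \<omega> j - (sqrt h)\<^sup>2/2 * (?c j \<omega>)\<^sup>2) \<in> borel_measurable (PiM {..<Suc n} (\<lambda>_. borel))"
      by (intro borel_measurable_sum borel_measurable_diff borel_measurable_times borel_measurable_power
          borel_measurable_const c_meas measurable_component_singleton) auto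
    then show ?thesis by measurable
  qed
  have "(\<integral>\<^sup>+\<omega>. ennreal (expmart th T n \<omega>) \<partial>P) = (\<integral>\<^sup>+\<omega>. ?F (increments T n \<omega>) \<partial>P)"
  proof (rule nn_integral_cong_AE)
    show "AE \<omega> in P. ennreal (expmart th T n \<omega>) = ?F (increments T n \<omega>)"
      using smax_grid_increments[OF T, of n]
    proof eventually_elim
      case (elim \<omega>)
      let ?g = "grid (\<lambda>t. B t \<omega>) T n"
      have "(\<Sum>j<Suc n. th (smax ?g j) * (?g (Suc j) - ?g j) - h/2 * (th (smax ?g j))\<^sup>2) =
        (\<Sum>j<Suc n. ?c j (increments T n \<omega>) * increments T n \<omega> j - (sqrt h)\<^sup>2/2 * (?c j (increments T n \<omega>))\<^sup>2)"
      proof (rule sum.cong[OF refl])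
        fix j assume "j \<in> {..<Suc n}"
        then have j: "j \<le> Suc n" "Suc j \<le> Suc n" by auto
        show "th (smax ?g j) * (?g (Suc j) - ?g j) - h/2 * (th (smax ?g j))\<^sup>2 =
          ?c j (increments T n \<omega>) * increments T n \<omega> j - (sqrt h)\<^sup>2/2 * (?c j (increments T n \<omega>))\<^sup>2"
          using elim[rule_format, OF j(1)] elim[rule_format, OF j(2)] h by (simp add: psum_def del: smax.simps)
      qed
      then show ?case by (simp only: expmart_def Let_def h_def)
    qed
  qed
  also have "\<dots> = (\<integral>\<^sup>+\<omega>. ?F \<omega> \<partial>PiM {..<Suc n} (\<lambda>_. gauss (sqrt h)))"
    unfolding h_def[symmetric] by (rule nn_integral_increments[OF T F_meas, folded h_def])
  also have "\<dots> = 1"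
    by (rule nn_integral_exp_martingale) (use h c_meas in \<open>auto simp: smax_psum_upd\<close>)
  finally show ?thesis .
qed

text \<open>With h the mesh, twice the exponent for \<open>th\<close> is the exponent for
  \<open>2 * th\<close> plus the sum of h th^2, and that sum is at most K^2 T. The second moment is
  thus reduced to the first-moment identity for \<open>2 * th\<close>.\<close>

lemma nn_integral_expmart_square:
  assumes [measurable]: "th \<in> borel_measurable borel" and T: "0 < T" and K: "\<And>s. \<bar>th s\<bar> \<le> K"
  shows "(\<integral>\<^sup>+\<omega>. ennreal ((expmart th T n \<omega>)\<^sup>2) \<partial>P) \<le> ennreal (exp (K\<^sup>2 * T))"
proof -
  have "(expmart th T n \<omega>)\<^sup>2 \<le> exp (K\<^sup>2 * T) * expmart (\<lambda>s. 2 * th s) T n \<omega>" for \<omega>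
  proof -
    define g where "g = grid (\<lambda>t. B t \<omega>) T n"
    define h where "h = T / real (Suc n)"
    have h: "h > 0" using T by (simp add: h_def)
    have "(\<Sum>j<Suc n. h * (th (smax g j))\<^sup>2) \<le> (\<Sum>j<Suc n. h * K\<^sup>2)"
      using K h by (intro sum_mono mult_left_mono) (auto simp: abs_le_square_iff[symmetric] intro: order.trans[OF K])
    also have "\<dots> = K\<^sup>2 * T" by (simp add: h_def)
    finally have le: "(\<Sum>j<Suc n. h * (th (smax g j))\<^sup>2) \<le> K\<^sup>2 * T" .
    have "(expmart th T n \<omega>)\<^sup>2 = exp (2 * (\<Sum>j<Suc n. th (smax g j) * (g (Suc j) - g j) - h/2 * (th (smax g j))\<^sup>2))"
      by (simp only: expmart_def Let_def g_def h_def exp_double)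
    also have "2 * (\<Sum>j<Suc n. th (smax g j) * (g (Suc j) - g j) - h/2 * (th (smax g j))\<^sup>2) =
      (\<Sum>j<Suc n. h * (th (smax g j))\<^sup>2) + (\<Sum>j<Suc n. 2 * th (smax g j) * (g (Suc j) - g j) - h/2 * (2 * th (smax g j))\<^sup>2)"
      unfolding sum_distrib_left sum.distrib[symmetric]
      by (intro sum.cong refl) (simp add: power2_eq_square field_simps)
    also have "exp \<dots> \<le> exp (K\<^sup>2 * T) * exp (\<Sum>j<Suc n. 2 * th (smax g j) * (g (Suc j) - g j) - h/2 * (2 * th (smax g j))\<^sup>2)"
      unfolding exp_add using le by (intro mult_right_mono) (auto simp del: sum.lessThan_Suc)
    finally show ?thesis by (simp only: expmart_def Let_def g_def h_def)
  qed
  then have "(\<integral>\<^sup>+\<omega>. ennreal ((expmart th T n \<omega>)\<^sup>2) \<partial>P)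
     \<le> (\<integral>\<^sup>+\<omega>. ennreal (exp (K\<^sup>2 * T)) * ennreal (expmart (\<lambda>s. 2 * th s) T n \<omega>) \<partial>P)"
    by (intro nn_integral_mono) (simp add: ennreal_mult[symmetric] expmart_def Let_def)
  also have "\<dots> = ennreal (exp (K\<^sup>2 * T))"
    using T by (subst nn_integral_cmult) (auto simp: nn_integral_expmart)
  finally show ?thesis .
qed

end

text \<open>A bound in \<open>L\<^sup>2\<close> gives the uniform integrability that carries the expectation to the limit.\<close>

lemma (in prob_space) expectation_limit_of_L2_bounded:
  fixes X :: "nat \<Rightarrow> 'a \<Rightarrow> real"
  assumes X[measurable]: "\<And>n. X n \<in> borel_measurable M" and Y[measurable]: "Y \<in> borel_measurable M"
    and nonneg: "\<And>n \<omega>. 0 \<le> X n \<omega>"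
    and one: "\<And>n. (\<integral>\<^sup>+\<omega>. ennreal (X n \<omega>) \<partial>M) = 1"
    and sq: "\<And>n. (\<integral>\<^sup>+\<omega>. ennreal ((X n \<omega>)\<^sup>2) \<partial>M) \<le> ennreal C"
    and lim: "AE \<omega> in M. (\<lambda>n. X n \<omega>) \<longlonglongrightarrow> Y \<omega>"
    and bound: "AE \<omega> in M. Y \<omega> \<le> R"
  shows "expectation Y = 1"
proof -
  define C' where "C' = max C 0"
  have C': "0 \<le> C'" by (simp add: C'_def)
  have sq': "(\<integral>\<^sup>+\<omega>. ennreal ((X n \<omega>)\<^sup>2) \<partial>M) \<le> ennreal C'" for n
    using sq[of n] by (rule order.trans) (auto simp: C'_def intro: ennreal_leI)
  have sqi: "integrable M (\<lambda>\<omega>. (X n \<omega>)\<^sup>2)" for n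
    by (rule integrableI_bounded) (use sq'[of n] in \<open>auto simp: power2_eq_square intro: le_less_trans\<close>)
  have sqC: "expectation (\<lambda>\<omega>. (X n \<omega>)\<^sup>2) \<le> C'" for n
    using sq'[of n] nn_integral_eq_integral[OF sqi[of n]] C' by (simp add: ennreal_le_iff)
  have Xi: "integrable M (X n)" for n
    by (rule integrableI_bounded) (use one[of n] nonneg in \<open>auto simp: abs_of_nonneg\<close>)
  have X1: "expectation (X n) = 1" for n
    using one[of n] nn_integral_eq_integral[OF Xi[of n]] nonneg by (simp add: ennreal_eq_1)
  \<comment> \<open>Truncating at r >= R leaves the limit unchanged and allows dominated
    convergence. What is cut off is at most X^2 / r, with expectation at most C' / r uniformly in
    n.\<close>
  have key: "\<bar>1 - expectation Y\<bar> \<le> C' / r" if r: "r > 0" "r \<ge> R" for r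
  proof -
    have mi: "integrable M (\<lambda>\<omega>. min (X n \<omega>) r)" for n
      by (rule integrable_const_bound[of _ r]) (use nonneg r in auto)
    have "(\<lambda>n. expectation (\<lambda>\<omega>. min (X n \<omega>) r)) \<longlonglongrightarrow> expectation Y"
    proof (rule integral_dominated_convergence[where w="\<lambda>_. r"])
      show "AE \<omega> in M. (\<lambda>n. min (X n \<omega>) r) \<longlonglongrightarrow> Y \<omega>"
        using lim bound
      proof eventually_elim
        case (elim \<omega>)
        have "(\<lambda>n. min (X n \<omega>) r) \<longlonglongrightarrow> min (Y \<omega>) r" using elim by (intro tendsto_intros)
        then show ?case using elim r by (simp add: min_absorb1)
      qed
    qed (use nonneg r in auto)
    then have L: "(\<lambda>n. 1 - expectation (\<lambda>\<omega>. min (X n \<omega>) r)) \<longlonglongrightarrow> 1 - expectation Y"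
      by (intro tendsto_intros)
    have "\<bar>1 - expectation (\<lambda>\<omega>. min (X n \<omega>) r)\<bar> \<le> C' / r" for n
    proof -
      have pt: "0 \<le> x - min x r \<and> x - min x r \<le> x\<^sup>2 / r" if "0 \<le> x" for x
      proof (cases "x \<le> r")
        case False
        then have "r * x \<le> x * x" using r by (intro mult_right_mono) auto
        then have "x \<le> x\<^sup>2 / r" using r by (simp add: field_simps power2_eq_square)
        then show ?thesis using False r by auto
      qed (use r in auto)
      have eq: "1 - expectation (\<lambda>\<omega>. min (X n \<omega>) r) = expectation (\<lambda>\<omega>. X n \<omega> - min (X n \<omega>) r)"
        using Xi mi X1 by simp
      have "0 \<le> expectation (\<lambda>\<omega>. X n \<omega> - min (X n \<omega>) r)"
        using pt nonneg by (intro integral_nonneg_AE) auto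
      moreover have "expectation (\<lambda>\<omega>. X n \<omega> - min (X n \<omega>) r) \<le> expectation (\<lambda>\<omega>. (X n \<omega>)\<^sup>2 / r)"
        using pt nonneg Xi mi sqi by (intro integral_mono) auto
      moreover have "expectation (\<lambda>\<omega>. (X n \<omega>)\<^sup>2 / r) \<le> C' / r"
        using sqC[of n] r by (simp add: divide_right_mono)
      ultimately show ?thesis unfolding eq by simp
    qed
    then show ?thesis using L
      by (intro LIMSEQ_le_const2[OF tendsto_rabs[OF L]]) auto
  qed
  have "\<bar>1 - expectation Y\<bar> \<le> 0"
  proof (rule LIMSEQ_le_const)
    show "(\<lambda>n. C' / real n) \<longlonglongrightarrow> 0" by (rule lim_const_over_n)
    show "\<exists>N. \<forall>n\<ge>N. \<bar>1 - expectation Y\<bar> \<le> C' / real n"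
    proof (intro exI allI impI key)
      fix n assume n: "n \<ge> Suc (nat \<lceil>R\<rceil>)"
      then show "0 < real n" by simp
      show "R \<le> real n" using n by linarith
    qed
  qed
  then show ?thesis by simp
qed

section \<open>Measurability of the running maximum, and the limit of the exponential
  martingales\<close>

context brownian_motion
begin

lemma running_max_eq: "running_max B t \<omega> = path_max (\<lambda>t. B t \<omega>) t"
  by (simp add: running_max_def path_max_def)

lemma running_max_continuous: "\<omega> \<in> space P \<Longrightarrow> continuous_on {0..} (\<lambda>t. running_max B t \<omega>)"
  unfolding running_max_eq using path_max_continuous[OF B_continuous] by simp

lemma running_max_mono: "\<omega> \<in> space P \<Longrightarrow> 0 \<le> s \<Longrightarrow> s \<le> t \<Longrightarrow> running_max B s \<omega> \<le> running_max B t \<omega>"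
  unfolding running_max_eq by (rule path_max_mono[OF B_continuous])

lemma running_max_ge: "\<omega> \<in> space P \<Longrightarrow> 0 \<le> t \<Longrightarrow> B t \<omega> \<le> running_max B t \<omega>"
  unfolding running_max_eq by (intro path_max_ge B_continuous) auto

lemma running_max_nonneg: "\<omega> \<in> space P \<Longrightarrow> B 0 \<omega> = 0 \<Longrightarrow> 0 \<le> t \<Longrightarrow> 0 \<le> running_max B t \<omega>"
  using running_max_mono[of \<omega> 0 t] by (simp add: running_max_eq)

lemma running_max_measurable_at [measurable]: "(\<lambda>\<omega>. running_max B t \<omega>) \<in> borel_measurable P"
proof -
  consider "t < 0" | "t = 0" | "t > 0" by linarith
  then show ?thesis
  proof cases
    case 1
    \<comment> \<open>For t < 0 the supremum is taken over the empty set and is a constant, whatever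
      \<omega> is.\<close>
    then show ?thesis by (simp add: running_max_def)
  next
    case 2
    then show ?thesis by (simp add: running_max_eq)
  next
    case 3
    show ?thesis
    proof (rule borel_measurable_LIMSEQ_real)
      show "(\<lambda>n. smax (grid (\<lambda>t. B t \<omega>) t n) (Suc n)) \<longlonglongrightarrow> running_max B t \<omega>" if "\<omega> \<in> space P" for \<omega>
        unfolding running_max_eq by (rule smax_grid_tendsto[OF B_continuous[OF that] 3])
    qed (use smax_grid_measurable[OF 3] in blast)
  qed
qed

text \<open>Time is rounded down to multiples of 1 / (n + 1). These are countably many values, so
  measurability at fixed times suffices for the approximations, and continuity of the running
  maximum in time gives the limit.\<close>

lemma running_max_measurable [measurable]:
  "(\<lambda>(t, \<omega>). running_max B t \<omega>) \<in> borel_measurable (borel \<Otimes>\<^sub>M P)"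
proof (rule borel_measurable_LIMSEQ_real)
  let ?u = "\<lambda>n p. running_max B (real_of_int \<lfloor>real (Suc n) * fst p\<rfloor> / real (Suc n)) (snd p)"
  show "?u n \<in> borel_measurable (borel \<Otimes>\<^sub>M P)" for n
  proof (rule measurable_compose_countable[where f="\<lambda>i p. running_max B (real_of_int i / real (Suc n)) (snd p)"
        and g="\<lambda>p. \<lfloor>real (Suc n) * fst p\<rfloor>"])
    show "(\<lambda>p. running_max B (real_of_int i / real (Suc n)) (snd p)) \<in> borel_measurable (borel \<Otimes>\<^sub>M P)" for i
      by (rule measurable_compose[OF measurable_snd running_max_measurable_at])
  qed measurable
  show "(\<lambda>n. ?u n p) \<longlonglongrightarrow> (case p of (t, \<omega>) \<Rightarrow> running_max B t \<omega>)" if "p \<in> space (borel \<Otimes>\<^sub>M P)" for p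
  proof -
    obtain t \<omega> where p: "p = (t, \<omega>)" by force
    have \<omega>: "\<omega> \<in> space P" using that p by (auto simp: space_pair_measure)
    let ?t = "\<lambda>n. real_of_int \<lfloor>real (Suc n) * t\<rfloor> / real (Suc n)"
    have lim: "?t \<longlonglongrightarrow> t"
    proof (rule tendsto_sandwich[where f="\<lambda>n. t - 1 / real (Suc n)" and h="\<lambda>_. t"])
      have "(\<lambda>n. 1 / real (Suc n)) \<longlonglongrightarrow> 0" by (rule LIMSEQ_Suc) (rule lim_const_over_n)
      then show "(\<lambda>n. t - 1 / real (Suc n)) \<longlonglongrightarrow> t" using tendsto_diff[OF tendsto_const] by fastforce
      show "\<forall>\<^sub>F n in sequentially. t - 1 / real (Suc n) \<le> ?t n"
      proof (intro always_eventually allI)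
        fix n
        have "real (Suc n) * t - 1 \<le> real_of_int \<lfloor>real (Suc n) * t\<rfloor>" by linarith
        then have "(real (Suc n) * t - 1) / real (Suc n) \<le> ?t n" by (intro divide_right_mono) auto
        then show "t - 1 / real (Suc n) \<le> ?t n" by (simp add: diff_divide_distrib)
      qed
      show "\<forall>\<^sub>F n in sequentially. ?t n \<le> t"
        by (intro always_eventually allI) (simp add: pos_divide_le_eq mult.commute)
    qed auto
    show ?thesis
    proof (cases "t < 0")
      \<comment> \<open>Rounding down keeps a negative time negative, so the approximations and the
        limit are the same supremum over the empty set.\<close>
      case True
      have "?t n < 0" for n
      proof -
        have "real (Suc n) * t < 0" using True by (intro mult_pos_neg) auto
        then have "\<lfloor>real (Suc n) * t\<rfloor> < 0" by simp
        then show ?thesis by (simp add: divide_less_0_iff)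
      qed
      then show ?thesis using True by (simp add: p running_max_def)
    next
      case False
      have "(\<lambda>n. running_max B (?t n) \<omega>) \<longlonglongrightarrow> running_max B t \<omega>"
        by (rule continuous_on_tendsto_compose[OF running_max_continuous[OF \<omega>] lim])
           (use False in auto)
      then show ?thesis by (simp add: p)
    qed
  qed
qed

lemma running_max_measurable' [measurable (raw)]:
  assumes [measurable]: "f \<in> borel_measurable M" "g \<in> measurable M P"
  shows "(\<lambda>x. running_max B (f x) (g x)) \<in> borel_measurable M"
  using measurable_compose[OF measurable_Pair[OF assms] running_max_measurable] by simp

text \<open>After \<open>smax_abel\<close> the exponent contains a Stieltjes sum against the
  discrete maximum, an end value and a Riemann sum, but no sum against the increments of
  \<open>B\<close>. Each of the three converges for every path.\<close>

lemma expmart_tendsto: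
  assumes \<omega>: "\<omega> \<in> space P" and T: "0 < T" and th: "continuous_on UNIV th"
    and V: "\<And>x. (V has_real_derivative th x) (at x)"
  shows "(\<lambda>n. expmart th T n \<omega>) \<longlonglongrightarrow>
    exp (V (running_max B T \<omega>) - V (B 0 \<omega>) - th (running_max B T \<omega>) * (running_max B T \<omega> - B T \<omega>)
       - integral {0..T} (\<lambda>t. (th (running_max B t \<omega>))\<^sup>2 / 2))"
proof -
  let ?b = "\<lambda>t. B t \<omega>"
  let ?g = "\<lambda>n. grid ?b T n"
  have b: "continuous_on {0..} ?b" using \<omega> by (rule B_continuous)
  have eq: "expmart th T n \<omega> = exp ((\<Sum>j<Suc n. th (smax (?g n) j) * (smax (?g n) (Suc j) - smax (?g n) j))
     - th (smax (?g n) (Suc n)) * (smax (?g n) (Suc n) - B T \<omega>)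
     - (\<Sum>j<Suc n. (th (smax (?g n) j))\<^sup>2 / 2 * (T / real (Suc n))))" for n
  proof -
    have "?g n (Suc n) = B T \<omega>" by (simp add: grid_def)
    moreover have "(\<Sum>j<Suc n. th (smax (?g n) j) * (?g n (Suc j) - ?g n j) - T / real (Suc n) / 2 * (th (smax (?g n) j))\<^sup>2)
      = (\<Sum>j<Suc n. th (smax (?g n) j) * (?g n (Suc j) - ?g n j)) - (\<Sum>j<Suc n. (th (smax (?g n) j))\<^sup>2 / 2 * (T / real (Suc n)))"
      unfolding sum_subtractf by (simp only: mult.commute times_divide_eq_left times_divide_eq_right)
    ultimately show ?thesis unfolding expmart_def Let_def by (simp only: smax_abel)
  qed
  have "(\<lambda>n. th (smax (?g n) (Suc n)) * (smax (?g n) (Suc n) - B T \<omega>)) \<longlonglongrightarrow>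
     th (path_max ?b T) * (path_max ?b T - B T \<omega>)"
    using smax_grid_tendsto[OF b T] continuous_on_tendsto_compose[OF th smax_grid_tendsto[OF b T]]
    by (intro tendsto_intros) auto
  moreover have "(\<lambda>n. \<Sum>j<Suc n. (th (smax (?g n) j))\<^sup>2 / 2 * (T / real (Suc n)))
    \<longlonglongrightarrow> integral {0..T} (\<lambda>t. (th (path_max ?b t))\<^sup>2 / 2)"
    by (rule riemann_smax_tendsto[OF b T]) (intro continuous_intros th; simp)
  ultimately show ?thesis
    unfolding eq running_max_eq using stieltjes_smax_tendsto[OF b T th V]
    by (intro tendsto_exp tendsto_diff)
qed

text \<open>The bound \<open>K\<close> on \<open>th\<close> gives the bound in L^2. As
  \<open>th\<close> is nonnegative and vanishes from \<open>c\<close> on, \<open>V\<close> is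
  largest at \<open>c\<close>, so the limit variable is at most exp (V c), the bound that the
  truncation argument asks for. The maximality of \<open>V c\<close> is also a conclusion, since it
  later dominates a whole sequence of such variables.\<close>

lemma exponential_martingale_identity:
  assumes T: "0 < T" and th: "continuous_on UNIV th"
    and V: "\<And>x. (V has_real_derivative th x) (at x)" and V0: "V 0 = 0"
    and th0: "\<And>s. 0 \<le> th s" and K: "\<And>s. th s \<le> K" and c: "\<And>s. c \<le> s \<Longrightarrow> th s = 0"
  shows "expectation (\<lambda>\<omega>. exp (V (running_max B T \<omega>) - th (running_max B T \<omega>) * (running_max B T \<omega> - B T \<omega>)
       - (LBINT t:{0..T}. (th (running_max B t \<omega>))\<^sup>2 / 2))) = 1" (is "expectation ?Y = 1")
    and "V s \<le> V c"
proof -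
  have [measurable]: "th \<in> borel_measurable borel" using th by (rule borel_measurable_continuous_onI)
  have "continuous_on UNIV V" using V DERIV_isCont by (auto intro!: continuous_at_imp_continuous_on)
  then have [measurable]: "V \<in> borel_measurable borel" by (rule borel_measurable_continuous_onI)
  have [measurable]: "B T \<in> borel_measurable P" using T by auto
  show Vc: "V s \<le> V c" for s
  proof (cases "s \<le> c")
    case True
    then show ?thesis by (rule DERIV_nonneg_imp_nondecreasing) (use V th0 in blast)
  next
    case False
    then obtain z where "z > c" "V s - V c = (s - c) * th z" using MVT2[of c s V th] V by auto
    then show ?thesis using c[of z] by simp
  qed
  show "expectation ?Y = 1"
  proof (rule expectation_limit_of_L2_bounded[where X="\<lambda>n. expmart th T n" and R="exp (V c)" and C="exp (K\<^sup>2 * T)"])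
    show "expmart th T n \<in> borel_measurable P" for n using T by simp
    show "?Y \<in> borel_measurable P" unfolding set_lebesgue_integral_def by measurable
    show "0 \<le> expmart th T n \<omega>" for n \<omega> by (simp add: expmart_def Let_def)
    show "(\<integral>\<^sup>+\<omega>. ennreal (expmart th T n \<omega>) \<partial>P) = 1" for n by (rule nn_integral_expmart) (use T in auto)
    show "(\<integral>\<^sup>+\<omega>. ennreal ((expmart th T n \<omega>)\<^sup>2) \<partial>P) \<le> ennreal (exp (K\<^sup>2 * T))" for n
      by (rule nn_integral_expmart_square) (use T th0 K in auto)
    show "AE \<omega> in P. (\<lambda>n. expmart th T n \<omega>) \<longlonglongrightarrow> ?Y \<omega>"
      using B_start AE_space
    proof eventually_elim
      case (elim \<omega>)
      have "continuous_on {0..T} (\<lambda>t. (th (running_max B t \<omega>))\<^sup>2 / 2)"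
        by (intro continuous_intros continuous_on_compose2[OF th]
            continuous_on_subset[OF running_max_continuous[OF elim(2)]]) auto
      from set_borel_integral_eq_integral(2)[OF borel_integrable_atLeastAtMost'[OF this]]
      show ?case using expmart_tendsto[OF elim(2) T th V] elim V0 by simp
    qed
    show "AE \<omega> in P. ?Y \<omega> \<le> exp (V c)"
      using AE_space
    proof eventually_elim
      case (elim \<omega>)
      have "0 \<le> th (running_max B T \<omega>) * (running_max B T \<omega> - B T \<omega>)"
        using th0 running_max_ge[OF elim, of T] T by (intro mult_nonneg_nonneg) auto
      moreover have "0 \<le> (LBINT t:{0..T}. (th (running_max B t \<omega>))\<^sup>2 / 2)"
        unfolding set_lebesgue_integral_def by (intro integral_nonneg_AE) auto
      ultimately show ?case using Vc[of "running_max B T \<omega>"] by simp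
    qed
  qed
qed

end

section \<open>First passage functionals\<close>

lemma antiderivative_exists:
  fixes f :: "real \<Rightarrow> real"
  assumes "continuous_on UNIV f"
  obtains V where "V 0 = 0" "\<And>x. (V has_real_derivative f x) (at x)"
proof -
  obtain F where F: "\<And>x. (F has_vector_derivative f x) (at x)"
    using einterval_antiderivative[of "-\<infinity>" "\<infinity>" f] assms
    by (auto simp: continuous_on_eq_continuous_at)
  have "((\<lambda>x. F x - F 0) has_real_derivative f x) (at x)" for x
    using F[of x] unfolding has_real_derivative_iff_has_vector_derivative[symmetric]
    by (auto intro!: derivative_eq_intros)
  then show ?thesis using that[of "\<lambda>x. F x - F 0"] by simp
qed

text \<open>Half its square is the rate 1 + l s when l > 0 and s >= 0; \<open>max 0 s\<close> keeps
  it nonnegative on the whole line.\<close>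

definition drift :: "real \<Rightarrow> real \<Rightarrow> real" where
  "drift l s = sqrt (2 * (1 + l * max 0 s))"

text \<open>The antiderivative of \<open>drift l\<close> on s >= 0 that vanishes at 0, for l > 0.
  Then, for x >= 0, \<open>exp (- potential l x)\<close> is the limit of the expectation of
  \<open>killing l x T\<close> as T grows.\<close>

definition potential :: "real \<Rightarrow> real \<Rightarrow> real" where
  "potential l s = sqrt 2 * 2 / (3 * l) * ((1 + l * s) powr (3/2) - 1)"

lemma potential_0 [simp]: "potential l 0 = 0"
  by (simp add: potential_def)

lemma DERIV_potential:
  assumes l: "0 < l" and s: "0 \<le> s"
  shows "(potential l has_real_derivative drift l s) (at s)"
proof -
  have pos: "0 < 1 + l * s" using l s by (simp add: add_pos_nonneg)
  have "(potential l has_real_derivative sqrt 2 * 2 / (3 * l) * (3/2 * (1 + l * s) powr (3/2 - 1) * l)) (at s)"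
    unfolding potential_def[abs_def]
    by (rule derivative_eq_intros refl | use pos in simp)+
  moreover have "sqrt 2 * 2 / (3 * l) * (3/2 * (1 + l * s) powr (3/2 - 1) * l) = drift l s"
    using pos l s by (simp add: drift_def powr_half_sqrt distrib_left flip: real_sqrt_mult)
  ultimately show ?thesis by simp
qed

lemma continuous_drift: "0 < l \<Longrightarrow> continuous_on UNIV (drift l)"
  unfolding drift_def by (intro continuous_intros)

text \<open>The drift restricted to \<open>s \<le> x\<close>, made continuous because the martingale identity needs it.\<close>

definition cutoff_drift :: "real \<Rightarrow> real \<Rightarrow> nat \<Rightarrow> real \<Rightarrow> real" where
  "cutoff_drift l x k s = drift l s * max 0 (min 1 (1 - real (Suc k) * (s - x)))"

lemma cutoff_drift_below: "s \<le> x \<Longrightarrow> cutoff_drift l x k s = drift l s"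
  by (simp add: cutoff_drift_def min_absorb1 max_absorb2 mult_nonneg_nonpos)

lemma cutoff_drift_above: "x + 1 / real (Suc k) \<le> s \<Longrightarrow> cutoff_drift l x k s = 0"
proof -
  assume "x + 1 / real (Suc k) \<le> s"
  then have "1 / real (Suc k) \<le> s - x" by simp
  then have "1 \<le> real (Suc k) * (s - x)" by (simp add: field_simps)
  then show ?thesis by (simp add: cutoff_drift_def max_absorb1)
qed

lemma cutoff_drift_nonneg: "0 < l \<Longrightarrow> 0 \<le> cutoff_drift l x k s"
  unfolding cutoff_drift_def drift_def by (intro mult_nonneg_nonneg) auto

text \<open>The cut-off ends at x + 1 at the latest, so one bound serves all \<open>k\<close> and
  provides dominating functions for the limit in \<open>k\<close>.\<close>

lemma cutoff_drift_le:
  assumes "0 < l" "0 \<le> x"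
  shows "cutoff_drift l x k s \<le> drift l (x + 1)"
proof (cases "s \<le> x + 1")
  case True
  have "cutoff_drift l x k s \<le> drift l s * 1"
    unfolding cutoff_drift_def using assms by (intro mult_left_mono) (auto simp: drift_def)
  also have "\<dots> \<le> drift l (x + 1)"
    unfolding drift_def using assms True by (auto intro!: mult_left_mono)
  finally show ?thesis .
next
  case False
  have "1 / real (Suc k) \<le> 1" by simp
  then have "cutoff_drift l x k s = 0" using False by (intro cutoff_drift_above) linarith
  then show ?thesis using assms by (simp add: drift_def)
qed

lemma continuous_cutoff_drift: "0 < l \<Longrightarrow> continuous_on UNIV (cutoff_drift l x k)"
  unfolding cutoff_drift_def by (intro continuous_intros continuous_drift)

lemma eventually_cutoff_drift_above:
  assumes "x < s"
  shows "\<forall>\<^sub>F k in sequentially. x + 1 / real (Suc k) \<le> s"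
proof -
  have "(\<lambda>k. 1 / real (Suc k)) \<longlonglongrightarrow> 0" by (rule LIMSEQ_Suc) (rule lim_const_over_n)
  then have "\<forall>\<^sub>F k in sequentially. 1 / real (Suc k) < s - x"
    using assms by (intro order_tendstoD) auto
  then show ?thesis by eventually_elim simp
qed

text \<open>The indicator is closed at x because the cut-off factor still equals 1 there.\<close>

lemma cutoff_drift_square_tendsto:
  assumes "0 < l" "0 \<le> s"
  shows "(\<lambda>k. (cutoff_drift l x k s)\<^sup>2 / 2) \<longlonglongrightarrow> (1 + l * s) * indicator {..x} s"
proof (cases "s \<le> x")
  case True
  have "(drift l s)\<^sup>2 / 2 = 1 + l * s" using assms by (simp add: drift_def)
  then show ?thesis using True by (simp only: cutoff_drift_below) simp
next
  case False
  have "\<forall>\<^sub>F k in sequentially. (cutoff_drift l x k s)\<^sup>2 / 2 = (1 + l * s) * indicator {..x} s"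
    using eventually_cutoff_drift_above[of x s] False by (auto elim!: eventually_mono simp: cutoff_drift_above)
  then show ?thesis by (rule tendsto_eventually)
qed

context brownian_motion
begin

text \<open>As the running maximum \<open>S\<close> is monotone, this is \<open>exp (- \<integral> (1 + l S))\<close> integrated up to the
  first passage of \<open>B\<close> above \<open>x\<close> (or up to \<open>T\<close>); no stopping times or strong Markov property are needed.\<close>

definition killing :: "real \<Rightarrow> real \<Rightarrow> real \<Rightarrow> 'a \<Rightarrow> real" where
  "killing l x T \<omega> = exp (- (LBINT t:{0..T}. (1 + l * running_max B t \<omega>) * indicator {..x} (running_max B t \<omega>)))"

lemma killing_measurable [measurable]:
  "(\<lambda>(x, \<omega>). killing l x T \<omega>) \<in> borel_measurable (borel \<Otimes>\<^sub>M P)"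
proof -
  have [measurable]: "(\<lambda>p. indicator {..fst (fst p)} (running_max B (snd p) (snd (fst p))) :: real) \<in> borel_measurable ((borel \<Otimes>\<^sub>M P) \<Otimes>\<^sub>M lborel)"
    unfolding indicator_def atMost_def mem_Collect_eq by measurable
  show ?thesis unfolding killing_def set_lebesgue_integral_def split_beta' by measurable
qed

lemma killing_measurable' [measurable (raw)]:
  assumes [measurable]: "f \<in> borel_measurable M" "g \<in> measurable M P"
  shows "(\<lambda>x. killing l (f x) T (g x)) \<in> borel_measurable M"
  using measurable_compose[OF measurable_Pair[OF assms] killing_measurable] by simp

lemma killing_bounds:
  assumes "\<omega> \<in> space P" "B 0 \<omega> = 0" "0 < l"
  shows "0 < killing l x T \<omega>" "killing l x T \<omega> \<le> 1"
proof -
  have "0 \<le> (LBINT t:{0..T}. (1 + l * running_max B t \<omega>) * indicator {..x} (running_max B t \<omega>))"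
    unfolding set_lebesgue_integral_def using running_max_nonneg[OF assms(1,2)] assms(3)
    by (intro integral_nonneg_AE AE_I2) (auto simp: indicator_def)
  then show "killing l x T \<omega> \<le> 1" by (simp add: killing_def)
qed (simp add: killing_def)

text \<open>As the cut-off sharpens, the martingale variable tends to exp (potential l x) times
  \<open>killing\<close> on the event S_T > x. On the complement the rate is at least 1 throughout
  [0, T], so \<open>killing\<close> is at most exp (- T) and the two variables differ by at most exp
  (potential l x) exp (- T). Dividing by exp (potential l x) leaves an error that depends neither on
  x nor on l.\<close>

lemma expectation_killing_bound:
  assumes T: "0 < T" and l: "0 < l" and x: "0 \<le> x"
  shows "\<bar>expectation (killing l x T) - exp (- potential l x)\<bar> \<le> exp (- T)"
proof -
  define th where "th = cutoff_drift l x"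
  have "\<exists>V. \<forall>k. V k 0 = 0 \<and> (\<forall>s. (V k has_real_derivative th k s) (at s))"
  proof (intro choice allI)
    fix k
    show "\<exists>V. V 0 = 0 \<and> (\<forall>s. (V has_real_derivative th k s) (at s))"
      using antiderivative_exists[OF continuous_cutoff_drift[OF l, of x k]] unfolding th_def by blast
  qed
  then obtain V where V0: "\<And>k. V k 0 = 0" and V: "\<And>k s. (V k has_real_derivative th k s) (at s)" by blast
  define K where "K = drift l (x + 1)"
  have K: "0 \<le> th k s" "th k s \<le> K" for k s
    unfolding th_def K_def using cutoff_drift_nonneg cutoff_drift_le l x by auto
  have K0: "0 \<le> K" using K by (rule order.trans)
  have thc: "continuous_on UNIV (th k)" for k unfolding th_def by (rule continuous_cutoff_drift[OF l])
  have [measurable]: "th k \<in> borel_measurable borel" for k using thc by (rule borel_measurable_continuous_onI)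
  have "continuous_on UNIV (V k)" for k using DERIV_isCont[OF V] by (auto intro!: continuous_at_imp_continuous_on)
  then have [measurable]: "V k \<in> borel_measurable borel" for k by (rule borel_measurable_continuous_onI)
  have [measurable]: "B T \<in> borel_measurable P" using T by auto
  have Vlow: "V k s = potential l s" if "0 \<le> s" "s \<le> x" for k s
  proof (cases "s = 0")
    case False
    then have "0 < s" using that by simp
    moreover have "((\<lambda>s. V k s - potential l s) has_real_derivative th k y - drift l y) (at y)" if "0 \<le> y" for y
      by (intro DERIV_diff V DERIV_potential l that)
    ultimately obtain z where z: "0 < z" "z < s"
      "(V k s - potential l s) - (V k 0 - potential l 0) = (s - 0) * (th k z - drift l z)"
      using MVT2[of 0 s "\<lambda>s. V k s - potential l s" "\<lambda>y. th k y - drift l y"] by auto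
    then show ?thesis using V0 that by (simp add: th_def cutoff_drift_below)
  qed (simp add: V0)
  have above: "th k s = 0" if "x + 1 / real (Suc k) \<le> s" for k s
    using that by (simp add: th_def cutoff_drift_above)
  define Y where "Y = (\<lambda>k \<omega>. exp (V k (running_max B T \<omega>) - th k (running_max B T \<omega>) * (running_max B T \<omega> - B T \<omega>)
       - (LBINT t:{0..T}. (th k (running_max B t \<omega>))\<^sup>2 / 2)))"
  have Y1: "expectation (Y k) = 1" for k
    unfolding Y_def by (rule exponential_martingale_identity(1)[OF T thc V V0 K(1) K(2) above])
  have Vle: "V k s \<le> V k (x + 1 / real (Suc k))" for k s
    by (rule exponential_martingale_identity(2)[OF T thc V V0 K(1) K(2) above])
  have Vinc: "V k s \<le> V k s'" if "s \<le> s'" for k s s'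
    using that by (rule DERIV_nonneg_imp_nondecreasing) (use V K in blast)
  \<comment> \<open>The cut-off takes place on a length 1 / (k + 1) with drift at most
    \<open>K\<close>, so \<open>V k\<close> exceeds its value at x by a vanishing amount.\<close>
  have Vhigh: "V k (x + 1 / real (Suc k)) \<le> potential l x + K * (1 / real (Suc k))" for k
  proof -
    obtain z where "V k (x + 1 / real (Suc k)) - V k x = (x + 1 / real (Suc k) - x) * th k z"
      using MVT2[of x "x + 1 / real (Suc k)" "V k" "th k"] V by auto
    moreover have "(x + 1 / real (Suc k) - x) * th k z \<le> (x + 1 / real (Suc k) - x) * K"
      using K by (intro mult_left_mono) auto
    ultimately show ?thesis using Vlow[of x k] x by (simp add: mult.commute)
  qed
  have Yb: "AE \<omega> in P. norm (Y k \<omega>) \<le> exp (potential l x + K)" for k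
    using AE_space
  proof eventually_elim
    case (elim \<omega>)
    have "0 \<le> th k (running_max B T \<omega>) * (running_max B T \<omega> - B T \<omega>)"
      using K running_max_ge[OF elim, of T] T by (intro mult_nonneg_nonneg) auto
    moreover have "0 \<le> (LBINT t:{0..T}. (th k (running_max B t \<omega>))\<^sup>2 / 2)"
      unfolding set_lebesgue_integral_def by (intro integral_nonneg_AE) auto
    moreover have "K * (1 / real (Suc k)) \<le> K * 1" using K0 by (intro mult_left_mono) auto
    ultimately show ?case
      using Vle[of k "running_max B T \<omega>"] Vhigh[of k] unfolding Y_def by simp
  qed
  \<comment> \<open>The pointwise limit of \<open>Y k\<close>. If S_T <= x, the cut-off is not felt
    at S_T. Otherwise \<open>th k\<close> vanishes at S_T for large k, which removes the boundary
    term, and \<open>V k\<close> at S_T tends to \<open>potential l x\<close>.\<close>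
  define Y' where "Y' = (\<lambda>\<omega>. if running_max B T \<omega> \<le> x
     then exp (potential l (running_max B T \<omega>) - drift l (running_max B T \<omega>) * (running_max B T \<omega> - B T \<omega>)) * killing l x T \<omega>
     else exp (potential l x) * killing l x T \<omega>)"
  have [measurable]: "drift l \<in> borel_measurable borel" "potential l \<in> borel_measurable borel"
    unfolding drift_def[abs_def] potential_def[abs_def] by measurable
  have Y'm [measurable]: "Y' \<in> borel_measurable P" unfolding Y'_def by measurable
  have lim: "AE \<omega> in P. (\<lambda>k. Y k \<omega>) \<longlonglongrightarrow> Y' \<omega>"
    using B_start AE_space
  proof eventually_elim
    case (elim \<omega>)
    have S0: "0 \<le> running_max B t \<omega>" if "0 \<le> t" for t using running_max_nonneg elim that by blast
    have [measurable]: "(\<lambda>t. running_max B t \<omega>) \<in> borel_measurable borel" using elim(2) by measurable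
    have "(\<lambda>k. LBINT t:{0..T}. (th k (running_max B t \<omega>))\<^sup>2 / 2) \<longlonglongrightarrow>
       (LBINT t:{0..T}. (1 + l * running_max B t \<omega>) * indicator {..x} (running_max B t \<omega>))"
      unfolding set_lebesgue_integral_def
    proof (rule integral_dominated_convergence[where w="\<lambda>t. indicator {0..T} t * (K\<^sup>2 / 2)"])
      show "AE t in lborel. (\<lambda>k. indicator {0..T} t *\<^sub>R ((th k (running_max B t \<omega>))\<^sup>2 / 2)) \<longlonglongrightarrow>
          indicator {0..T} t *\<^sub>R ((1 + l * running_max B t \<omega>) * indicator {..x} (running_max B t \<omega>))"
      proof (rule AE_I2)
        fix t
        show "(\<lambda>k. indicator {0..T} t *\<^sub>R ((th k (running_max B t \<omega>))\<^sup>2 / 2)) \<longlonglongrightarrow>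
          indicator {0..T} t *\<^sub>R ((1 + l * running_max B t \<omega>) * indicator {..x} (running_max B t \<omega>))"
          using cutoff_drift_square_tendsto[OF l S0, of t x] unfolding th_def
          by (cases "t \<in> {0..T}") auto
      qed
      show "AE t in lborel. norm (indicator {0..T} t *\<^sub>R ((th k (running_max B t \<omega>))\<^sup>2 / 2)) \<le> indicator {0..T} t * (K\<^sup>2 / 2)" for k
        using K by (intro AE_I2) (auto simp: indicator_def intro!: power_mono)
      show "integrable lborel (\<lambda>t. indicator {0..T} t * (K\<^sup>2 / 2))"
        using T by (intro integrable_mult_left integrable_real_indicator) auto
    qed auto
    then have I: "(\<lambda>k. exp (- (LBINT t:{0..T}. (th k (running_max B t \<omega>))\<^sup>2 / 2))) \<longlonglongrightarrow> killing l x T \<omega>"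
      unfolding killing_def by (intro tendsto_intros)
    have Yeq: "Y k \<omega> = exp (V k (running_max B T \<omega>) - th k (running_max B T \<omega>) * (running_max B T \<omega> - B T \<omega>))
       * exp (- (LBINT t:{0..T}. (th k (running_max B t \<omega>))\<^sup>2 / 2))" for k
      unfolding Y_def exp_add[symmetric] by simp
    show ?case
    proof (cases "running_max B T \<omega> \<le> x")
      case True
      then have "V k (running_max B T \<omega>) = potential l (running_max B T \<omega>)"
        "th k (running_max B T \<omega>) = drift l (running_max B T \<omega>)" for k
        using Vlow S0[of T] T by (auto simp: th_def cutoff_drift_below)
      then show ?thesis unfolding Yeq Y'_def using True
        by (simp only: if_True) (intro tendsto_mult tendsto_const I)
    next
      case False
      let ?s = "running_max B T \<omega>"
      have ev: "\<forall>\<^sub>F k in sequentially. x + 1 / real (Suc k) \<le> ?s"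
        using False by (intro eventually_cutoff_drift_above) auto
      have "(\<lambda>k. V k ?s - th k ?s * (?s - B T \<omega>)) \<longlonglongrightarrow> potential l x"
      proof (rule tendsto_sandwich[where f="\<lambda>_. potential l x" and h="\<lambda>k. potential l x + K * (1 / real (Suc k))"])
        have "(\<lambda>k. 1 / real (Suc k)) \<longlonglongrightarrow> 0" by (rule LIMSEQ_Suc) (rule lim_const_over_n)
        from tendsto_add[OF tendsto_const[of "potential l x"] tendsto_mult[OF tendsto_const[of K] this]]
        show "(\<lambda>k. potential l x + K * (1 / real (Suc k))) \<longlonglongrightarrow> potential l x" by simp
        show "\<forall>\<^sub>F k in sequentially. potential l x \<le> V k ?s - th k ?s * (?s - B T \<omega>)"
          using ev
        proof eventually_elim
          case (elim k)
          then show ?case using Vinc[of x ?s k] Vlow[of x k] x False above[of k ?s] by simp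
        qed
        show "\<forall>\<^sub>F k in sequentially. V k ?s - th k ?s * (?s - B T \<omega>) \<le> potential l x + K * (1 / real (Suc k))"
          using ev
        proof eventually_elim
          case (elim k)
          then show ?case using Vle[of k ?s] Vhigh[of k] above[of k ?s] by simp
        qed
      qed auto
      then have "(\<lambda>k. exp (V k ?s - th k ?s * (?s - B T \<omega>))) \<longlonglongrightarrow> exp (potential l x)"
        by (intro tendsto_intros)
      from tendsto_mult[OF this I] show ?thesis unfolding Yeq Y'_def using False by simp
    qed
  qed
  have Ym [measurable]: "Y k \<in> borel_measurable P" for k
    unfolding Y_def set_lebesgue_integral_def by measurable
  have "(\<lambda>k. expectation (Y k)) \<longlonglongrightarrow> expectation Y'"
    by (rule integral_dominated_convergence[where w="\<lambda>_. exp (potential l x + K)"]) (use lim Yb in auto)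
  then have EY': "expectation Y' = 1" using Y1 by (simp add: LIMSEQ_const_iff)
  have Kb: "AE \<omega> in P. norm (killing l x T \<omega>) \<le> 1"
    using B_start AE_space by eventually_elim (use killing_bounds l in \<open>auto simp: abs_of_pos\<close>)
  have Ki: "integrable P (killing l x T)"
    by (rule integrable_const_bound[OF Kb]) measurable
  have diff: "AE \<omega> in P. norm (exp (potential l x) * killing l x T \<omega> - Y' \<omega>) \<le> exp (potential l x) * exp (- T)"
    using B_start AE_space
  proof eventually_elim
    case (elim \<omega>)
    show ?case
    proof (cases "running_max B T \<omega> \<le> x")
      case True
      let ?s = "running_max B T \<omega>"
      have S0: "0 \<le> running_max B t \<omega>" if "0 \<le> t" for t using running_max_nonneg elim that by blast
      have cont: "continuous_on {0..T} (\<lambda>t. 1 + l * running_max B t \<omega>)"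
        by (intro continuous_intros continuous_on_subset[OF running_max_continuous[OF elim(2)]]) auto
      have ind: "indicator {..x} (running_max B t \<omega>) = (1::real)" if "t \<in> {0..T}" for t
        using that running_max_mono[OF elim(2), of t T] True by simp
      have "T = (LBINT t:{0..T}. 1)" using T by (simp add: set_lebesgue_integral_def)
      also have "\<dots> \<le> (LBINT t:{0..T}. 1 + l * running_max B t \<omega>)"
        using S0 l borel_integrable_atLeastAtMost'[OF cont] borel_integrable_atLeastAtMost'[of 0 T "\<lambda>_. 1::real"]
        by (intro set_integral_mono) auto
      also have "\<dots> = (LBINT t:{0..T}. (1 + l * running_max B t \<omega>) * indicator {..x} (running_max B t \<omega>))"
        using ind by (intro set_lebesgue_integral_cong) auto
      finally have kT: "killing l x T \<omega> \<le> exp (- T)" by (simp add: killing_def)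
      define E where "E = exp (potential l ?s - drift l ?s * (?s - B T \<omega>))"
      have "0 \<le> drift l ?s * (?s - B T \<omega>)"
        using running_max_ge[OF elim(2), of T] T l by (intro mult_nonneg_nonneg) (auto simp: drift_def)
      moreover have "potential l ?s \<le> potential l x"
        using Vinc[of ?s x 0] Vlow[of ?s 0] Vlow[of x 0] True S0[of T] x T by simp
      ultimately have E: "0 \<le> E" "E \<le> exp (potential l x)" by (auto simp: E_def)
      have "exp (potential l x) * killing l x T \<omega> - Y' \<omega> = (exp (potential l x) - E) * killing l x T \<omega>"
        using True by (simp add: Y'_def E_def algebra_simps)
      also have "norm \<dots> \<le> exp (potential l x) * exp (- T)"
        using E kT killing_bounds[OF elim(2,1) l, of x T] by (simp add: abs_mult) (intro mult_mono; simp)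
      finally show ?thesis .
    qed (simp add: Y'_def)
  qed
  have Y'i: "integrable P Y'"
  proof (rule integrable_const_bound)
    show "AE \<omega> in P. norm (Y' \<omega>) \<le> exp (potential l x) * exp (- T) + exp (potential l x) * 1"
      using diff Kb
    proof eventually_elim
      case (elim \<omega>)
      have "norm (exp (potential l x) * killing l x T \<omega>) \<le> exp (potential l x) * 1"
        using elim(2) unfolding norm_mult by (intro mult_mono) auto
      then show ?case using elim(1) unfolding real_norm_def by linarith
    qed
  qed measurable
  have "\<bar>exp (potential l x) * expectation (killing l x T) - 1\<bar> = norm (expectation (\<lambda>\<omega>. exp (potential l x) * killing l x T \<omega> - Y' \<omega>))"
    using Ki Y'i EY' by simp
  also have "\<dots> \<le> expectation (\<lambda>\<omega>. norm (exp (potential l x) * killing l x T \<omega> - Y' \<omega>))"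
    by (rule integral_norm_bound)
  also have "\<dots> \<le> exp (potential l x) * exp (- T)"
    using Ki Y'i diff by (intro integral_le_const) auto
  finally have *: "\<bar>exp (potential l x) * expectation (killing l x T) - 1\<bar> \<le> exp (potential l x) * exp (- T)" .
  have "expectation (killing l x T) - exp (- potential l x) = exp (- potential l x) * (exp (potential l x) * expectation (killing l x T) - 1)"
    by (simp add: algebra_simps exp_minus)
  then have "\<bar>expectation (killing l x T) - exp (- potential l x)\<bar> = exp (- potential l x) * \<bar>exp (potential l x) * expectation (killing l x T) - 1\<bar>"
    by (simp add: abs_mult)
  also have "\<dots> \<le> exp (- potential l x) * (exp (potential l x) * exp (- T))"
    using * by (intro mult_left_mono) auto
  also have "\<dots> = exp (- T)" by (simp add: mult.assoc[symmetric] exp_minus)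
  finally show ?thesis .
qed

end

section \<open>The Laplace transform of the area at an exponential time\<close>

text \<open>The weight in x is chosen for this tail: 1 / (1 + l s) cancels the factor 1 + l S in the
  derivative of \<open>discount\<close>.\<close>

lemma nn_integral_inverse_square_tail:
  assumes l: "0 < l" and s: "0 \<le> s"
  shows "(\<integral>\<^sup>+x. ennreal (l / (1 + l * x)\<^sup>2) * indicator {s..} x \<partial>lborel) = ennreal (1 / (1 + l * s))"
proof -
  have "(\<integral>\<^sup>+x. ennreal (l / (1 + l * x)\<^sup>2) * indicator {s..} x \<partial>lborel) = ennreal (0 - (- 1 / (1 + l * s)))"
  proof (rule nn_integral_FTC_atLeast)
    fix x assume "s \<le> x"
    then have pos: "0 < 1 + l * x" using l s by (intro add_pos_nonneg) auto
    show "((\<lambda>x. - 1 / (1 + l * x)) has_real_derivative l / (1 + l * x)\<^sup>2) (at x)"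
      using pos by (auto intro!: derivative_eq_intros simp: power2_eq_square)
    show "0 \<le> l / (1 + l * x)\<^sup>2" using l by simp
  next
    show "((\<lambda>x. - 1 / (1 + l * x)) \<longlongrightarrow> 0) at_top"
      by (intro tendsto_divide_0[OF tendsto_const] filterlim_at_top_imp_at_infinity
          filterlim_tendsto_add_at_top[OF tendsto_const] filterlim_tendsto_pos_mult_at_top[OF tendsto_const])
         (use l in \<open>auto simp: filterlim_ident\<close>)
  qed measurable
  then show ?thesis by simp
qed

context brownian_motion
begin

definition discount :: "real \<Rightarrow> real \<Rightarrow> 'a \<Rightarrow> real" where
  "discount l t \<omega> = exp (- (LBINT u:{0..t}. 1 + l * running_max B u \<omega>))"

lemma discount_measurable [measurable]:
  "(\<lambda>(t, \<omega>). discount l t \<omega>) \<in> borel_measurable (borel \<Otimes>\<^sub>M P)"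
proof -
  have [measurable]: "(\<lambda>p :: (real \<times> 'a) \<times> real. indicator {0..fst (fst p)} (snd p) :: real) \<in> borel_measurable ((borel \<Otimes>\<^sub>M P) \<Otimes>\<^sub>M lborel)"
    unfolding indicator_def atLeastAtMost_iff by measurable
  show ?thesis unfolding discount_def set_lebesgue_integral_def split_beta' by measurable
qed

lemma discount_measurable' [measurable (raw)]:
  assumes [measurable]: "f \<in> borel_measurable M" "g \<in> measurable M P"
  shows "(\<lambda>x. discount l (f x) (g x)) \<in> borel_measurable M"
  using measurable_compose[OF measurable_Pair[OF assms] discount_measurable] by simp

text \<open>S is continuous and nondecreasing, so the times in [0, T] with S <= x form an interval
  [0, \<tau>]. On it the integrand is minus the derivative of \<open>discount\<close>, and
  \<open>killing\<close> is the value of \<open>discount\<close> at \<tau>.\<close>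

lemma nn_integral_discount_below:
  assumes \<omega>: "\<omega> \<in> space P" "B 0 \<omega> = 0" and T: "0 < T" and l: "0 < l" and x: "0 \<le> x"
  shows "(\<integral>\<^sup>+t. ennreal ((1 + l * running_max B t \<omega>) * discount l t \<omega>) * indicator {..x} (running_max B t \<omega>) * indicator {0..T} t \<partial>lborel)
    = ennreal (1 - killing l x T \<omega>)"
proof -
  let ?S = "\<lambda>t. running_max B t \<omega>"
  note S_cont = running_max_continuous[OF \<omega>(1)]
  have S0: "0 \<le> ?S t" if "0 \<le> t" for t using running_max_nonneg \<omega> that by blast
  define A where "A = {t\<in>{0..T}. ?S t \<le> x}"
  define \<tau> where "\<tau> = Sup A"
  have "?S 0 \<le> x" using \<omega> x by (simp add: running_max_eq)
  then have A0: "0 \<in> A" using T by (simp add: A_def)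
  have "closed A"
  proof -
    have "A = {0..T} \<inter> ?S -` {..x}" by (auto simp: A_def)
    then show ?thesis
      using continuous_closed_preimage[OF continuous_on_subset[OF S_cont, of "{0..T}"], of "{..x}"] by auto
  qed
  moreover have bdd: "bdd_above A" by (auto simp: A_def intro!: bdd_aboveI[of _ T])
  ultimately have \<tau>A: "\<tau> \<in> A" unfolding \<tau>_def using A0 by (intro closed_contains_Sup) auto
  have A_eq: "A = {0..\<tau>}"
  proof (intro set_eqI iffI)
    fix t assume t: "t \<in> A"
    then have "t \<le> \<tau>" unfolding \<tau>_def using bdd by (rule cSup_upper)
    then show "t \<in> {0..\<tau>}" using t by (simp add: A_def)
  next
    fix t assume t: "t \<in> {0..\<tau>}"
    then have "?S t \<le> ?S \<tau>" by (intro running_max_mono \<omega>) auto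
    then show "t \<in> A" using t \<tau>A by (simp add: A_def)
  qed
  have \<tau>0: "0 \<le> \<tau>" using \<tau>A by (simp add: A_def)
  \<comment> \<open>Stated for a type variable because the real-valued and the
    \<open>ennreal\<close>-valued indicator are both rewritten with it.\<close>
  have A_ind: "indicator {0..T} t * indicator {..x} (?S t) = (indicator {0..\<tau>} t :: 'c::comm_semiring_1)" for t
    unfolding A_eq[symmetric] by (auto simp: A_def indicator_def)
  let ?f = "\<lambda>t. 1 + l * ?S t"
  have f: "continuous_on {0..\<tau>} ?f"
    by (intro continuous_intros continuous_on_subset[OF S_cont]) auto
  have kill: "killing l x T \<omega> = discount l \<tau> \<omega>"
  proof -
    have "(LBINT t:{0..T}. ?f t * indicator {..x} (?S t)) = (LBINT t:{0..\<tau>}. ?f t)"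
      unfolding set_lebesgue_integral_def A_ind[symmetric, where 'c=real] by (simp add: mult_ac)
    then show ?thesis by (simp add: killing_def discount_def)
  qed
  have disc: "discount l t \<omega> = exp (- integral {0..t} ?f)" if "t \<in> {0..\<tau>}" for t
    unfolding discount_def using that
    by (subst set_borel_integral_eq_integral(2)[OF borel_integrable_atLeastAtMost'[OF continuous_on_subset[OF f]]]) auto
  have "((\<lambda>t. ?f t * discount l t \<omega>) has_integral (- discount l \<tau> \<omega>) - (- discount l 0 \<omega>)) {0..\<tau>}"
  proof (rule fundamental_theorem_of_calculus[OF \<tau>0])
    fix t assume t: "t \<in> {0..\<tau>}"
    have "((\<lambda>u. integral {0..u} ?f) has_real_derivative ?f t) (at t within {0..\<tau>})"
      by (rule integral_has_real_derivative[OF f t])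
    then have "((\<lambda>u. - exp (- integral {0..u} ?f)) has_real_derivative ?f t * exp (- integral {0..t} ?f)) (at t within {0..\<tau>})"
      by (auto intro!: derivative_eq_intros simp: algebra_simps)
    then have "((\<lambda>u. - discount l u \<omega>) has_real_derivative ?f t * discount l t \<omega>) (at t within {0..\<tau>})"
      unfolding disc[OF t] by (rule has_field_derivative_transform_within[where d=1]) (use t in \<open>auto simp: disc\<close>)
    then show "((\<lambda>u. - discount l u \<omega>) has_vector_derivative ?f t * discount l t \<omega>) (at t within {0..\<tau>})"
      by (simp add: has_real_derivative_iff_has_vector_derivative)
  qed
  then have "integral\<^sup>N lborel (\<lambda>t. ennreal (?f t * discount l t \<omega>) * indicator {0..\<tau>} t) = ennreal (- discount l \<tau> \<omega> - (- discount l 0 \<omega>))"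
    using S0 l by (intro nn_integral_has_integral_lebesgue') (auto simp: discount_def)
  also have "discount l 0 \<omega> = 1" using disc[of 0] \<tau>0 by simp
  finally show ?thesis
    unfolding A_ind[symmetric] kill by (simp add: mult_ac)
qed

text \<open>Fubini for one double integral: integrating over x first produces 1 / (1 + l S) and
  gives back \<open>discount\<close>; integrating over t first produces 1 -
  \<open>killing\<close>.\<close>

lemma nn_integral_discount:
  assumes \<omega>: "\<omega> \<in> space P" "B 0 \<omega> = 0" and T: "0 < T" and l: "0 < l"
  shows "(\<integral>\<^sup>+t. ennreal (discount l t \<omega>) * indicator {0..T} t \<partial>lborel)
    = (\<integral>\<^sup>+x. ennreal (l / (1 + l * x)\<^sup>2) * indicator {0..} x * ennreal (1 - killing l x T \<omega>) \<partial>lborel)"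
proof -
  let ?S = "\<lambda>t. running_max B t \<omega>"
  have S0: "0 \<le> ?S t" if "0 \<le> t" for t using running_max_nonneg \<omega> that by blast
  have [measurable]: "?S \<in> borel_measurable borel" "(\<lambda>t. discount l t \<omega>) \<in> borel_measurable borel"
    using \<omega>(1) by measurable
  let ?w = "\<lambda>x. ennreal (l / (1 + l * x)\<^sup>2)"
  let ?g = "\<lambda>t. ennreal ((1 + l * ?S t) * discount l t \<omega>)"
  have "(\<integral>\<^sup>+t. ennreal (discount l t \<omega>) * indicator {0..T} t \<partial>lborel)
    = (\<integral>\<^sup>+t. (\<integral>\<^sup>+x. (?w x * indicator {0..} x) * (?g t * indicator {..x} (?S t) * indicator {0..T} t) \<partial>lborel) \<partial>lborel)"
  proof (rule nn_integral_cong)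
    fix t
    show "ennreal (discount l t \<omega>) * indicator {0..T} t =
      (\<integral>\<^sup>+x. (?w x * indicator {0..} x) * (?g t * indicator {..x} (?S t) * indicator {0..T} t) \<partial>lborel)"
    proof (cases "t \<in> {0..T}")
      case True
      then have s: "0 \<le> ?S t" by (intro S0) auto
      have pos: "0 < 1 + l * ?S t" using l s by (intro add_pos_nonneg) auto
      have "(\<integral>\<^sup>+x. (?w x * indicator {0..} x) * (?g t * indicator {..x} (?S t) * indicator {0..T} t) \<partial>lborel)
        = (\<integral>\<^sup>+x. ?g t * (?w x * indicator {?S t..} x) \<partial>lborel)"
        using True s by (intro nn_integral_cong) (auto simp: indicator_def mult_ac)
      also have "\<dots> = ?g t * ennreal (1 / (1 + l * ?S t))"
        by (subst nn_integral_cmult) (auto simp: nn_integral_inverse_square_tail[OF l s])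
      also have "\<dots> = ennreal (discount l t \<omega>)"
        using pos by (subst ennreal_mult[symmetric]) (auto simp: discount_def)
      finally show ?thesis using True by simp
    qed simp
  qed
  also have "\<dots> = (\<integral>\<^sup>+x. (\<integral>\<^sup>+t. (?w x * indicator {0..} x) * (?g t * indicator {..x} (?S t) * indicator {0..T} t) \<partial>lborel) \<partial>lborel)"
  proof (rule lborel_pair.Fubini')
    have [measurable]: "(\<lambda>p. indicator {..fst p} (?S (snd p)) :: ennreal) \<in> borel_measurable (lborel \<Otimes>\<^sub>M lborel)"
      unfolding indicator_def atMost_iff by measurable
    show "(\<lambda>(x, t). (?w x * indicator {0..} x) * (?g t * indicator {..x} (?S t) * indicator {0..T} t)) \<in> borel_measurable (lborel \<Otimes>\<^sub>M lborel)"
      unfolding split_beta' by measurable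
  qed
  also have "\<dots> = (\<integral>\<^sup>+x. ?w x * indicator {0..} x * ennreal (1 - killing l x T \<omega>) \<partial>lborel)"
  proof (rule nn_integral_cong)
    fix x
    show "(\<integral>\<^sup>+t. (?w x * indicator {0..} x) * (?g t * indicator {..x} (?S t) * indicator {0..T} t) \<partial>lborel)
      = ?w x * indicator {0..} x * ennreal (1 - killing l x T \<omega>)"
    proof (cases "0 \<le> x")
      case True
      have [measurable]: "(\<lambda>t. indicator {..x} (?S t) :: ennreal) \<in> borel_measurable lborel" by measurable
      show ?thesis
        using nn_integral_discount_below[OF \<omega> T l True] by (subst nn_integral_cmult) auto
    qed simp
  qed
  finally show ?thesis .
qed

text \<open>The weight has total mass 1, so the uniform error exp (- T) survives the integration
  over x unchanged. Two one-sided bounds replace an absolute value because both quantities live in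
  \<open>ennreal\<close>.\<close>

lemma nn_integral_expectation_discount_approx:
  fixes l :: real
  assumes T: "0 < T" and l: "0 < l"
  defines "R \<equiv> (\<integral>\<^sup>+x. ennreal (l / (1 + l * x)\<^sup>2) * indicator {0..} x * ennreal (1 - exp (- potential l x)) \<partial>lborel)"
    and "A \<equiv> (\<integral>\<^sup>+\<omega>. (\<integral>\<^sup>+t. ennreal (discount l t \<omega>) * indicator {0..T} t \<partial>lborel) \<partial>P)"
  shows "A \<le> R + ennreal (exp (- T))" "R \<le> A + ennreal (exp (- T))"
proof -
  interpret PL: pair_sigma_finite P lborel ..
  let ?w = "\<lambda>x. ennreal (l / (1 + l * x)\<^sup>2) * indicator {0..} x"
  have w1: "(\<integral>\<^sup>+x. ?w x \<partial>lborel) = 1"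
    using nn_integral_inverse_square_tail[OF l, of 0] by simp
  have Kb: "AE \<omega> in P. norm (killing l x T \<omega>) \<le> 1" for x
    using B_start AE_space by eventually_elim (use killing_bounds l in \<open>auto simp: abs_of_pos\<close>)
  have Ki: "integrable P (killing l x T)" for x
    by (rule integrable_const_bound[OF Kb]) measurable
  have EK: "(\<integral>\<^sup>+\<omega>. ennreal (1 - killing l x T \<omega>) \<partial>P) = ennreal (1 - expectation (killing l x T))" for x
  proof -
    have "AE \<omega> in P. 0 \<le> 1 - killing l x T \<omega>"
      using B_start AE_space by eventually_elim (use killing_bounds l in auto)
    then have "(\<integral>\<^sup>+\<omega>. ennreal (1 - killing l x T \<omega>) \<partial>P) = ennreal (expectation (\<lambda>\<omega>. 1 - killing l x T \<omega>))"
      using Ki by (intro nn_integral_eq_integral) auto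
    then show ?thesis using Ki by (simp add: prob_space)
  qed
  have [measurable]: "(\<lambda>x. expectation (killing l x T)) \<in> borel_measurable borel" by measurable
  have [measurable]: "potential l \<in> borel_measurable borel" unfolding potential_def[abs_def] by measurable
  have "A = (\<integral>\<^sup>+\<omega>. (\<integral>\<^sup>+x. ?w x * ennreal (1 - killing l x T \<omega>) \<partial>lborel) \<partial>P)"
    unfolding A_def
  proof (rule nn_integral_cong_AE)
    show "AE \<omega> in P. (\<integral>\<^sup>+t. ennreal (discount l t \<omega>) * indicator {0..T} t \<partial>lborel) =
      (\<integral>\<^sup>+x. ?w x * ennreal (1 - killing l x T \<omega>) \<partial>lborel)"
      using B_start AE_space by eventually_elim (use nn_integral_discount T l in blast)
  qed
  also have "\<dots> = (\<integral>\<^sup>+x. (\<integral>\<^sup>+\<omega>. ?w x * ennreal (1 - killing l x T \<omega>) \<partial>P) \<partial>lborel)"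
    by (rule PL.Fubini'[symmetric]) measurable
  also have "\<dots> = (\<integral>\<^sup>+x. ?w x * ennreal (1 - expectation (killing l x T)) \<partial>lborel)"
    by (intro nn_integral_cong) (subst nn_integral_cmult, auto simp: EK)
  finally have A: "A = (\<integral>\<^sup>+x. ?w x * ennreal (1 - expectation (killing l x T)) \<partial>lborel)" .
  have e: "(\<integral>\<^sup>+x. ?w x * ennreal (exp (- T)) \<partial>lborel) = ennreal (exp (- T))"
    by (subst nn_integral_multc) (auto simp: w1)
  have "A \<le> (\<integral>\<^sup>+x. ?w x * ennreal (1 - exp (- potential l x)) + ?w x * ennreal (exp (- T)) \<partial>lborel)"
    unfolding A
  proof (rule nn_integral_mono)
    fix x :: real
    have "ennreal (1 - expectation (killing l x T)) \<le> ennreal (1 - exp (- potential l x)) + ennreal (exp (- T))" if "0 \<le> x"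
    proof -
      have "0 \<le> potential l x"
        unfolding potential_def using that l by (intro mult_nonneg_nonneg) (auto intro!: ge_one_powr_ge_zero)
      then have plus: "ennreal (1 - exp (- potential l x)) + ennreal (exp (- T)) = ennreal (1 - exp (- potential l x) + exp (- T))"
        by (intro ennreal_plus[symmetric]) auto
      show ?thesis
        using expectation_killing_bound[OF T l that] unfolding plus
        by (intro ennreal_leI) linarith
    qed
    then show "?w x * ennreal (1 - expectation (killing l x T)) \<le> ?w x * ennreal (1 - exp (- potential l x)) + ?w x * ennreal (exp (- T))"
      by (cases "0 \<le> x") (auto simp: distrib_left[symmetric] intro!: mult_left_mono)
  qed
  also have "\<dots> = R + ennreal (exp (- T))"
    unfolding R_def by (subst nn_integral_add) (auto simp: e)
  finally show "A \<le> R + ennreal (exp (- T))" .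
  have "R \<le> (\<integral>\<^sup>+x. ?w x * ennreal (1 - expectation (killing l x T)) + ?w x * ennreal (exp (- T)) \<partial>lborel)"
    unfolding R_def
  proof (rule nn_integral_mono)
    fix x :: real
    have "ennreal (1 - exp (- potential l x)) \<le> ennreal (1 - expectation (killing l x T)) + ennreal (exp (- T))" if "0 \<le> x"
    proof -
      have "expectation (killing l x T) \<le> 1"
        using Ki Kb[of x] by (intro integral_le_const) auto
      then have plus: "ennreal (1 - expectation (killing l x T)) + ennreal (exp (- T)) = ennreal (1 - expectation (killing l x T) + exp (- T))"
        by (intro ennreal_plus[symmetric]) auto
      show ?thesis
        using expectation_killing_bound[OF T l that] unfolding plus
        by (intro ennreal_leI) linarith
    qed
    then show "?w x * ennreal (1 - exp (- potential l x)) \<le> ?w x * ennreal (1 - expectation (killing l x T)) + ?w x * ennreal (exp (- T))"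
      by (cases "0 \<le> x") (auto simp: distrib_left[symmetric] intro!: mult_left_mono)
  qed
  also have "\<dots> = A + ennreal (exp (- T))"
    unfolding A by (subst nn_integral_add) (auto simp: e)
  finally show "R \<le> A + ennreal (exp (- T))" .
qed

text \<open>T runs through n + 1: the integrals up to T increase to the full one by monotone
  convergence, and the errors exp (- T) vanish in both bounds.\<close>

lemma nn_integral_expectation_discount:
  assumes l: "0 < l"
  shows "(\<integral>\<^sup>+\<omega>. (\<integral>\<^sup>+t. ennreal (discount l t \<omega>) * indicator {0..} t \<partial>lborel) \<partial>P)
   = (\<integral>\<^sup>+x. ennreal (l / (1 + l * x)\<^sup>2) * indicator {0..} x * ennreal (1 - exp (- potential l x)) \<partial>lborel)"
   (is "?A = ?R")
proof -
  define A where "A = (\<lambda>n. (\<integral>\<^sup>+\<omega>. (\<integral>\<^sup>+t. ennreal (discount l t \<omega>) * indicator {0..real (Suc n)} t \<partial>lborel) \<partial>P))"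
  have sup: "(SUP n. A n) = ?A"
  proof -
    have "(\<integral>\<^sup>+t. ennreal (discount l t \<omega>) * indicator {0..} t \<partial>lborel) =
      (SUP n. \<integral>\<^sup>+t. ennreal (discount l t \<omega>) * indicator {0..real (Suc n)} t \<partial>lborel)" if \<omega>: "\<omega> \<in> space P" for \<omega>
    proof -
      have [measurable]: "(\<lambda>t. discount l t \<omega>) \<in> borel_measurable borel" using \<omega> by measurable
      have "indicator {0..} t = (SUP n. indicator {0..real (Suc n)} t :: ennreal)" for t :: real
      proof -
        have "indicator {0..} t \<le> (indicator {0..real (Suc (nat \<lceil>t\<rceil>))} t :: ennreal)"
          by (auto simp: indicator_def) linarith
        then show ?thesis
          by (intro antisym SUP_least SUP_upper2[where i="nat \<lceil>t\<rceil>"]) (auto simp: indicator_def)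
      qed
      then have "(\<integral>\<^sup>+t. ennreal (discount l t \<omega>) * indicator {0..} t \<partial>lborel)
         = (\<integral>\<^sup>+t. (SUP n. ennreal (discount l t \<omega>) * indicator {0..real (Suc n)} t) \<partial>lborel)"
        by (simp add: SUP_mult_left_ennreal)
      also have "\<dots> = (SUP n. \<integral>\<^sup>+t. ennreal (discount l t \<omega>) * indicator {0..real (Suc n)} t \<partial>lborel)"
        by (rule nn_integral_monotone_convergence_SUP)
           (auto simp: incseq_def le_fun_def indicator_def)
      finally show ?thesis .
    qed
    then have "?A = (\<integral>\<^sup>+\<omega>. (SUP n. \<integral>\<^sup>+t. ennreal (discount l t \<omega>) * indicator {0..real (Suc n)} t \<partial>lborel) \<partial>P)"
      by (intro nn_integral_cong) auto
    also have "\<dots> = (SUP n. A n)"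
      unfolding A_def
      by (rule nn_integral_monotone_convergence_SUP)
         (auto simp: incseq_def le_fun_def indicator_def intro!: nn_integral_mono)
    finally show ?thesis by simp
  qed
  have "incseq A"
    by (auto simp: A_def incseq_def indicator_def intro!: nn_integral_mono)
  then have limA: "A \<longlonglongrightarrow> ?A" unfolding sup[symmetric] by (rule LIMSEQ_SUP)
  have "(\<lambda>n. exp (- real (Suc n))) \<longlonglongrightarrow> 0"
    by (intro filterlim_compose[OF exp_at_bot] filterlim_compose[OF filterlim_uminus_at_bot_at_top]
       filterlim_compose[OF filterlim_real_sequentially filterlim_Suc])
  then have e: "(\<lambda>n. ennreal (exp (- real (Suc n)))) \<longlonglongrightarrow> 0" using tendsto_ennrealI by fastforce
  show ?thesis
  proof (rule antisym)
    show "?A \<le> ?R"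
    proof (rule LIMSEQ_le[OF limA])
      show "(\<lambda>n. ?R + ennreal (exp (- real (Suc n)))) \<longlonglongrightarrow> ?R"
        using tendsto_add[OF tendsto_const e, of ?R] by simp
      show "\<exists>N. \<forall>n\<ge>N. A n \<le> ?R + ennreal (exp (- real (Suc n)))"
        unfolding A_def by (intro exI allI impI nn_integral_expectation_discount_approx(1) l) simp
    qed
    show "?R \<le> ?A"
    proof (rule LIMSEQ_le_const)
      show "(\<lambda>n. A n + ennreal (exp (- real (Suc n)))) \<longlonglongrightarrow> ?A"
        using tendsto_add[OF limA e] by simp
      show "\<exists>N. \<forall>n\<ge>N. ?R \<le> A n + ennreal (exp (- real (Suc n)))"
        unfolding A_def by (intro exI allI impI nn_integral_expectation_discount_approx(2) l) simp
    qed
  qed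
qed

end

text \<open>No Brownian motion occurs in it. Since the Laplace transform of the area is its limit,
  that transform is the same for every Brownian motion, which is what scaling relies on.\<close>

definition grid_laplace :: "nat \<Rightarrow> real \<Rightarrow> real" where
  "grid_laplace n s = (LINT w|PiM {..<Suc n} (\<lambda>_. gauss (sqrt (1 / real (Suc n)))).
     exp (- s * (\<Sum>j<Suc n. smax (psum w) j * (1 / real (Suc n)))))"

section \<open>Uniqueness of the law of the area, and Brownian scaling\<close>

context brownian_motion
begin

lemma area_running_max_measurable [measurable]: "area_running_max B \<in> borel_measurable P"
  unfolding area_running_max_def[abs_def] set_lebesgue_integral_def by measurable

lemma area_running_max_nonneg: "AE \<omega> in P. 0 \<le> area_running_max B \<omega>"
  using B_start AE_space
proof eventually_elim
  case (elim \<omega>)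
  then show ?case
    unfolding area_running_max_def set_lebesgue_integral_def
    by (intro integral_nonneg_AE AE_I2) (auto simp: indicator_def intro!: running_max_nonneg)
qed

lemma grid_laplace_tendsto:
  assumes s: "0 \<le> s"
  shows "(\<lambda>n. grid_laplace n s) \<longlonglongrightarrow> expectation (\<lambda>\<omega>. exp (- s * area_running_max B \<omega>))"
proof -
  let ?X = "\<lambda>n \<omega>. exp (- s * (\<Sum>j<Suc n. smax (grid (\<lambda>t. B t \<omega>) 1 n) j * (1 / real (Suc n))))"
  have Xm [measurable]: "?X n \<in> borel_measurable P" for n
    using smax_grid_measurable[of 1 n] by measurable
  have eq: "grid_laplace n s = expectation (?X n)" for n
  proof -
    let ?F = "\<lambda>w. exp (- s * (\<Sum>j<Suc n. smax (psum w) j * (1 / real (Suc n))))"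
    have F: "?F \<in> borel_measurable (PiM {..<Suc n} (\<lambda>_. borel))"
    proof -
      have "(\<lambda>w. - s * (\<Sum>j<Suc n. smax (psum w) j * (1 / real (Suc n)))) \<in> borel_measurable (PiM {..<Suc n} (\<lambda>_. borel))"
        by (intro borel_measurable_times borel_measurable_const borel_measurable_sum smax_psum_measurable) auto
      then show ?thesis by measurable
    qed
    have "grid_laplace n s = expectation (\<lambda>\<omega>. ?F (increments 1 n \<omega>))"
      unfolding grid_laplace_def distr_increments[OF zero_less_one, symmetric]
      by (rule integral_distr[OF increments_measurable[OF zero_less_one] F])
    also have "\<dots> = expectation (?X n)"
    proof (rule integral_cong_AE)
      show "(\<lambda>\<omega>. ?F (increments 1 n \<omega>)) \<in> borel_measurable P"
        using measurable_compose[OF increments_measurable[OF zero_less_one] F] .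
      show "AE \<omega> in P. ?F (increments 1 n \<omega>) = ?X n \<omega>"
        using smax_grid_increments[OF zero_less_one, of n]
      proof eventually_elim
        case (elim \<omega>)
        have "(\<Sum>j<Suc n. smax (psum (increments 1 n \<omega>)) j * (1 / real (Suc n))) =
          (\<Sum>j<Suc n. smax (grid (\<lambda>t. B t \<omega>) 1 n) j * (1 / real (Suc n)))"
          using elim by (intro sum.cong) auto
        then show ?case by (simp only:)
      qed
    qed (rule Xm)
    finally show ?thesis .
  qed
  show ?thesis unfolding eq
  proof (rule integral_dominated_convergence[where w="\<lambda>_. 1"])
    show "AE \<omega> in P. (\<lambda>n. ?X n \<omega>) \<longlonglongrightarrow> exp (- s * area_running_max B \<omega>)"
      using AE_space
    proof eventually_elim
      case (elim \<omega>)
      have "continuous_on {0..1} (\<lambda>t. running_max B t \<omega>)"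
        by (rule continuous_on_subset[OF running_max_continuous[OF elim]]) auto
      from set_borel_integral_eq_integral(2)[OF borel_integrable_atLeastAtMost'[OF this]]
      have "area_running_max B \<omega> = integral {0..1} (\<lambda>t. path_max (\<lambda>t. B t \<omega>) t)"
        by (simp add: area_running_max_def running_max_eq)
      moreover have "(\<lambda>n. \<Sum>j<Suc n. smax (grid (\<lambda>t. B t \<omega>) 1 n) j * (1 / real (Suc n)))
          \<longlonglongrightarrow> integral {0..1} (\<lambda>t. path_max (\<lambda>t. B t \<omega>) t)"
        by (rule riemann_smax_tendsto[OF B_continuous[OF elim] zero_less_one continuous_on_id])
      ultimately show ?case by (intro tendsto_exp tendsto_mult tendsto_const) simp
    qed
    show "AE \<omega> in P. norm (?X n \<omega>) \<le> 1" for n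
      using B_start AE_space
    proof eventually_elim
      case (elim \<omega>)
      have "0 \<le> smax (grid (\<lambda>t. B t \<omega>) 1 n) j" if "j \<le> Suc n" for j
        using smax_grid_range(1)[OF B_continuous[OF elim(2)] zero_less_one that] elim by simp
      then have "0 \<le> (\<Sum>j<Suc n. smax (grid (\<lambda>t. B t \<omega>) 1 n) j * (1 / real (Suc n)))"
        by (intro sum_nonneg mult_nonneg_nonneg) auto
      then show ?case using s by (simp del: sum.lessThan_Suc)
    qed
  qed (use Xm in auto)
qed

lemma standard_brownian_motion_scaled:
  assumes c: "0 < c"
  shows "standard_brownian_motion P (\<lambda>t \<omega>. B (c * t) \<omega> / sqrt c)"
  unfolding standard_brownian_motion_def
proof (intro conjI allI impI ballI)
  show "prob_space P" by (rule prob_space_axioms)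
  show "(\<lambda>\<omega>. B (c * t) \<omega> / sqrt c) \<in> borel_measurable P" if "0 \<le> t" for t
    using c that by (intro borel_measurable_divide B_measurable borel_measurable_const) auto
  show "AE \<omega> in P. B (c * 0) \<omega> / sqrt c = 0"
    using B_start by eventually_elim simp
  show "indep_vars (\<lambda>_. borel) (\<lambda>i \<omega>. B (c * t (Suc i)) \<omega> / sqrt c - B (c * t i) \<omega> / sqrt c) {..<n}"
    if t: "0 \<le> t 0 \<and> strict_mono_on {..n} t" for n t
  proof -
    define u where "u = (\<lambda>i. c * t i)"
    have "0 \<le> u 0 \<and> strict_mono_on {..n} u"
      unfolding u_def
    proof
      show "strict_mono_on {..n} (\<lambda>i. c * t i)"
        by (intro strict_mono_onI mult_strict_left_mono c) (use t in \<open>auto intro: strict_mono_onD[of "{..n}" t]\<close>)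
    qed (use t c in simp)
    then have "indep_vars (\<lambda>_. borel) (\<lambda>i \<omega>. B (u (Suc i)) \<omega> - B (u i) \<omega>) {..<n}"
      using standard unfolding standard_brownian_motion_def by blast
    then have "indep_vars (\<lambda>_. borel) (\<lambda>i \<omega>. (B (u (Suc i)) \<omega> - B (u i) \<omega>) / sqrt c) {..<n}"
      by (rule indep_vars_compose2) measurable
    then show ?thesis by (simp add: diff_divide_distrib u_def)
  qed
  show "distributed P lborel (\<lambda>\<omega>. B (c * t) \<omega> / sqrt c - B (c * s) \<omega> / sqrt c)
      (\<lambda>x. ennreal (normal_density 0 (sqrt (t - s)) x))" if st: "0 \<le> s \<and> s < t" for s t
  proof -
    have "distributed P lborel (\<lambda>\<omega>. B (c * t) \<omega> - B (c * s) \<omega>) (\<lambda>x. ennreal (normal_density 0 (sqrt (c * t - c * s)) x))"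
      using standard st c unfolding standard_brownian_motion_def by simp
    from normal_density_affine[OF this, of "1 / sqrt c" 0]
    have "distributed P lborel (\<lambda>\<omega>. 0 + 1 / sqrt c * (B (c * t) \<omega> - B (c * s) \<omega>))
      (\<lambda>x. ennreal (normal_density (0 + 1 / sqrt c * 0) (\<bar>1 / sqrt c\<bar> * sqrt (c * t - c * s)) x))"
      using c st by simp
    moreover have "\<bar>1 / sqrt c\<bar> * sqrt (c * t - c * s) = sqrt (t - s)"
      using c by (simp add: real_sqrt_mult flip: right_diff_distrib)
    ultimately show ?thesis by (simp add: diff_divide_distrib)
  qed
  show "continuous_on {0..} (\<lambda>t. B (c * t) \<omega> / sqrt c)" if "\<omega> \<in> space P" for \<omega>
    by (intro continuous_intros continuous_on_compose2[OF B_continuous[OF that]]) (use c in auto)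
qed

lemma running_max_scaled:
  assumes c: "0 < c" and \<omega>: "\<omega> \<in> space P" and t: "0 \<le> t"
  shows "running_max (\<lambda>t \<omega>. B (c * t) \<omega> / sqrt c) t \<omega> = running_max B (c * t) \<omega> / sqrt c"
proof -
  have b: "continuous_on {0..} (\<lambda>t. B t \<omega>)" using \<omega> by (rule B_continuous)
  have b': "continuous_on {0..} (\<lambda>t. B (c * t) \<omega> / sqrt c)"
    by (intro continuous_intros continuous_on_compose2[OF b]) (use c in auto)
  have "path_max (\<lambda>t. B (c * t) \<omega> / sqrt c) t = path_max (\<lambda>t. B t \<omega>) (c * t) / sqrt c"
  proof (rule antisym)
    show "path_max (\<lambda>t. B (c * t) \<omega> / sqrt c) t \<le> path_max (\<lambda>t. B t \<omega>) (c * t) / sqrt c"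
      using c t by (intro path_max_le divide_right_mono path_max_ge[OF b]) auto
    have "path_max (\<lambda>t. B t \<omega>) (c * t) \<le> sqrt c * path_max (\<lambda>t. B (c * t) \<omega> / sqrt c) t"
    proof (rule path_max_le)
      fix u assume u: "0 \<le> u" "u \<le> c * t"
      have "B (c * (u / c)) \<omega> / sqrt c \<le> path_max (\<lambda>t. B (c * t) \<omega> / sqrt c) t"
        by (rule path_max_ge[OF b']) (use u c in \<open>auto simp: field_simps\<close>)
      then show "B u \<omega> \<le> sqrt c * path_max (\<lambda>t. B (c * t) \<omega> / sqrt c) t"
        using c by (simp add: field_simps)
    qed (use c t in auto)
    then show "path_max (\<lambda>t. B t \<omega>) (c * t) / sqrt c \<le> path_max (\<lambda>t. B (c * t) \<omega> / sqrt c) t"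
      using c by (simp add: field_simps)
  qed
  then show ?thesis by (simp add: running_max_def path_max_def)
qed

text \<open>The substitution u = c x contributes c and the scaling of the maximum contributes sqrt
  c; together they give c^(3/2).\<close>

lemma expectation_area_scaled:
  assumes c: "0 < c" and l: "0 \<le> l"
  shows "expectation (\<lambda>\<omega>. exp (- l * (LBINT u:{0..c}. running_max B u \<omega>)))
    = expectation (\<lambda>\<omega>. exp (- l * (c powr (3/2) * area_running_max B \<omega>)))"
proof -
  let ?B = "\<lambda>t \<omega>. B (c * t) \<omega> / sqrt c"
  interpret B': brownian_motion P ?B
    by unfold_locales (rule standard_brownian_motion_scaled[OF c])
  have s: "0 \<le> l * c powr (3/2)" using l by simp
  have cc: "c powr (3/2) = c * sqrt c"
    using c powr_add[of c 1 "1/2"] by (simp add: powr_half_sqrt)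
  have "(LBINT u:{0..c}. running_max B u \<omega>) = c powr (3/2) * area_running_max ?B \<omega>" if \<omega>: "\<omega> \<in> space P" for \<omega>
  proof -
    have "(LBINT u:{0..c}. running_max B u \<omega>) = c * (\<integral>x. indicator {0..c} (0 + c * x) *\<^sub>R running_max B (0 + c * x) \<omega> \<partial>lborel)"
      unfolding set_lebesgue_integral_def using c by (subst lborel_integral_real_affine[where c=c and t=0]) auto
    also have "(\<integral>x. indicator {0..c} (0 + c * x) *\<^sub>R running_max B (0 + c * x) \<omega> \<partial>lborel)
       = (\<integral>x. sqrt c * (indicator {0..1} x *\<^sub>R running_max ?B x \<omega>) \<partial>lborel)"
      using c running_max_scaled[OF c \<omega>]
      by (intro Bochner_Integration.integral_cong) (auto simp: indicator_def mult_le_cancel_left1 zero_le_mult_iff)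
    also have "\<dots> = sqrt c * area_running_max ?B \<omega>"
      unfolding area_running_max_def set_lebesgue_integral_def by simp
    finally show ?thesis by (simp add: cc)
  qed
  then have "expectation (\<lambda>\<omega>. exp (- l * (LBINT u:{0..c}. running_max B u \<omega>)))
    = expectation (\<lambda>\<omega>. exp (- (l * c powr (3/2)) * area_running_max ?B \<omega>))"
    by (intro Bochner_Integration.integral_cong) auto
  \<comment> \<open>The scaled process has a different area as a random variable; the transforms
    agree because both are limits of the same \<open>grid_laplace\<close>.\<close>
  also have "\<dots> = expectation (\<lambda>\<omega>. exp (- (l * c powr (3/2)) * area_running_max B \<omega>))"
    by (rule LIMSEQ_unique[OF B'.grid_laplace_tendsto[OF s] grid_laplace_tendsto[OF s]])
  finally show ?thesis by (simp add: mult.assoc)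
qed

end

text \<open>Inverts \<open>potential l\<close>; the constant 3 / (2 sqrt 2) is the reciprocal of its
  factor 2 sqrt 2 / 3. The conjunct 0 <= x selects the half-line on which \<open>potential\<close>
  increases; the right-hand side implies it because y >= 1.\<close>

lemma potential_le_iff:
  assumes l: "0 < l" and v: "0 \<le> v"
  defines "y \<equiv> 1 + 3 / (2 * sqrt 2) * l * v"
  shows "0 \<le> x \<and> v \<le> potential l x \<longleftrightarrow> (y powr (2/3) - 1) / l \<le> x"
proof -
  have y: "1 \<le> y" using l v by (simp add: y_def)
  have y1: "1 \<le> y powr (2/3)" using y by (simp add: ge_one_powr_ge_zero)
  have "v \<le> potential l x \<longleftrightarrow> y powr (2/3) \<le> 1 + l * x" if x: "0 \<le> x"
  proof -
    have z: "1 \<le> 1 + l * x" using l x by simp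
    have "v \<le> potential l x \<longleftrightarrow> y \<le> (1 + l * x) powr (3/2)"
      unfolding potential_def y_def using l by (simp add: field_simps)
    also have "\<dots> \<longleftrightarrow> y powr (2/3) \<le> 1 + l * x"
    proof
      assume "y \<le> (1 + l * x) powr (3/2)"
      then have "y powr (2/3) \<le> ((1 + l * x) powr (3/2)) powr (2/3)" using y by (intro powr_mono2) auto
      then show "y powr (2/3) \<le> 1 + l * x" using z by (simp add: powr_powr)
    next
      assume "y powr (2/3) \<le> 1 + l * x"
      then have "(y powr (2/3)) powr (3/2) \<le> (1 + l * x) powr (3/2)" by (intro powr_mono2) auto
      then show "y \<le> (1 + l * x) powr (3/2)" using y by (simp add: powr_powr)
    qed
    finally show ?thesis .
  qed
  moreover have "(y powr (2/3) - 1) / l \<le> x \<longleftrightarrow> y powr (2/3) \<le> 1 + l * x"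
    using l by (simp add: field_simps)
  moreover have "0 \<le> x" if "y powr (2/3) \<le> 1 + l * x"
  proof -
    have "0 \<le> l * x" using y1 that by linarith
    then show ?thesis using l by (simp add: zero_le_mult_iff)
  qed
  ultimately show ?thesis by blast
qed

lemma nn_integral_exp_minus_Icc:
  assumes "0 \<le> c"
  shows "(\<integral>\<^sup>+v. ennreal (exp (- v)) * indicator {0..c} v \<partial>lborel) = ennreal (1 - exp (- c))"
proof -
  have "((\<lambda>v. exp (- v)) has_integral (- exp (- c)) - (- exp (- 0))) {0..c}"
    using assms by (intro fundamental_theorem_of_calculus)
      (auto intro!: derivative_eq_intros simp: has_real_derivative_iff_has_vector_derivative[symmetric])
  then show ?thesis by (subst nn_integral_has_integral_lebesgue') auto
qed

text \<open>Here 1 - exp (- potential) is written as the integral of exp (- v) over v from 0 to the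
  potential. After exchanging the integrals, x runs over the tail from \<open>?X v\<close>, where 1
  + l x equals y^(2/3), so the weight integrates to y^(-2/3).\<close>

lemma nn_integral_potential:
  assumes l: "0 < l"
  shows "(\<integral>\<^sup>+x. ennreal (l / (1 + l * x)\<^sup>2) * indicator {0..} x * ennreal (1 - exp (- potential l x)) \<partial>lborel)
    = (\<integral>\<^sup>+v. ennreal (exp (- v) * (1 + 3 / (2 * sqrt 2) * l * v) powr (- 2/3)) * indicator {0..} v \<partial>lborel)"
proof -
  let ?w = "\<lambda>x. ennreal (l / (1 + l * x)\<^sup>2)"
  let ?y = "\<lambda>v. 1 + 3 / (2 * sqrt 2) * l * v"
  let ?X = "\<lambda>v. (?y v powr (2/3) - 1) / l"
  have [measurable]: "(\<lambda>p :: real \<times> real. indicator {?X (fst p)..} (snd p) :: ennreal) \<in> borel_measurable (lborel \<Otimes>\<^sub>M lborel)"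
  proof -
    have eq: "indicator {?X (fst p)..} (snd p) = (if snd p < ?X (fst p) then 0 else 1 :: ennreal)" for p :: "real \<times> real"
      by (auto simp: indicator_def)
    show ?thesis unfolding eq by measurable
  qed
  have "(\<integral>\<^sup>+x. ?w x * indicator {0..} x * ennreal (1 - exp (- potential l x)) \<partial>lborel)
    = (\<integral>\<^sup>+x. (\<integral>\<^sup>+v. (ennreal (exp (- v)) * indicator {0..} v) * (?w x * indicator {?X v..} x) \<partial>lborel) \<partial>lborel)"
  proof (rule nn_integral_cong)
    fix x
    show "?w x * indicator {0..} x * ennreal (1 - exp (- potential l x))
      = (\<integral>\<^sup>+v. (ennreal (exp (- v)) * indicator {0..} v) * (?w x * indicator {?X v..} x) \<partial>lborel)"
    proof (cases "0 \<le> x")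
      case True
      have p: "0 \<le> potential l x"
        unfolding potential_def using True l by (intro mult_nonneg_nonneg) (auto intro!: ge_one_powr_ge_zero)
      have "(\<integral>\<^sup>+v. (ennreal (exp (- v)) * indicator {0..} v) * (?w x * indicator {?X v..} x) \<partial>lborel)
        = (\<integral>\<^sup>+v. ?w x * (ennreal (exp (- v)) * indicator {0..potential l x} v) \<partial>lborel)"
      proof (rule nn_integral_cong)
        fix v
        show "(ennreal (exp (- v)) * indicator {0..} v) * (?w x * indicator {?X v..} x) =
          ?w x * (ennreal (exp (- v)) * indicator {0..potential l x} v)"
          using potential_le_iff[OF l, of v x] True by (cases "0 \<le> v") (auto simp: indicator_def mult_ac)
      qed
      also have "\<dots> = ?w x * ennreal (1 - exp (- potential l x))"
        by (subst nn_integral_cmult) (auto simp: nn_integral_exp_minus_Icc[OF p])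
      finally show ?thesis using True by simp
    next
      \<comment> \<open>For x < 0 the two indicators exclude each other, since \<open>?X v\<close>
        is nonnegative whenever v is.\<close>
      case False
      have "indicator {0..} v * indicator {?X v..} x = (0 :: ennreal)" for v
        using potential_le_iff[OF l, of v x] False by (auto simp: indicator_def)
      moreover have "(ennreal (exp (- v)) * indicator {0..} v) * (?w x * indicator {?X v..} x)
          = (ennreal (exp (- v)) * ?w x) * (indicator {0..} v * indicator {?X v..} x)" for v
        by (simp only: mult_ac)
      ultimately have "(ennreal (exp (- v)) * indicator {0..} v) * (?w x * indicator {?X v..} x) = 0" for v
        by (simp only: mult_zero_right)
      then have "(\<integral>\<^sup>+v. (ennreal (exp (- v)) * indicator {0..} v) * (?w x * indicator {?X v..} x) \<partial>lborel) = (\<integral>\<^sup>+v. 0 \<partial>(lborel :: real measure))"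
        by (intro nn_integral_cong)
      then show ?thesis using False by (simp only: nn_integral_const) simp
    qed
  qed
  also have "\<dots> = (\<integral>\<^sup>+v. (\<integral>\<^sup>+x. (ennreal (exp (- v)) * indicator {0..} v) * (?w x * indicator {?X v..} x) \<partial>lborel) \<partial>lborel)"
  proof (rule lborel_pair.Fubini')
    show "(\<lambda>(v, x). (ennreal (exp (- v)) * indicator {0..} v) * (?w x * indicator {?X v..} x)) \<in> borel_measurable (lborel \<Otimes>\<^sub>M lborel)"
      unfolding split_beta' by measurable
  qed
  also have "\<dots> = (\<integral>\<^sup>+v. ennreal (exp (- v) * ?y v powr (- 2/3)) * indicator {0..} v \<partial>lborel)"
  proof (rule nn_integral_cong)
    fix v
    show "(\<integral>\<^sup>+x. (ennreal (exp (- v)) * indicator {0..} v) * (?w x * indicator {?X v..} x) \<partial>lborel)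
      = ennreal (exp (- v) * ?y v powr (- 2/3)) * indicator {0..} v"
    proof (cases "0 \<le> v")
      case True
      have y: "1 \<le> ?y v" using l True by simp
      then have X0: "0 \<le> ?X v" using l by (simp add: ge_one_powr_ge_zero)
      have "1 / (1 + l * ?X v) = ?y v powr (- 2/3)"
      proof -
        have "1 + l * ?X v = ?y v powr (2/3)" using l by simp
        moreover have "?y v powr (- 2/3) = 1 / ?y v powr (2/3)"
          using powr_minus_divide[of "?y v" "2/3"] by simp
        ultimately show ?thesis by (simp only:)
      qed
      then have tail: "(\<integral>\<^sup>+x. ?w x * indicator {?X v..} x \<partial>lborel) = ennreal (?y v powr (- 2/3))"
        using nn_integral_inverse_square_tail[OF l X0] by (simp only:)
      have "(\<integral>\<^sup>+x. (ennreal (exp (- v)) * indicator {0..} v) * (?w x * indicator {?X v..} x) \<partial>lborel)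
        = (ennreal (exp (- v)) * indicator {0..} v) * ennreal (?y v powr (- 2/3))"
        unfolding tail[symmetric] by (rule nn_integral_cmult) measurable
      then show ?thesis using True by (simp only: ennreal_mult[OF exp_ge_zero powr_ge_zero]) (simp add: mult_ac)
    qed simp
  qed
  finally show ?thesis .
qed

context brownian_motion
begin

text \<open>At a fixed time t, \<open>discount\<close> is exp (- t) times exp (- l I) with I the
  integral of S up to t. Scaling replaces I by t^(3/2) A under the expectation, one t at a time;
  Fubini then assembles the slices.\<close>

lemma area_laplace:
  assumes l: "0 < l"
  shows "(\<integral>\<^sup>+\<omega>. (\<integral>\<^sup>+t. ennreal (exp (- t) * exp (- l * (t powr (3/2) * area_running_max B \<omega>))) * indicator {0..} t \<partial>lborel) \<partial>P)
    = (\<integral>\<^sup>+v. ennreal (exp (- v) * (1 + 3 / (2 * sqrt 2) * l * v) powr (- 2/3)) * indicator {0..} v \<partial>lborel)"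
proof -
  interpret PL: pair_sigma_finite P lborel ..
  have A0: "AE \<omega> in P. 0 \<le> area_running_max B \<omega>" by (rule area_running_max_nonneg)
  have slice: "(\<integral>\<^sup>+\<omega>. ennreal (exp (- t) * exp (- l * (t powr (3/2) * area_running_max B \<omega>))) \<partial>P)
      = (\<integral>\<^sup>+\<omega>. ennreal (discount l t \<omega>) \<partial>P)" if t: "0 < t" for t
  proof -
    let ?I = "\<lambda>\<omega>. LBINT u:{0..t}. running_max B u \<omega>"
    have [measurable]: "?I \<in> borel_measurable P" unfolding set_lebesgue_integral_def by measurable
    have d: "discount l t \<omega> = exp (- t) * exp (- l * ?I \<omega>)" if "\<omega> \<in> space P" for \<omega>
    proof -
      have "continuous_on {0..t} (\<lambda>t. running_max B t \<omega>)"
        by (rule continuous_on_subset[OF running_max_continuous[OF that]]) auto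
      then have "set_integrable lborel {0..t} (\<lambda>t. running_max B t \<omega>)"
        by (rule borel_integrable_atLeastAtMost')
      then have "(LBINT u:{0..t}. 1 + l * running_max B u \<omega>) = (LBINT u:{0..t}. 1) + l * ?I \<omega>"
        using borel_integrable_atLeastAtMost'[of 0 t "\<lambda>_. 1::real"] by (subst set_integral_add(2)) auto
      also have "(LBINT u:{0..t}. 1) = t" using t by (simp add: set_lebesgue_integral_def)
      finally show ?thesis by (simp add: discount_def exp_add[symmetric])
    qed
    have I0: "AE \<omega> in P. 0 \<le> ?I \<omega>"
      using B_start AE_space
    proof eventually_elim
      case (elim \<omega>)
      then show ?case unfolding set_lebesgue_integral_def
        by (intro integral_nonneg_AE AE_I2) (auto simp: indicator_def intro!: running_max_nonneg)
    qed
    have 1: "(\<integral>\<^sup>+\<omega>. ennreal (exp (- l * ?I \<omega>)) \<partial>P) = ennreal (expectation (\<lambda>\<omega>. exp (- l * ?I \<omega>)))"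
      using I0 l by (intro nn_integral_eq_integral integrable_const_bound[of _ 1]) auto
    have 2: "(\<integral>\<^sup>+\<omega>. ennreal (exp (- l * (t powr (3/2) * area_running_max B \<omega>))) \<partial>P)
        = ennreal (expectation (\<lambda>\<omega>. exp (- l * (t powr (3/2) * area_running_max B \<omega>))))"
      using A0 l by (intro nn_integral_eq_integral integrable_const_bound[of _ 1]) auto
    have "(\<integral>\<^sup>+\<omega>. ennreal (discount l t \<omega>) \<partial>P) = (\<integral>\<^sup>+\<omega>. ennreal (exp (- t)) * ennreal (exp (- l * ?I \<omega>)) \<partial>P)"
      by (intro nn_integral_cong) (simp add: d ennreal_mult)
    also have "\<dots> = ennreal (exp (- t)) * ennreal (expectation (\<lambda>\<omega>. exp (- l * ?I \<omega>)))"
      unfolding 1[symmetric] by (rule nn_integral_cmult) measurable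
    also have "\<dots> = ennreal (exp (- t)) * (\<integral>\<^sup>+\<omega>. ennreal (exp (- l * (t powr (3/2) * area_running_max B \<omega>))) \<partial>P)"
      using expectation_area_scaled[OF t, of l] l 2 by simp
    also have "\<dots> = (\<integral>\<^sup>+\<omega>. ennreal (exp (- t) * exp (- l * (t powr (3/2) * area_running_max B \<omega>))) \<partial>P)"
      by (subst nn_integral_cmult[symmetric]) (auto simp: ennreal_mult)
    finally show ?thesis ..
  qed
  have "(\<integral>\<^sup>+\<omega>. (\<integral>\<^sup>+t. ennreal (exp (- t) * exp (- l * (t powr (3/2) * area_running_max B \<omega>))) * indicator {0..} t \<partial>lborel) \<partial>P)
    = (\<integral>\<^sup>+t. (\<integral>\<^sup>+\<omega>. ennreal (exp (- t) * exp (- l * (t powr (3/2) * area_running_max B \<omega>))) * indicator {0..} t \<partial>P) \<partial>lborel)"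
    by (rule PL.Fubini'[symmetric]) (unfold split_beta', measurable)
  also have "\<dots> = (\<integral>\<^sup>+t. (\<integral>\<^sup>+\<omega>. ennreal (discount l t \<omega>) * indicator {0..} t \<partial>P) \<partial>lborel)"
  proof (rule nn_integral_cong_AE)
    show "AE t in lborel. (\<integral>\<^sup>+\<omega>. ennreal (exp (- t) * exp (- l * (t powr (3/2) * area_running_max B \<omega>))) * indicator {0..} t \<partial>P)
      = (\<integral>\<^sup>+\<omega>. ennreal (discount l t \<omega>) * indicator {0..} t \<partial>P)"
      \<comment> \<open>Scaling requires t > 0; the time 0 is discarded as a null set.\<close>
      using AE_lborel_singleton[of "0::real"]
    proof eventually_elim
      case (elim t)
      show ?case
      proof (cases "0 < t")
        case True
        then show ?thesis using slice[OF True] by simp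
      qed (use elim in auto)
    qed
  qed
  also have "\<dots> = (\<integral>\<^sup>+\<omega>. (\<integral>\<^sup>+t. ennreal (discount l t \<omega>) * indicator {0..} t \<partial>lborel) \<partial>P)"
    by (rule PL.Fubini') (unfold split_beta', measurable)
  also have "\<dots> = (\<integral>\<^sup>+v. ennreal (exp (- v) * (1 + 3 / (2 * sqrt 2) * l * v) powr (- 2/3)) * indicator {0..} v \<partial>lborel)"
    unfolding nn_integral_expectation_discount[OF l] by (rule nn_integral_potential[OF l])
  finally show ?thesis .
qed

end

section \<open>Moments of the area\<close>

text \<open>The Gamma law of shape c and rate 1; shape 1 is the standard exponential law. The form
  with \<open>powr\<close> divided by \<open>exp\<close> is that of
  \<open>Gamma_integral_real\<close>.\<close>

definition gamma_measure :: "real \<Rightarrow> real measure" where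
  "gamma_measure c = density lborel (\<lambda>g. ennreal (g powr (c - 1) / exp g / Gamma c) * indicator {0..} g)"

lemma sets_gamma_measure [measurable_cong, simp]: "sets (gamma_measure c) = sets borel"
  by (simp add: gamma_measure_def)

lemma space_gamma_measure [simp]: "space (gamma_measure c) = UNIV"
  by (simp add: gamma_measure_def)

lemma nn_integral_gamma_measure:
  assumes "f \<in> borel_measurable borel"
  shows "(\<integral>\<^sup>+g. f g \<partial>gamma_measure c) = (\<integral>\<^sup>+g. ennreal (g powr (c - 1) / exp g / Gamma c) * indicator {0..} g * f g \<partial>lborel)"
  unfolding gamma_measure_def using assms by (subst nn_integral_density) auto

text \<open>The point 0 must be excluded because \<open>0 powr 0\<close> is 0 whereas
  \<open>0 ^ 0\<close> is 1; otherwise the passage between the two kinds of powers would fail for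
  the moment of order 0.\<close>

lemma AE_gamma_measure_pos: "AE g in gamma_measure c. 0 < g"
  unfolding gamma_measure_def
proof (subst AE_density)
  show "AE g in lborel. 0 < ennreal (g powr (c - 1) / exp g / Gamma c) * indicator {0..} g \<longrightarrow> 0 < g"
    using AE_lborel_singleton[of "0::real"] by eventually_elim (auto simp: indicator_def)
qed measurable

lemma nn_integral_Gamma:
  assumes "0 < (c::real)"
  shows "(\<integral>\<^sup>+g. ennreal (g powr (c - 1) / exp g) * indicator {0..} g \<partial>lborel) = ennreal (Gamma c)"
  by (rule nn_integral_has_integral_lebesgue'[OF _ Gamma_integral_real[OF assms]]) auto

lemma nn_integral_gamma_measure_powr:
  assumes c: "0 < c" and r: "0 \<le> r"
  shows "(\<integral>\<^sup>+g. ennreal (g powr r) \<partial>gamma_measure c) = ennreal (Gamma (c + r) / Gamma c)"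
proof -
  have G: "0 < Gamma c" using c by (rule Gamma_real_pos)
  have "(\<integral>\<^sup>+g. ennreal (g powr r) \<partial>gamma_measure c)
     = (\<integral>\<^sup>+g. ennreal (1 / Gamma c) * (ennreal (g powr (c + r - 1) / exp g) * indicator {0..} g) \<partial>lborel)"
  proof (subst nn_integral_gamma_measure, simp, rule nn_integral_cong)
    fix g :: real
    have "g powr (c - 1) * g powr r = g powr (c + r - 1)" by (simp add: powr_add[symmetric] algebra_simps)
    then have "g powr (c - 1) / exp g / Gamma c * g powr r = 1 / Gamma c * (g powr (c + r - 1) / exp g)"
      by (simp add: field_simps)
    then have "ennreal (g powr (c - 1) / exp g / Gamma c) * ennreal (g powr r) = ennreal (1 / Gamma c) * ennreal (g powr (c + r - 1) / exp g)"
      using G by (simp only: ennreal_mult[symmetric] divide_nonneg_nonneg powr_ge_zero exp_ge_zero less_imp_le zero_le_one)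
    then show "ennreal (g powr (c - 1) / exp g / Gamma c) * indicator {0..} g * ennreal (g powr r) =
      ennreal (1 / Gamma c) * (ennreal (g powr (c + r - 1) / exp g) * indicator {0..} g)"
      by (cases "0 \<le> g") auto
  qed
  also have "\<dots> = ennreal (1 / Gamma c) * ennreal (Gamma (c + r))"
    using c r by (subst nn_integral_cmult) (auto simp: nn_integral_Gamma)
  also have "\<dots> = ennreal (Gamma (c + r) / Gamma c)"
    using G c r by (simp add: ennreal_mult[symmetric] Gamma_real_pos less_imp_le)
  finally show ?thesis .
qed

text \<open>Substituting (1 + s) g in the Gamma integral pulls out the power of 1 + s. With c = 2/3
  this turns the power -2/3 in \<open>area_laplace\<close> into a Laplace transform.\<close>

lemma nn_integral_gamma_measure_exp:
  assumes c: "0 < c" and s: "0 \<le> s"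
  shows "(\<integral>\<^sup>+g. ennreal (exp (- s * g)) \<partial>gamma_measure c) = ennreal ((1 + s) powr (- c))"
proof -
  have G: "0 < Gamma c" using c by (rule Gamma_real_pos)
  let ?f = "\<lambda>g. ennreal (g powr (c - 1) / exp g) * indicator {0..} g"
  have "ennreal (Gamma c) = ennreal \<bar>1 + s\<bar> * (\<integral>\<^sup>+x. ?f (0 + (1 + s) * x) \<partial>lborel)"
    using s by (subst nn_integral_Gamma[OF c, symmetric], intro nn_integral_real_affine) auto
  also have "(\<integral>\<^sup>+x. ?f (0 + (1 + s) * x) \<partial>lborel)
    = (\<integral>\<^sup>+x. ennreal (Gamma c * (1 + s) powr (c - 1)) * (ennreal (x powr (c - 1) / exp x / Gamma c) * indicator {0..} x * ennreal (exp (- s * x))) \<partial>lborel)"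
  proof (rule nn_integral_cong)
    fix x :: real
    show "?f (0 + (1 + s) * x) = ennreal (Gamma c * (1 + s) powr (c - 1)) * (ennreal (x powr (c - 1) / exp x / Gamma c) * indicator {0..} x * ennreal (exp (- s * x)))"
    proof (cases "0 \<le> x")
      case True
      have "exp ((1 + s) * x) = exp x / exp (- s * x)" by (simp add: exp_diff[symmetric] algebra_simps)
      then have "((1 + s) * x) powr (c - 1) / exp ((1 + s) * x) =
        Gamma c * (1 + s) powr (c - 1) * (x powr (c - 1) / exp x / Gamma c * exp (- s * x))"
      proof -
        have alg: "p * q / (X / E) = G * p * (q / X / G * E)" if "G \<noteq> 0" for p q X E G :: real
          using that by simp
        have "((1 + s) * x) powr (c - 1) = (1 + s) powr (c - 1) * x powr (c - 1)"
          using True s by (simp add: powr_mult)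
        then show ?thesis using \<open>exp ((1 + s) * x) = exp x / exp (- s * x)\<close> G by (simp only: alg less_imp_neq[symmetric] not_False_eq_True)
      qed
      then show ?thesis using True s G by (simp add: ennreal_mult[symmetric] mult_nonneg_nonneg)
    next
      case False
      then have "\<not> 0 \<le> (1 + s) * x" using s by (simp add: zero_le_mult_iff)
      then show ?thesis using False by simp
    qed
  qed
  also have "\<dots> = ennreal (Gamma c * (1 + s) powr (c - 1)) * (\<integral>\<^sup>+g. ennreal (exp (- s * g)) \<partial>gamma_measure c)"
    by (subst nn_integral_gamma_measure, simp) (rule nn_integral_cmult, measurable)
  finally have e: "ennreal (Gamma c) = ennreal (1 + s) * (ennreal (Gamma c * (1 + s) powr (c - 1)) * (\<integral>\<^sup>+g. ennreal (exp (- s * g)) \<partial>gamma_measure c))"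
    using s by simp
  let ?k = "(1 + s) * (Gamma c * (1 + s) powr (c - 1))"
  have k: "?k = Gamma c * (1 + s) powr c" "0 < ?k"
    using s G powr_add[of "1 + s" 1 "c - 1"] by auto
  have "ennreal ?k * (\<integral>\<^sup>+g. ennreal (exp (- s * g)) \<partial>gamma_measure c) = ennreal (Gamma c)"
    using e s G by (simp add: ennreal_mult mult.assoc)
  also have "\<dots> = ennreal ?k * ennreal ((1 + s) powr (- c))"
    using s G k(1) by (subst ennreal_mult[symmetric]) (auto simp: powr_minus field_simps)
  finally show ?thesis
    using k(2) ennreal_mult_cancel_left by auto
qed

lemma prob_space_gamma_measure:
  assumes "0 < c"
  shows "prob_space (gamma_measure c)"
proof
  show "emeasure (gamma_measure c) (space (gamma_measure c)) = 1"
    using nn_integral_gamma_measure_exp[OF assms, of 0] by simp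
qed

text \<open>The finite differences \<open>m\<^sup>k (1 - exp (- U / m))\<^sup>k\<close> have expectations determined by the
  Laplace transform, are bounded by \<open>U\<^sup>k\<close>, and converge to it.\<close>

lemma moments_le_of_laplace_eq:
  fixes U :: "'a \<Rightarrow> real" and W :: "'b \<Rightarrow> real"
  assumes M: "prob_space M" and N: "prob_space N"
    and U[measurable]: "U \<in> borel_measurable M" and W[measurable]: "W \<in> borel_measurable N"
    and U0: "AE x in M. 0 \<le> U x" and W0: "AE x in N. 0 \<le> W x"
    and eq: "\<And>l. 0 \<le> l \<Longrightarrow> (LINT x|M. exp (- l * U x)) = (LINT x|N. exp (- l * W x))"
  shows "(\<integral>\<^sup>+x. ennreal (U x ^ k) \<partial>M) \<le> (\<integral>\<^sup>+x. ennreal (W x ^ k) \<partial>N)"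
proof -
  interpret M: prob_space M by (rule M)
  interpret N: prob_space N by (rule N)
  define d where "d = (\<lambda>n u. (real (Suc n) * (1 - exp (- (1 / real (Suc n)) * u))) ^ k)"
  have [measurable]: "d n \<in> borel_measurable borel" for n unfolding d_def by measurable
  \<comment> \<open>With y = u / (n + 1), both bounds come from 1 - y <= exp (- y) <= 1 / (1 +
    y).\<close>
  have inner: "0 \<le> real (Suc n) * (1 - exp (- (1 / real (Suc n)) * u))"
    "real (Suc n) * (1 - exp (- (1 / real (Suc n)) * u)) \<le> u"
    "u / (1 + u / real (Suc n)) \<le> real (Suc n) * (1 - exp (- (1 / real (Suc n)) * u))" if u: "0 \<le> u" for n u
  proof -
    define m where "m = real (Suc n)"
    have m: "0 < m" by (simp add: m_def)
    define y where "y = u / m"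
    have y: "0 \<le> y" "u = m * y" "- (1 / m) * u = - y" using m u by (auto simp: y_def)
    have "1 + - y \<le> exp (- y)" by (rule exp_ge_add_one_self)
    then have 2: "m * (1 - exp (- y)) \<le> m * y" using m by (intro mult_left_mono) auto
    have "1 + y \<le> exp y" by (rule exp_ge_add_one_self)
    then have "exp (- y) \<le> 1 / (1 + y)" using y by (simp add: exp_minus field_simps)
    then have "y / (1 + y) \<le> 1 - exp (- y)" using y by (simp add: field_simps)
    then have 3: "m * (y / (1 + y)) \<le> m * (1 - exp (- y))" using m by (intro mult_left_mono) auto
    show "0 \<le> real (Suc n) * (1 - exp (- (1 / real (Suc n)) * u))"
      unfolding m_def[symmetric] y(3) using m y by (intro mult_nonneg_nonneg) auto
    show "real (Suc n) * (1 - exp (- (1 / real (Suc n)) * u)) \<le> u"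
      unfolding m_def[symmetric] y(3) using 2 y(2) by simp
    show "u / (1 + u / real (Suc n)) \<le> real (Suc n) * (1 - exp (- (1 / real (Suc n)) * u))"
    proof -
      have "u / m = y" by (simp add: y_def)
      then show ?thesis
        unfolding m_def[symmetric] y(3) using 3 unfolding times_divide_eq_right y(2)[symmetric] by simp
    qed
  qed
  have d_lim: "(\<lambda>n. d n u) \<longlonglongrightarrow> u ^ k" if u: "0 \<le> u" for u
    unfolding d_def
  proof (rule tendsto_power, rule tendsto_sandwich[where f="\<lambda>n. u / (1 + u / real (Suc n))" and h="\<lambda>_. u"])
    have "(\<lambda>n. u / real (Suc n)) \<longlonglongrightarrow> 0" by (rule LIMSEQ_Suc) (rule lim_const_over_n)
    then have "(\<lambda>n. u / (1 + u / real (Suc n))) \<longlonglongrightarrow> u / (1 + 0)" by (intro tendsto_intros) auto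
    then show "(\<lambda>n. u / (1 + u / real (Suc n))) \<longlonglongrightarrow> u" by simp
  qed (use inner[OF u] in auto)
  have d_bounds: "0 \<le> d n u" "d n u \<le> u ^ k" if "0 \<le> u" for n u
    unfolding d_def using inner[OF that] by (auto intro!: zero_le_power power_mono)
  \<comment> \<open>By the binomial theorem only exponentials with rates j / (n + 1) occur, so the
    integrals of \<open>d n (U x)\<close> and \<open>d n (W x)\<close> agree by
    \<open>eq\<close>.\<close>
  have expand: "d n u = (\<Sum>j\<le>k. real (Suc n) ^ k * (real (k choose j) * (-1) ^ j) * exp (- (real j / real (Suc n)) * u))" for n u
  proof -
    have "(1 - exp (- (1 / real (Suc n)) * u)) ^ k = ((- exp (- (1 / real (Suc n)) * u)) + 1) ^ k" by simp
    also have "\<dots> = (\<Sum>j\<le>k. real (k choose j) * (- exp (- (1 / real (Suc n)) * u)) ^ j * 1 ^ (k - j))"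
      by (rule binomial_ring)
    also have "\<dots> = (\<Sum>j\<le>k. (real (k choose j) * (-1) ^ j) * exp (- (real j / real (Suc n)) * u))"
      by (intro sum.cong refl) (simp add: power_minus[of "exp _"] exp_of_nat_mult[symmetric])
    finally show ?thesis unfolding d_def power_mult_distrib by (simp add: sum_distrib_left mult_ac)
  qed
  have intM: "integrable M (\<lambda>x. exp (- l * U x))" if "0 \<le> l" for l
    by (rule M.integrable_const_bound[of _ 1]) (use U0 that in auto)
  have intN: "integrable N (\<lambda>x. exp (- l * W x))" if "0 \<le> l" for l
    by (rule N.integrable_const_bound[of _ 1]) (use W0 that in auto)
  have dM: "integrable M (\<lambda>x. d n (U x))" and dN: "integrable N (\<lambda>x. d n (W x))" for n
    unfolding expand by (intro Bochner_Integration.integrable_sum integrable_mult_right intM intN; simp)+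
  have "(LINT x|M. d n (U x)) = (LINT x|N. d n (W x))" for n
  proof -
    let ?c = "\<lambda>j. real (Suc n) ^ k * (real (k choose j) * (-1) ^ j)" and ?l = "\<lambda>j. real j / real (Suc n)"
    have l: "0 \<le> ?l j" for j by simp
    have "(LINT x|M. d n (U x)) = (\<Sum>j\<le>k. LINT x|M. ?c j * exp (- ?l j * U x))"
      unfolding expand by (intro Bochner_Integration.integral_sum integrable_mult_right intM l)
    also have "\<dots> = (\<Sum>j\<le>k. LINT x|N. ?c j * exp (- ?l j * W x))"
      by (simp only: integral_mult_right_zero eq[OF l])
    also have "\<dots> = (LINT x|N. d n (W x))"
      unfolding expand by (intro Bochner_Integration.integral_sum[symmetric] integrable_mult_right intN l)
    finally show ?thesis .
  qed
  then have d_eq: "(\<integral>\<^sup>+x. ennreal (d n (U x)) \<partial>M) = (\<integral>\<^sup>+x. ennreal (d n (W x)) \<partial>N)" for n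
    using U0 W0 d_bounds(1) by (subst (1 2) nn_integral_eq_integral) (auto intro: dM dN elim!: eventually_mono)
  \<comment> \<open>Fatou on the side of U and the pointwise bound on the side of W yield an
    inequality even when moments are infinite. Equality comes later from exchanging the roles of U
    and W.\<close>
  have "(\<integral>\<^sup>+x. ennreal (U x ^ k) \<partial>M) = (\<integral>\<^sup>+x. liminf (\<lambda>n. ennreal (d n (U x))) \<partial>M)"
  proof (rule nn_integral_cong_AE)
    show "AE x in M. ennreal (U x ^ k) = liminf (\<lambda>n. ennreal (d n (U x)))"
      using U0
    proof eventually_elim
      case (elim x)
      have "(\<lambda>n. ennreal (d n (U x))) \<longlonglongrightarrow> ennreal (U x ^ k)"
        by (intro tendsto_ennrealI d_lim elim)
      then show ?case by (intro lim_imp_Liminf[symmetric]) auto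
    qed
  qed
  also have "\<dots> \<le> liminf (\<lambda>n. \<integral>\<^sup>+x. ennreal (d n (U x)) \<partial>M)"
    by (intro nn_integral_liminf) measurable
  also have "\<dots> \<le> (\<integral>\<^sup>+x. ennreal (W x ^ k) \<partial>N)"
    unfolding d_eq
  proof (rule Liminf_le)
    have "(\<integral>\<^sup>+x. ennreal (d n (W x)) \<partial>N) \<le> (\<integral>\<^sup>+x. ennreal (W x ^ k) \<partial>N)" for n
    proof (rule nn_integral_mono_AE)
      show "AE x in N. ennreal (d n (W x)) \<le> ennreal (W x ^ k)"
        using W0 by eventually_elim (intro ennreal_leI d_bounds(2))
    qed
    then show "\<forall>\<^sub>F n in sequentially. (\<integral>\<^sup>+x. ennreal (d n (W x)) \<partial>N) \<le> (\<integral>\<^sup>+x. ennreal (W x ^ k) \<partial>N)"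
      by simp
  qed simp
  finally show ?thesis .
qed

context brownian_motion
begin

text \<open>The variables \<open>U\<close>, with an exponential time t, and \<open>W\<close>, with
  an exponential v and a Gamma(2/3) variable g, have equal transforms, hence equal moments. The k-th
  moments of t^(3/2), v and g are Gamma (1 + 3k/2), k! and Gamma (2/3 + k) / Gamma (2/3);
  independence factorises both sides, and one divides by the first.\<close>

lemma area_moment:
  "(\<integral>\<^sup>+\<omega>. ennreal (area_running_max B \<omega> ^ k) \<partial>P)
    = ennreal ((3 / (2 * sqrt 2)) ^ k * fact k * (Gamma (2/3 + real k) / Gamma (2/3)) / Gamma (1 + 3/2 * real k))"
proof -
  define a :: real where "a = 3 / (2 * sqrt 2)"
  have a: "0 < a" by (simp add: a_def)
  let ?A = "area_running_max B"
  interpret E: prob_space "gamma_measure 1" by (rule prob_space_gamma_measure) simp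
  interpret G: prob_space "gamma_measure (2/3)" by (rule prob_space_gamma_measure) simp
  interpret PE: pair_prob_space P "gamma_measure 1" ..
  interpret EG: pair_prob_space "gamma_measure 1" "gamma_measure (2/3)" ..
  define U where "U = (\<lambda>(\<omega>, t). t powr (3/2) * ?A \<omega>)"
  define W where "W = (\<lambda>(v, g). a * v * g :: real)"
  have Um [measurable]: "U \<in> borel_measurable (P \<Otimes>\<^sub>M gamma_measure 1)" unfolding U_def by measurable
  have Wm [measurable]: "W \<in> borel_measurable (gamma_measure 1 \<Otimes>\<^sub>M gamma_measure (2/3))" unfolding W_def by measurable
  have U0: "AE x in P \<Otimes>\<^sub>M gamma_measure 1. 0 \<le> U x"
  proof (rule PE.AE_pair_measure)
    show "AE \<omega> in P. AE t in gamma_measure 1. 0 \<le> U (\<omega>, t)"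
      using area_running_max_nonneg by eventually_elim (simp add: U_def)
  qed measurable
  have W0: "AE x in gamma_measure 1 \<Otimes>\<^sub>M gamma_measure (2/3). 0 \<le> W x"
  proof (rule EG.AE_pair_measure)
    show "AE x in gamma_measure 1. AE y in gamma_measure (2/3). 0 \<le> W (x, y)"
      using AE_gamma_measure_pos[of 1]
    proof eventually_elim
      case (elim v)
      show ?case using AE_gamma_measure_pos[of "2/3"]
        by eventually_elim (use elim a in \<open>simp add: W_def\<close>)
    qed
  qed measurable
  \<comment> \<open>At t = 0 the density of shape 1 is \<open>0 powr 0\<close>, which is 0 and not
    exp 0, so the integrands agree only almost everywhere.\<close>
  have one: "(\<integral>\<^sup>+t. f t \<partial>gamma_measure 1) = (\<integral>\<^sup>+t. ennreal (exp (- t)) * f t * indicator {0..} t \<partial>lborel)"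
    if [measurable]: "f \<in> borel_measurable borel" for f
  proof (subst nn_integral_gamma_measure, simp add: that, rule nn_integral_cong_AE)
    show "AE t in lborel. ennreal (t powr (1 - 1) / exp t / Gamma 1) * indicator {0..} t * f t = ennreal (exp (- t)) * f t * indicator {0..} t"
      using AE_lborel_singleton[of "0::real"]
      by eventually_elim (simp add: exp_minus inverse_eq_divide mult_ac)
  qed
  have lap: "(\<integral>\<^sup>+x. ennreal (exp (- l * U x)) \<partial>(P \<Otimes>\<^sub>M gamma_measure 1)) =
    (\<integral>\<^sup>+x. ennreal (exp (- l * W x)) \<partial>(gamma_measure 1 \<Otimes>\<^sub>M gamma_measure (2/3)))" if l: "0 < l" for l
  proof -
    have "(\<integral>\<^sup>+x. ennreal (exp (- l * U x)) \<partial>(P \<Otimes>\<^sub>M gamma_measure 1)) =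
      (\<integral>\<^sup>+\<omega>. (\<integral>\<^sup>+t. ennreal (exp (- l * U (\<omega>, t))) \<partial>gamma_measure 1) \<partial>P)"
      by (rule E.nn_integral_fst[symmetric]) measurable
    also have "\<dots> = (\<integral>\<^sup>+\<omega>. (\<integral>\<^sup>+t. ennreal (exp (- t) * exp (- l * (t powr (3/2) * ?A \<omega>))) * indicator {0..} t \<partial>lborel) \<partial>P)"
      by (intro nn_integral_cong) (subst one, auto simp: U_def ennreal_mult)
    also have "\<dots> = (\<integral>\<^sup>+v. ennreal (exp (- v) * (1 + a * l * v) powr (- 2/3)) * indicator {0..} v \<partial>lborel)"
      unfolding a_def by (rule area_laplace[OF l])
    also have "\<dots> = (\<integral>\<^sup>+v. ennreal ((1 + a * l * v) powr (- 2/3)) \<partial>gamma_measure 1)"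
      by (subst one) (auto simp: ennreal_mult)
    also have "\<dots> = (\<integral>\<^sup>+v. (\<integral>\<^sup>+g. ennreal (exp (- l * W (v, g))) \<partial>gamma_measure (2/3)) \<partial>gamma_measure 1)"
    proof (rule nn_integral_cong_AE)
      show "AE v in gamma_measure 1. ennreal ((1 + a * l * v) powr (- 2/3)) = (\<integral>\<^sup>+g. ennreal (exp (- l * W (v, g))) \<partial>gamma_measure (2/3))"
        using AE_gamma_measure_pos[of 1]
      proof eventually_elim
        case (elim v)
        then show ?case
          using nn_integral_gamma_measure_exp[of "2/3" "a * l * v"] a l by (simp add: W_def mult_ac)
      qed
    qed
    also have "\<dots> = (\<integral>\<^sup>+x. ennreal (exp (- l * W x)) \<partial>(gamma_measure 1 \<Otimes>\<^sub>M gamma_measure (2/3)))"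
      by (rule G.nn_integral_fst) measurable
    finally show ?thesis .
  qed
  have lapr: "(integral\<^sup>L (P \<Otimes>\<^sub>M gamma_measure 1) (\<lambda>x. exp (- l * U x))) =
      (integral\<^sup>L (gamma_measure 1 \<Otimes>\<^sub>M gamma_measure (2/3)) (\<lambda>x. exp (- l * W x)))" if l: "0 \<le> l" for l
  proof (cases "l = 0")
    case True
    then show ?thesis using PE.prob_space EG.prob_space by simp
  next
    case False
    have "integrable (P \<Otimes>\<^sub>M gamma_measure 1) (\<lambda>x. exp (- l * U x))"
      by (rule PE.integrable_const_bound[of _ 1]) (use U0 l in auto)
    then have 1: "(\<integral>\<^sup>+x. ennreal (exp (- l * U x)) \<partial>(P \<Otimes>\<^sub>M gamma_measure 1)) = ennreal (integral\<^sup>L (P \<Otimes>\<^sub>M gamma_measure 1) (\<lambda>x. exp (- l * U x)))"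
      by (rule nn_integral_eq_integral) auto
    have "integrable (gamma_measure 1 \<Otimes>\<^sub>M gamma_measure (2/3)) (\<lambda>x. exp (- l * W x))"
      by (rule EG.integrable_const_bound[of _ 1]) (use W0 l in auto)
    then have 2: "(\<integral>\<^sup>+x. ennreal (exp (- l * W x)) \<partial>(gamma_measure 1 \<Otimes>\<^sub>M gamma_measure (2/3))) = ennreal (integral\<^sup>L (gamma_measure 1 \<Otimes>\<^sub>M gamma_measure (2/3)) (\<lambda>x. exp (- l * W x)))"
      by (rule nn_integral_eq_integral) auto
    have "ennreal (integral\<^sup>L (P \<Otimes>\<^sub>M gamma_measure 1) (\<lambda>x. exp (- l * U x))) = ennreal (integral\<^sup>L (gamma_measure 1 \<Otimes>\<^sub>M gamma_measure (2/3)) (\<lambda>x. exp (- l * W x)))"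
      using lap[of l] l False unfolding 1 2 by simp
    then show ?thesis by (subst (asm) ennreal_inj) (auto intro!: integral_nonneg_AE)
  qed
  have eq: "(\<integral>\<^sup>+x. ennreal (U x ^ k) \<partial>(P \<Otimes>\<^sub>M gamma_measure 1)) = (\<integral>\<^sup>+x. ennreal (W x ^ k) \<partial>(gamma_measure 1 \<Otimes>\<^sub>M gamma_measure (2/3)))"
    by (intro antisym moments_le_of_laplace_eq PE.prob_space_axioms EG.prob_space_axioms Um Wm U0 W0 lapr lapr[symmetric])
  have mom: "(\<integral>\<^sup>+g. ennreal ((g powr r) ^ k) \<partial>gamma_measure c) = ennreal (Gamma (c + r * real k) / Gamma c)"
    if "0 < c" "0 < r" for c r
  proof -
    have "(\<integral>\<^sup>+g. ennreal ((g powr r) ^ k) \<partial>gamma_measure c) = (\<integral>\<^sup>+g. ennreal (g powr (r * real k)) \<partial>gamma_measure c)"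
    proof (rule nn_integral_cong_AE)
      show "AE g in gamma_measure c. ennreal ((g powr r) ^ k) = ennreal (g powr (r * real k))"
        using AE_gamma_measure_pos[of c] by eventually_elim (simp add: powr_power mult.commute)
    qed
    then show ?thesis using that by (simp add: nn_integral_gamma_measure_powr)
  qed
  have "(\<integral>\<^sup>+x. ennreal (U x ^ k) \<partial>(P \<Otimes>\<^sub>M gamma_measure 1)) = (\<integral>\<^sup>+\<omega>. (\<integral>\<^sup>+t. ennreal (U (\<omega>, t) ^ k) \<partial>gamma_measure 1) \<partial>P)"
    by (rule E.nn_integral_fst[symmetric]) measurable
  also have "\<dots> = (\<integral>\<^sup>+\<omega>. ennreal (?A \<omega> ^ k) * ennreal (Gamma (1 + 3/2 * real k)) \<partial>P)"
  proof (rule nn_integral_cong_AE)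
    show "AE \<omega> in P. (\<integral>\<^sup>+t. ennreal (U (\<omega>, t) ^ k) \<partial>gamma_measure 1) = ennreal (?A \<omega> ^ k) * ennreal (Gamma (1 + 3/2 * real k))"
      using area_running_max_nonneg
    proof eventually_elim
      case (elim \<omega>)
      have "(\<integral>\<^sup>+t. ennreal (U (\<omega>, t) ^ k) \<partial>gamma_measure 1) = (\<integral>\<^sup>+t. ennreal (?A \<omega> ^ k) * ennreal ((t powr (3/2)) ^ k) \<partial>gamma_measure 1)"
        using elim by (intro nn_integral_cong) (simp add: U_def power_mult_distrib ennreal_mult mult_ac)
      also have "\<dots> = ennreal (?A \<omega> ^ k) * ennreal (Gamma (1 + 3/2 * real k))"
        by (subst nn_integral_cmult) (auto simp: mom)
      finally show ?case .
    qed
  qed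
  also have "\<dots> = (\<integral>\<^sup>+\<omega>. ennreal (?A \<omega> ^ k) \<partial>P) * ennreal (Gamma (1 + 3/2 * real k))"
    by (rule nn_integral_multc) measurable
  finally have L: "(\<integral>\<^sup>+x. ennreal (U x ^ k) \<partial>(P \<Otimes>\<^sub>M gamma_measure 1)) = (\<integral>\<^sup>+\<omega>. ennreal (?A \<omega> ^ k) \<partial>P) * ennreal (Gamma (1 + 3/2 * real k))" .
  have mom1: "(\<integral>\<^sup>+g. ennreal (g ^ k) \<partial>gamma_measure c) = ennreal (Gamma (c + real k) / Gamma c)" if "0 < c" for c
  proof -
    have "(\<integral>\<^sup>+g. ennreal (g ^ k) \<partial>gamma_measure c) = (\<integral>\<^sup>+g. ennreal ((g powr 1) ^ k) \<partial>gamma_measure c)"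
    proof (rule nn_integral_cong_AE)
      show "AE g in gamma_measure c. ennreal (g ^ k) = ennreal ((g powr 1) ^ k)"
        using AE_gamma_measure_pos[of c] by eventually_elim simp
    qed
    then show ?thesis using mom[of c 1] that by simp
  qed
  let ?g = "Gamma (2/3 + real k) / Gamma (2/3 :: real)"
  have g: "0 \<le> ?g" by (intro divide_nonneg_nonneg less_imp_le Gamma_real_pos) auto
  have "(\<integral>\<^sup>+x. ennreal (W x ^ k) \<partial>(gamma_measure 1 \<Otimes>\<^sub>M gamma_measure (2/3))) = (\<integral>\<^sup>+v. (\<integral>\<^sup>+g. ennreal (W (v, g) ^ k) \<partial>gamma_measure (2/3)) \<partial>gamma_measure 1)"
    by (rule G.nn_integral_fst[symmetric]) measurable
  also have "\<dots> = (\<integral>\<^sup>+v. ennreal (a ^ k * ?g) * ennreal (v ^ k) \<partial>gamma_measure 1)"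
  proof (rule nn_integral_cong_AE)
    show "AE v in gamma_measure 1. (\<integral>\<^sup>+g. ennreal (W (v, g) ^ k) \<partial>gamma_measure (2/3)) = ennreal (a ^ k * ?g) * ennreal (v ^ k)"
      using AE_gamma_measure_pos[of 1]
    proof eventually_elim
      case (elim v)
      have "(\<integral>\<^sup>+g. ennreal (W (v, g) ^ k) \<partial>gamma_measure (2/3)) = (\<integral>\<^sup>+g. ennreal ((a * v) ^ k) * ennreal (g ^ k) \<partial>gamma_measure (2/3))"
      proof (rule nn_integral_cong_AE)
        show "AE g in gamma_measure (2/3). ennreal (W (v, g) ^ k) = ennreal ((a * v) ^ k) * ennreal (g ^ k)"
          using AE_gamma_measure_pos[of "2/3"]
          by eventually_elim (use elim a in \<open>simp add: W_def power_mult_distrib ennreal_mult[symmetric]\<close>)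
      qed
      also have "\<dots> = ennreal ((a * v) ^ k) * ennreal ?g"
        by (subst nn_integral_cmult) (auto simp: mom1)
      also have "\<dots> = ennreal (a ^ k * ?g) * ennreal (v ^ k)"
        using g elim a by (simp only: ennreal_mult[symmetric] zero_le_power mult_nonneg_nonneg less_imp_le power_mult_distrib mult_ac)
      finally show ?case .
    qed
  qed
  also have "\<dots> = ennreal (a ^ k * ?g) * ennreal (Gamma (1 + real k))"
    by (subst nn_integral_cmult) (auto simp: mom1)
  also have "\<dots> = ennreal (a ^ k * ?g * fact k)"
    using g a Gamma_fact[of k, where 'a=real] by (subst ennreal_mult[symmetric]) auto
  finally have R: "(\<integral>\<^sup>+x. ennreal (W x ^ k) \<partial>(gamma_measure 1 \<Otimes>\<^sub>M gamma_measure (2/3))) = ennreal (a ^ k * ?g * fact k)" .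
  define Q where "Q = Gamma (1 + 3/2 * real k)"
  have Q: "0 < Q" unfolding Q_def by (rule Gamma_real_pos) (simp add: add_pos_nonneg)
  have "ennreal Q * (\<integral>\<^sup>+\<omega>. ennreal (?A \<omega> ^ k) \<partial>P) = ennreal (a ^ k * ?g * fact k)"
    using eq unfolding L R Q_def by (simp only: mult.commute)
  also have "a ^ k * ?g * fact k = Q * (a ^ k * fact k * ?g / Q)"
    using Q by simp
  also have "ennreal \<dots> = ennreal Q * ennreal (a ^ k * fact k * ?g / Q)"
    by (intro ennreal_mult divide_nonneg_nonneg mult_nonneg_nonneg g) (use Q a in auto)
  finally show ?thesis
    unfolding a_def[symmetric] Q_def[symmetric] using Q by (simp only: ennreal_mult_cancel_left) auto
qed

end

section \<open>The power series and their hypergeometric form\<close>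

lemma Gamma_real_plus1: "0 < x \<Longrightarrow> Gamma (x + 1) = x * Gamma x" for x :: real
  by (rule Gamma_plus1) (auto elim!: nonpos_Ints_cases)

lemma Gamma_real_nonzero: "0 < x \<Longrightarrow> Gamma x \<noteq> 0" for x :: real
  using Gamma_real_pos[of x] by force

lemma Gamma_legendre_duplication_real:
  assumes "0 < (x::real)"
  shows "Gamma x * Gamma (x + 1/2) = 2 powr (1 - 2 * x) * sqrt pi * Gamma (2 * x)"
proof -
  have n: "complex_of_real y \<notin> \<int>\<^sub>\<le>\<^sub>0" if "0 < y" for y
  proof
    assume "complex_of_real y \<in> \<int>\<^sub>\<le>\<^sub>0"
    then obtain k where k: "complex_of_real y = of_int k" "k \<le> 0" by (rule nonpos_Ints_cases)
    have "y = Re (complex_of_real y)" by simp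
    also have "\<dots> = of_int k" unfolding k(1) by simp
    finally show False using k(2) that by simp
  qed
  have "Gamma (complex_of_real x) * Gamma (complex_of_real x + 1/2) =
      exp ((1 - 2 * complex_of_real x) * of_real (ln 2)) * of_real (sqrt pi) * Gamma (2 * complex_of_real x)"
    using n[of x] n[of "x + 1/2"] assms by (intro Gamma_legendre_duplication) auto
  also have "complex_of_real x + 1/2 = of_real (x + 1/2)" by simp
  also have "2 * complex_of_real x = of_real (2 * x)" by simp
  also have "exp ((1 - of_real (2 * x)) * of_real (ln 2)) = complex_of_real (exp ((1 - 2 * x) * ln 2))"
    by (simp flip: exp_of_real)
  also have "exp ((1 - 2 * x) * ln 2) = 2 powr (1 - 2 * x)" by (simp add: powr_def)
  finally have "complex_of_real (Gamma x * Gamma (x + 1/2)) = complex_of_real (2 powr (1 - 2 * x) * sqrt pi * Gamma (2 * x))"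
    by (simp only: Gamma_complex_of_real of_real_mult[symmetric])
  then show ?thesis by (simp only: of_real_eq_iff)
qed

definition density_const :: real where
  "density_const = 3 powr (1/2) * Gamma (1/3) / (2 powr (5/6) * pi)"

text \<open>Up to the sign (-1)^n, the coefficient of y^n in f(x) / sqrt x, where y =
  x^(3/2).\<close>

definition density_coeff :: "nat \<Rightarrow> real" where
  "density_coeff n = density_const * (Gamma (1 + real n / 2) * Gamma (4/3 + real n / 2) /
     (Gamma (7/6 + real n / 2) * fact n) * (2/3) powr (real n / 2))"

text \<open>By \<open>area_moment\<close> this is the n-th moment of A divided by n!.\<close>

definition moment_coeff :: "nat \<Rightarrow> real" where
  "moment_coeff n = (3 / (2 * sqrt 2)) ^ n * (Gamma (2/3 + real n) / Gamma (2/3)) / Gamma (1 + 3/2 * real n)"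

lemma density_const_pos: "0 < density_const"
  unfolding density_const_def by (intro divide_pos_pos mult_pos_pos Gamma_real_pos) auto

lemma density_coeff_nonneg: "0 \<le> density_coeff n"
  unfolding density_coeff_def
  by (intro mult_nonneg_nonneg divide_nonneg_nonneg less_imp_le[OF Gamma_real_pos] less_imp_le[OF density_const_pos])
     (auto intro: add_pos_nonneg)

lemma moment_coeff_nonneg: "0 \<le> moment_coeff n"
  unfolding moment_coeff_def
  by (intro mult_nonneg_nonneg divide_nonneg_nonneg less_imp_le[OF Gamma_real_pos])
     (auto intro: add_pos_nonneg)

text \<open>Steps of two, because raising n by 2 raises every Gamma argument by 1; the powers of 2/3
  contribute one factor 2/3.\<close>

lemma density_coeff_rec:
  "density_coeff (n + 2) = density_coeff n * ((real n + 8/3) / (3 * (real n + 7/3) * (real n + 1)))"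
proof -
  define m where "m = real n"
  have m: "0 \<le> m" by (simp add: m_def)
  have g1: "Gamma (1 + real (n + 2) / 2) = (1 + m/2) * Gamma (1 + m/2)"
    using Gamma_real_plus1[of "1 + m/2"] m by (simp add: m_def field_simps)
  have g2: "Gamma (4/3 + real (n + 2) / 2) = (4/3 + m/2) * Gamma (4/3 + m/2)"
    using Gamma_real_plus1[of "4/3 + m/2"] m by (simp add: m_def field_simps)
  have g3: "Gamma (7/6 + real (n + 2) / 2) = (7/6 + m/2) * Gamma (7/6 + m/2)"
    using Gamma_real_plus1[of "7/6 + m/2"] m by (simp add: m_def field_simps)
  have f: "fact (n + 2) = (m + 2) * (m + 1) * (fact n :: real)"
    by (simp add: m_def algebra_simps)
  have p: "(2/3) powr (real (n + 2) / 2) = (2/3) * (2/3 :: real) powr (m / 2)"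
    using powr_add[of "2/3 :: real" 1 "m/2"] by (simp add: m_def add_divide_distrib)
  \<comment> \<open>The remaining identity is rational; the Gamma values enter as free variables, of
    which only nonvanishing is used.\<close>
  have alg: "A * ((X/2 * G1) * (W/2 * G2) / ((Z/2 * G3) * (X * Y * F)) * ((2/3) * p))
     = A * (G1 * G2 / (G3 * F) * p) * (W / (3 * Z * Y))"
    if "G3 \<noteq> 0" "F \<noteq> 0" "X \<noteq> 0" "Y \<noteq> 0" "Z \<noteq> 0" for A G1 G2 G3 F p X Y Z W :: real
    using that by (simp add: field_simps)
  have e: "1 + m/2 = (m + 2) / 2" "4/3 + m/2 = (m + 8/3) / 2" "7/6 + m/2 = (m + 7/3) / 2"
    by (simp_all add: field_simps)
  have "Gamma (7/6 + m/2) \<noteq> 0" using m by (intro Gamma_real_nonzero) simp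
  then show ?thesis
    unfolding density_coeff_def g1 g2 g3 f p unfolding m_def[symmetric] e using m by (intro alg) auto
qed

text \<open>Raising n by 2 raises 1 + 3n/2 by 3. Of the three factors so produced, the one with m +
  2/3 cancels against Gamma (2/3 + n), which leaves a ratio of the same shape as in
  \<open>density_coeff_rec\<close>.\<close>

lemma moment_coeff_rec:
  "moment_coeff (n + 2) = moment_coeff n * ((real n + 5/3) / (3 * (real n + 2) * (real n + 4/3)))"
proof -
  define m where "m = real n"
  have m: "0 \<le> m" by (simp add: m_def)
  have g1: "Gamma (2/3 + real (n + 2)) = (m + 5/3) * ((m + 2/3) * Gamma (2/3 + m))"
    using Gamma_real_plus1[of "2/3 + m"] Gamma_real_plus1[of "2/3 + m + 1"] m by (simp add: m_def add_ac)
  have g2: "Gamma (1 + 3/2 * real (n + 2)) = (3/2 * (m + 2)) * ((3/2 * (m + 4/3)) * ((3/2 * (m + 2/3)) * Gamma (1 + 3/2 * m)))"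
  proof -
    define z where "z = 1 + 3/2 * m"
    have z: "1 + 3/2 * real (n + 2) = z + 1 + 1 + 1" "z = 3/2 * (m + 2/3)" "z + 1 = 3/2 * (m + 4/3)" "z + 1 + 1 = 3/2 * (m + 2)" "0 < z"
      using m by (simp_all add: z_def m_def)
    have "Gamma (z + 1 + 1 + 1) = (z + 1 + 1) * ((z + 1) * (z * Gamma z))"
      using z(5) by (simp only: Gamma_real_plus1 add_pos_pos zero_less_one)
    also have "\<dots> = (3/2 * (m + 2)) * ((3/2 * (m + 4/3)) * ((3/2 * (m + 2/3)) * Gamma z))"
      by (simp only: z(4)[symmetric] z(3)[symmetric] z(2)[symmetric])
    finally show ?thesis unfolding z(1) z_def .
  qed
  have p: "(3 / (2 * sqrt 2)) ^ (n + 2) = 9/8 * (3 / (2 * sqrt 2)) ^ n"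
    by (simp add: power_add power2_eq_square)
  have alg: "9/8 * A * (W * (Z * G1) / G) / ((3/2 * X) * ((3/2 * Y) * ((3/2 * Z) * G2)))
     = A * (G1 / G) / G2 * (W / (3 * X * Y))"
    if "G \<noteq> 0" "G2 \<noteq> 0" "X \<noteq> 0" "Y \<noteq> 0" "Z \<noteq> 0" for A G G1 G2 X Y Z W :: real
    using that by (simp add: field_simps)
  have "Gamma (1 + 3/2 * m) \<noteq> 0" "Gamma (2/3 :: real) \<noteq> 0"
    using m by (auto intro!: Gamma_real_nonzero)
  then show ?thesis
    unfolding moment_coeff_def g1 g2 p unfolding m_def[symmetric] using m by (intro alg) auto
qed

text \<open>Duplication at 2/3 expresses Gamma (4/3) / Gamma (7/6) by Gamma (2/3), and reflection at
  1/3 evaluates the remaining product Gamma (1/3) Gamma (2/3).\<close>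

lemma density_coeff_0: "density_coeff 0 = sqrt 2 / sqrt pi"
proof -
  have dup: "Gamma (2/3) * Gamma (7/6) = 2 powr (-1/3) * sqrt pi * Gamma (4/3 :: real)"
    using Gamma_legendre_duplication_real[of "2/3"] by simp
  have refl: "Gamma (1/3) * Gamma (2/3) = 2 * pi / sqrt (3 :: real)"
  proof -
    have "Gamma (complex_of_real (1/3)) * Gamma (1 - complex_of_real (1/3)) = of_real pi / sin (of_real pi * complex_of_real (1/3))"
      by (rule Gamma_reflection_complex)
    also have "1 - complex_of_real (1/3) = of_real (2/3)" by simp
    also have "sin (of_real pi * complex_of_real (1/3)) = of_real (sin (pi / 3))"
      by (simp flip: sin_of_real)
    also have "of_real pi / of_real (sin (pi / 3)) = complex_of_real (pi / sin (pi / 3))"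
      by simp
    finally have "complex_of_real (Gamma (1/3) * Gamma (2/3)) = of_real (pi / sin (pi/3))"
      by (simp only: Gamma_complex_of_real of_real_mult)
    then have "Gamma (1/3) * Gamma (2/3) = pi / sin (pi/3)" by (simp only: of_real_eq_iff)
    then show ?thesis by (simp add: sin_60)
  qed
  have r: "Gamma (4/3) / Gamma (7/6) = Gamma (2/3) * 2 powr (1/3) / sqrt (pi :: real)"
  proof -
    have "2 powr (1/3) * (2 powr (-1/3)) = (1::real)" by (simp flip: powr_add)
    then have "2 powr (1/3) * (Gamma (2/3) * Gamma (7/6)) = sqrt pi * Gamma (4/3 :: real)"
      unfolding dup by (simp only: mult.assoc[symmetric] mult_1_left)
    then have "Gamma (4/3) = 2 powr (1/3) * (Gamma (2/3) * Gamma (7/6)) / sqrt (pi :: real)" by simp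
    then show ?thesis using Gamma_real_nonzero[of "7/6"] by simp
  qed
  have "density_coeff 0 = 3 powr (1/2) / (2 powr (5/6) * pi) * (Gamma (1/3) * (Gamma (4/3) / Gamma (7/6)))"
    unfolding density_coeff_def density_const_def by simp
  also have "\<dots> = sqrt 3 / (2 powr (5/6) * pi) * ((Gamma (1/3) * Gamma (2/3)) * 2 powr (1/3) / sqrt pi)"
    unfolding r by (simp add: powr_half_sqrt)
  also have "\<dots> = (2 * 2 powr (1/3) / 2 powr (5/6)) / sqrt pi"
    unfolding refl by (simp add: field_simps)
  also have "2 * 2 powr (1/3) / 2 powr (5/6) = (2 :: real) powr (1 + 1/3 - 5/6)"
    unfolding powr_diff powr_add by simp
  also have "\<dots> = sqrt 2" by (simp add: powr_half_sqrt)
  finally show ?thesis .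
qed

text \<open>Duplication at 4/3 supplies Gamma (4/3) Gamma (11/6); the functional equation lowers 4/3
  to 1/3 and 8/3 to 5/3, after which all Gamma values cancel.\<close>

lemma density_coeff_1: "density_coeff 1 = 5/8"
proof -
  have dup: "Gamma (4/3) * Gamma (11/6) = 2 powr (-5/3) * sqrt pi * Gamma (8/3 :: real)"
    using Gamma_legendre_duplication_real[of "4/3"] by simp
  have g43: "Gamma (4/3 :: real) = 1/3 * Gamma (1/3)" using Gamma_real_plus1[of "1/3"] by simp
  have g83: "Gamma (8/3 :: real) = 5/3 * Gamma (5/3)" using Gamma_real_plus1[of "5/3"] by simp
  have g32: "Gamma (3/2 :: real) = sqrt pi / 2" using Gamma_real_plus1[of "1/2"] by (simp add: Gamma_one_half_real)
  have r: "Gamma (1/3) * (Gamma (11/6) / Gamma (5/3)) = 5 * 2 powr (-5/3) * sqrt (pi :: real)"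
    using dup Gamma_real_nonzero[of "5/3"] unfolding g43 g83 by (simp add: field_simps)
  have "density_coeff 1 = 3 powr (1/2) / (2 powr (5/6) * pi) * (sqrt pi / 2) * (Gamma (1/3) * (Gamma (11/6) / Gamma (5/3))) * (2/3) powr (1/2)"
    unfolding density_coeff_def density_const_def by (simp add: g32 mult_ac)
  also have "\<dots> = sqrt 3 / (2 powr (5/6) * pi) * (sqrt pi / 2) * (5 * 2 powr (-5/3) * sqrt pi) * (sqrt 2 / sqrt 3)"
    unfolding r by (simp add: powr_half_sqrt real_sqrt_divide)
  also have "\<dots> = 5 / 2 * (2 powr (-5/3) / 2 powr (5/6) * sqrt 2)"
  proof -
    have "sqrt pi * sqrt pi = pi" by simp
    then show ?thesis by (simp add: field_simps)
  qed
  also have "2 powr (-5/3) / 2 powr (5/6) * sqrt 2 = (2 :: real) powr (-5/3 - 5/6 + 1/2)"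
    unfolding powr_add powr_diff by (simp add: powr_half_sqrt)
  also have "\<dots> = 2 powr (- 2)" by simp
  also have "\<dots> = 1/4" by (simp add: powr_minus)
  finally show ?thesis by simp
qed

lemma moment_coeff_0: "moment_coeff 0 = 1"
  using Gamma_real_nonzero[of "2/3"] by (simp add: moment_coeff_def)

lemma moment_coeff_1: "moment_coeff 1 = 2/3 * density_coeff 0"
proof -
  have g52: "Gamma (5/2 :: real) = 3/4 * sqrt pi"
    using Gamma_real_plus1[of "1/2"] Gamma_real_plus1[of "3/2"] by (simp add: Gamma_one_half_real)
  have g53: "Gamma (5/3 :: real) = 2/3 * Gamma (2/3)" using Gamma_real_plus1[of "2/3"] by simp
  have e: "2/3 + real 1 = 5/3" "1 + 3/2 * real 1 = 5/2" by simp_all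
  have "moment_coeff 1 = 3 / (2 * sqrt 2) * (2/3) / (3/4 * sqrt pi)"
    unfolding moment_coeff_def e g52 g53 using Gamma_real_nonzero[of "2/3"] by simp
  also have "\<dots> = 4/3 * (1 / sqrt 2) / sqrt pi" by simp
  also have "1 / sqrt 2 = sqrt 2 / (2 :: real)" by (simp add: field_simps)
  finally have "moment_coeff 1 = 2/3 * (sqrt 2 / sqrt pi)" by simp
  then show ?thesis by (simp add: density_coeff_0)
qed

text \<open>The factor reflects that y^(n+1) with y = x^(3/2) has derivative 3/2 (n + 1) y^n sqrt x.
  A direct proof would use the triplication formula for Gamma (5/2 + 3n/2); comparing the two-step
  recurrences leaves only n = 0 and n = 1 to be evaluated.\<close>

lemma moment_coeff_Suc: "moment_coeff (Suc n) = 2 / (3 * (real n + 1)) * density_coeff n"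
proof (induction n rule: less_induct)
  case (less n)
  consider "n = 0" | "n = 1" | k where "n = k + 2"
    by (metis One_nat_def Suc_1 add_2_eq_Suc' not0_implies_Suc)
  then show ?case
  proof cases
    case 1
    then show ?thesis using moment_coeff_1 by simp
  next
    case 2
    then show ?thesis using moment_coeff_rec[of 0] moment_coeff_0 density_coeff_1 by (simp add: numeral_2_eq_2)
  next
    case (3 k)
    define m where "m = real k"
    have m: "0 \<le> m" by (simp add: m_def)
    have ih: "moment_coeff (Suc k) = 2 / (3 * (m + 1)) * density_coeff k" using less[of k] 3 by (simp add: m_def)
    have "moment_coeff (Suc n) = moment_coeff (Suc k + 2)" using 3 by simp
    also have "\<dots> = 2 / (3 * (m + 1)) * density_coeff k * ((m + 8/3) / (3 * (m + 3) * (m + 7/3)))"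
      unfolding moment_coeff_rec[of "Suc k"] ih by (simp add: m_def add_ac)
    also have "\<dots> = 2 / (3 * (m + 3)) * (density_coeff k * ((m + 8/3) / (3 * (m + 7/3) * (m + 1))))"
    proof -
      have "2 / (3 * Y) * d * (W / (3 * X * Z)) = 2 / (3 * X) * (d * (W / (3 * Z * Y)))" for d W X Y Z :: real
        by (simp add: mult_ac)
      then show ?thesis .
    qed
    also have "\<dots> = 2 / (3 * (m + 3)) * density_coeff n"
      unfolding 3 density_coeff_rec by (simp add: m_def)
    finally show ?thesis using 3 by (simp add: m_def add_ac)
  qed
qed

text \<open>The bound on \<open>r\<close> makes the term ratio tend to 0, so the series converges
  for every z and \<open>eval_fps\<close> is its genuine sum.\<close>

lemma hypergeometric_sums:
  assumes "\<And>n. fps_nth (fps_hypergeo as bs 1) (Suc n) = r n * fps_nth (fps_hypergeo as bs 1) n"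
    and r: "\<And>n. 0 \<le> r n" "\<And>n. r n \<le> 2 / (real n + 1/2)"
  shows "(\<lambda>n. fps_nth (fps_hypergeo as bs 1) n * z ^ n) sums hypergeometric as bs z"
proof -
  have "summable (\<lambda>n. fps_nth (fps_hypergeo as bs 1) n * z ^ n)"
  \<comment> \<open>Beyond 4 |z| the bound 2 |z| / (n + 1/2) on the ratio is at most 1/2.\<close>
  proof (rule summable_ratio_test[where c="1/2" and N="nat \<lceil>4 * \<bar>z\<bar>\<rceil>"])
    fix n assume "nat \<lceil>4 * \<bar>z\<bar>\<rceil> \<le> n"
    then have n: "4 * \<bar>z\<bar> \<le> real n" by linarith
    have "r n * \<bar>z\<bar> \<le> 2 / (real n + 1/2) * \<bar>z\<bar>" using r by (intro mult_right_mono) auto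
    also have "\<dots> \<le> 1/2" using n by (simp add: field_simps)
    finally have "r n * \<bar>z\<bar> \<le> 1/2" .
    then have "(r n * \<bar>z\<bar>) * norm (fps_nth (fps_hypergeo as bs 1) n * z ^ n) \<le> 1/2 * norm (fps_nth (fps_hypergeo as bs 1) n * z ^ n)"
      by (intro mult_right_mono) auto
    then show "norm (fps_nth (fps_hypergeo as bs 1) (Suc n) * z ^ Suc n) \<le> 1/2 * norm (fps_nth (fps_hypergeo as bs 1) n * z ^ n)"
      unfolding assms(1) using r(1)[of n] by (simp add: abs_mult mult_ac del: fps_hypergeo_nth)
  qed simp
  then show ?thesis unfolding hypergeometric_def eval_fps_def by (rule summable_sums)
qed

section \<open>Even and odd coefficients as coefficients of hypergeometric series\<close>

abbreviation (input) hyp_even :: "nat \<Rightarrow> real" where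
  "hyp_even m \<equiv> fps_nth (fps_hypergeo [4/3, 1] [7/6, 1/2] 1) m"

abbreviation (input) hyp_odd :: "nat \<Rightarrow> real" where
  "hyp_odd m \<equiv> fps_nth (fps_hypergeo [11/6] [5/3] 1) m"

lemma hyp_even_Suc: "hyp_even (Suc m) = (real m + 4/3) / ((real m + 7/6) * (real m + 1/2)) * hyp_even m"
  unfolding fps_hypergeo_rec by (simp add: add_ac del: fps_hypergeo_nth)

lemma hyp_odd_Suc: "hyp_odd (Suc m) = (real m + 11/6) / ((real m + 5/3) * (real m + 1)) * hyp_odd m"
  unfolding fps_hypergeo_rec by (simp add: add_ac del: fps_hypergeo_nth)

text \<open>The recurrence at n = 2 m is that of the 2F2 coefficients divided by 6, which is why the
  argument is x^3 / 6. The upper parameter 1 cancels the factorial of the hypergeometric series,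
  because the ratio has no factor m + 1.\<close>

lemma density_coeff_even: "density_coeff (2 * m) = sqrt 2 / sqrt pi * (hyp_even m / 6 ^ m)"
proof (induction m)
  case 0
  then show ?case using density_coeff_0 by (simp del: fps_hypergeo_nth)
next
  case (Suc m)
  define t where "t = real m"
  have t: "0 \<le> t" by (simp add: t_def)
  have "density_coeff (2 * Suc m) = density_coeff (2 * m) * ((2 * t + 8/3) / (3 * (2 * t + 7/3) * (2 * t + 1)))"
    using density_coeff_rec[of "2 * m"] by (simp add: t_def)
  also have "(2 * t + 8/3) / (3 * (2 * t + 7/3) * (2 * t + 1)) = (t + 4/3) / ((t + 7/6) * (t + 1/2)) / 6"
    using t by (simp add: divide_simps) (simp add: algebra_simps)
  finally show ?case unfolding Suc.IH hyp_even_Suc t_def[symmetric] by (simp add: mult_ac del: fps_hypergeo_nth)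
qed

text \<open>At n = 2 m + 1 the ratio does contain m + 1, which is the factorial, so one upper and
  one lower parameter remain.\<close>

lemma density_coeff_odd: "density_coeff (2 * m + 1) = 5/8 * (hyp_odd m / 6 ^ m)"
proof (induction m)
  case 0
  then show ?case using density_coeff_1 by (simp del: fps_hypergeo_nth)
next
  case (Suc m)
  define t where "t = real m"
  have t: "0 \<le> t" by (simp add: t_def)
  have "density_coeff (2 * Suc m + 1) = density_coeff (2 * m + 1) * ((2 * t + 11/3) / (3 * (2 * t + 10/3) * (2 * t + 2)))"
    using density_coeff_rec[of "2 * m + 1"] by (simp add: t_def add_ac)
  also have "(2 * t + 11/3) / (3 * (2 * t + 10/3) * (2 * t + 2)) = (t + 11/6) / ((t + 5/3) * (t + 1)) / 6"
    using t by (simp add: divide_simps) (simp add: algebra_simps)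
  finally show ?case unfolding Suc.IH hyp_odd_Suc t_def[symmetric] by (simp add: mult_ac del: fps_hypergeo_nth)
qed

lemma hyp_even_sums: "(\<lambda>m. hyp_even m * z ^ m) sums hypergeometric [4/3, 1] [7/6, 1/2] z"
proof (rule hypergeometric_sums[OF hyp_even_Suc])
  show "(real m + 4/3) / ((real m + 7/6) * (real m + 1/2)) \<le> 2 / (real m + 1/2)" for m
  proof -
    have "(real m + 4/3) / (real m + 7/6) \<le> 2" by (simp add: field_simps)
    then have "(real m + 4/3) / (real m + 7/6) / (real m + 1/2) \<le> 2 / (real m + 1/2)"
      by (intro divide_right_mono) auto
    then show ?thesis by simp
  qed
qed simp

lemma hyp_odd_sums: "(\<lambda>m. hyp_odd m * z ^ m) sums hypergeometric [11/6] [5/3] z"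
proof (rule hypergeometric_sums[OF hyp_odd_Suc])
  show "(real m + 11/6) / ((real m + 5/3) * (real m + 1)) \<le> 2 / (real m + 1/2)" for m
  proof -
    have "(real m + 11/6) / (real m + 5/3) \<le> 2" by (simp add: field_simps)
    then have "(real m + 11/6) / (real m + 5/3) / (real m + 1) \<le> 2 / (real m + 1/2)"
      by (intro frac_le) auto
    then show ?thesis by simp
  qed
qed simp

text \<open>The density of M divided by sqrt x, as an entire function of y = x^(3/2).\<close>

definition density_series :: "real \<Rightarrow> real" where
  "density_series y = (\<Sum>n. (-1) ^ n * density_coeff n * y ^ n)"

text \<open>Interleaves the two hypergeometric series. Their convergence also proves that of the
  whole series, on which the later summability claims rest.\<close>

lemma density_series_sums_hypergeometric:
  "(\<lambda>n. (-1) ^ n * density_coeff n * y ^ n) sums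
    (sqrt 2 / sqrt pi * hypergeometric [4/3, 1] [7/6, 1/2] (y\<^sup>2 / 6) - 5/8 * y * hypergeometric [11/6] [5/3] (y\<^sup>2 / 6))"
proof -
  let ?f = "\<lambda>m. sqrt 2 / sqrt pi * (hyp_even m * (y\<^sup>2 / 6) ^ m)"
  let ?g = "\<lambda>m. - (5/8 * y) * (hyp_odd m * (y\<^sup>2 / 6) ^ m)"
  have "(\<lambda>n. if even n then ?f (n div 2) else ?g ((n - 1) div 2)) sums
     (- (5/8 * y) * hypergeometric [11/6] [5/3] (y\<^sup>2 / 6) + sqrt 2 / sqrt pi * hypergeometric [4/3, 1] [7/6, 1/2] (y\<^sup>2 / 6))"
    by (intro sums_if sums_mult hyp_even_sums hyp_odd_sums)
  moreover have "(if even n then ?f (n div 2) else ?g ((n - 1) div 2)) = (-1) ^ n * density_coeff n * y ^ n" for n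
  proof (cases "even n")
    case True
    then obtain m where m: "n = 2 * m" by (rule evenE)
    show ?thesis unfolding m density_coeff_even by (simp add: power_mult power_divide del: fps_hypergeo_nth)
  next
    case False
    then obtain m where m: "n = 2 * m + 1" by (rule oddE)
    show ?thesis unfolding m density_coeff_odd by (simp add: power_mult power_divide del: fps_hypergeo_nth)
  qed
  ultimately show ?thesis by simp
qed

lemma density_series_sums: "(\<lambda>n. (-1) ^ n * density_coeff n * y ^ n) sums density_series y"
  unfolding density_series_def by (rule summable_sums[OF sums_summable[OF density_series_sums_hypergeometric]])

lemma density_series_hypergeometric:
  "density_series y = sqrt 2 / sqrt pi * hypergeometric [4/3, 1] [7/6, 1/2] (y\<^sup>2 / 6) - 5/8 * y * hypergeometric [11/6] [5/3] (y\<^sup>2 / 6)"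
  by (rule sums_unique2[OF density_series_sums density_series_sums_hypergeometric])

lemma continuous_density_series: "continuous_on UNIV density_series"
proof -
  have "(density_series has_field_derivative (\<Sum>n. diffs (\<lambda>n. (-1) ^ n * density_coeff n) n * x ^ n)) (at x)" for x
    unfolding density_series_def
    by (rule termdiffs_strong_converges_everywhere) (rule sums_summable[OF density_series_sums])
  then show ?thesis using DERIV_isCont by (blast intro: continuous_at_imp_continuous_on)
qed

text \<open>The probability that M exceeds x, as a function of y = x^(3/2).\<close>

definition survival_series :: "real \<Rightarrow> real" where
  "survival_series y = (\<Sum>n. (-1) ^ n * moment_coeff n * y ^ n)"

lemma summable_moment_coeff: "summable (\<lambda>n. moment_coeff n * y ^ n)"
proof -
  have "summable (\<lambda>n. norm ((-1) ^ n * density_coeff n * \<bar>y\<bar> ^ n))"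
  proof -
    \<comment> \<open>At the argument - |y| the alternating signs cancel, so convergence there is
      absolute convergence at y.\<close>
    have "summable (\<lambda>n. (-1) ^ n * density_coeff n * (- \<bar>y\<bar>) ^ n)" by (rule sums_summable[OF density_series_sums])
    moreover have "(-1) ^ n * density_coeff n * (- \<bar>y\<bar>) ^ n = norm ((-1) ^ n * density_coeff n * \<bar>y\<bar> ^ n)" for n
    proof -
      have "(-1) ^ n * density_coeff n * (- \<bar>y\<bar>) ^ n = density_coeff n * ((-1) * (- \<bar>y\<bar>)) ^ n"
        unfolding power_mult_distrib by (simp add: mult_ac)
      then show ?thesis using density_coeff_nonneg[of n] by (simp add: abs_mult power_abs)
    qed
    ultimately show ?thesis by simp
  qed
  then have "summable (\<lambda>n. moment_coeff (Suc n) * y ^ n)"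
  proof (rule summable_comparison_test[rotated], intro exI allI impI)
    fix n
    have "2 / (3 * (real n + 1)) \<le> 1" by (simp add: field_simps)
    then have "moment_coeff (Suc n) \<le> density_coeff n"
      unfolding moment_coeff_Suc using density_coeff_nonneg[of n] mult_right_mono[of "2 / (3 * (real n + 1))" 1 "density_coeff n"] by (simp only: mult_1_left)
    then show "norm (moment_coeff (Suc n) * y ^ n) \<le> norm ((-1) ^ n * density_coeff n * \<bar>y\<bar> ^ n)"
      using moment_coeff_nonneg[of "Suc n"] density_coeff_nonneg[of n]
      by (simp add: abs_mult power_abs mult_right_mono)
  qed
  then have "summable (\<lambda>n. y * (moment_coeff (Suc n) * y ^ n))" by (rule summable_mult)
  then have "summable (\<lambda>n. moment_coeff (Suc n) * y ^ Suc n)" by (simp add: mult_ac)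
  then show ?thesis by (subst (asm) summable_Suc_iff)
qed

lemma summable_survival_series: "summable (\<lambda>n. (-1) ^ n * moment_coeff n * y ^ n)"
proof -
  have "(-1) ^ n * moment_coeff n * y ^ n = moment_coeff n * (- y) ^ n" for n
    by (subst power_minus) simp
  then show ?thesis using summable_moment_coeff[of "- y"] by (simp only:)
qed

lemma survival_series_0 [simp]: "survival_series 0 = 1"
  unfolding survival_series_def by (simp add: moment_coeff_0)

lemma DERIV_survival_series: "(survival_series has_real_derivative - (2/3) * density_series y) (at y)"
proof -
  have "(survival_series has_field_derivative (\<Sum>n. diffs (\<lambda>n. (-1) ^ n * moment_coeff n) n * y ^ n)) (at y)"
    unfolding survival_series_def
    by (rule termdiffs_strong_converges_everywhere) (rule summable_survival_series)
  also have "(\<lambda>n. diffs (\<lambda>n. (-1) ^ n * moment_coeff n) n * y ^ n) = (\<lambda>n. - (2/3) * ((-1) ^ n * density_coeff n * y ^ n))"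
    unfolding diffs_def moment_coeff_Suc by (auto simp: fun_eq_iff field_simps)
  also have "suminf \<dots> = - (2/3) * density_series y"
    unfolding density_series_def by (rule suminf_mult[OF sums_summable[OF density_series_sums]])
  finally show ?thesis .
qed

text \<open>The moments of A grow slowly enough for the exponential series to be integrated
  termwise: the expected absolute values of its terms are \<open>moment_coeff k * s ^ k\<close>,
  which is summable for every s.\<close>

lemma (in brownian_motion) expectation_area_exp:
  assumes s: "0 \<le> s"
  shows "expectation (\<lambda>\<omega>. exp (- s * area_running_max B \<omega>)) = survival_series s"
proof -
  let ?A = "area_running_max B"
  let ?f = "\<lambda>k \<omega>. (- s * ?A \<omega>) ^ k / fact k"
  have m0: "0 \<le> fact k * moment_coeff k" for k using moment_coeff_nonneg[of k] by simp
  have nn: "(\<integral>\<^sup>+\<omega>. ennreal (?A \<omega> ^ k) \<partial>P) = ennreal (fact k * moment_coeff k)" for k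
    unfolding area_moment moment_coeff_def by (simp add: mult_ac)
  have pw: "AE \<omega> in P. 0 \<le> ?A \<omega> ^ k" for k
    using area_running_max_nonneg by eventually_elim simp
  have int: "integrable P (\<lambda>\<omega>. ?A \<omega> ^ k)" for k
    by (rule integrableI_nn_integral_finite[OF _ pw nn]) measurable
  have mom: "expectation (\<lambda>\<omega>. ?A \<omega> ^ k) = fact k * moment_coeff k" for k
    using nn[of k] nn_integral_eq_integral[OF int pw] m0[of k] integral_nonneg_AE[OF pw[of k]] by (simp add: ennreal_inj)
  have f_eq: "?f k \<omega> = ((- s) ^ k / fact k) * ?A \<omega> ^ k" for k \<omega>
    unfolding power_mult_distrib by simp
  have E: "expectation (?f k) = (-1) ^ k * moment_coeff k * s ^ k" for k
    unfolding f_eq by (subst power_minus) (simp add: mom)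
  have nE: "expectation (\<lambda>\<omega>. norm (?f k \<omega>)) = moment_coeff k * s ^ k" for k
  proof -
    have "expectation (\<lambda>\<omega>. norm (?f k \<omega>)) = expectation (\<lambda>\<omega>. (s ^ k / fact k) * ?A \<omega> ^ k)"
    proof (rule integral_cong_AE)
      show "AE \<omega> in P. norm (?f k \<omega>) = (s ^ k / fact k) * ?A \<omega> ^ k"
        using area_running_max_nonneg by eventually_elim (use s in \<open>simp add: power_abs abs_mult power_mult_distrib\<close>)
    qed measurable
    then show ?thesis by (simp add: mom mult_ac)
  qed
  have "(\<lambda>k. expectation (?f k)) sums expectation (\<lambda>\<omega>. \<Sum>k. ?f k \<omega>)"
  proof (rule sums_integral)
    show "integrable P (?f k)" for k unfolding f_eq by (intro integrable_mult_right int)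
    show "AE \<omega> in P. summable (\<lambda>k. norm (?f k \<omega>))"
      using summable_norm_exp[of "- s * ?A _"] by (intro AE_I2) (simp only: real_scaleR_def divide_inverse mult.commute)
    show "summable (\<lambda>k. expectation (\<lambda>\<omega>. norm (?f k \<omega>)))"
      unfolding nE by (rule summable_moment_coeff)
  qed
  moreover have "(\<Sum>k. ?f k \<omega>) = exp (- s * ?A \<omega>)" for \<omega>
    by (simp add: exp_def divide_inverse mult_ac)
  ultimately show ?thesis unfolding E survival_series_def by (simp add: sums_iff)
qed

text \<open>Replacing x by \<open>max 0 x\<close> extends the density by 0 to x <= 0; the factor
  sqrt x vanishes at 0, so the extension is continuous on the whole line.\<close>

definition maximal_density :: "real \<Rightarrow> real" where
  "maximal_density x = sqrt (max 0 x) * density_series (max 0 x * sqrt (max 0 x))"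

definition maximal_survival :: "real \<Rightarrow> real" where
  "maximal_survival x = survival_series (max 0 x * sqrt (max 0 x))"

lemma powr_three_halves: "0 \<le> x \<Longrightarrow> x powr (3/2) = x * sqrt x" for x :: real
  using powr_add[of x 1 "1/2"] by (simp add: powr_half_sqrt)

lemma continuous_maximal_density: "continuous_on UNIV maximal_density"
  unfolding maximal_density_def
  by (intro continuous_intros continuous_on_compose2[OF continuous_density_series]) auto

lemma continuous_maximal_survival: "continuous_on UNIV maximal_survival"
proof -
  have *: "continuous_on UNIV survival_series"
    using DERIV_isCont[OF DERIV_survival_series] by (auto intro!: continuous_at_imp_continuous_on)
  show ?thesis
    unfolding maximal_survival_def
    by (intro continuous_intros continuous_on_compose2[OF *]) auto
qed

lemma DERIV_maximal_survival:
  assumes x: "0 < x"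
  shows "(maximal_survival has_real_derivative - maximal_density x) (at x)"
proof -
  have "((\<lambda>x. x * sqrt x) has_real_derivative 3/2 * sqrt x) (at x)"
    using x by (auto intro!: derivative_eq_intros simp: field_simps)
  from DERIV_chain2[OF DERIV_survival_series this]
  have "((\<lambda>x. survival_series (x * sqrt x)) has_real_derivative - maximal_density x) (at x)"
    using x by (simp add: maximal_density_def mult_ac)
  then show ?thesis
  proof (rule has_field_derivative_transform_within_open)
    show "survival_series (y * sqrt y) = maximal_survival y" if "y \<in> {0<..}" for y
      using that by (simp add: maximal_survival_def)
  qed (use x in auto)
qed

lemma nn_integral_maximal_density:
  assumes nonneg: "\<And>x. 0 \<le> maximal_density x"
  shows "(\<integral>\<^sup>+x. ennreal (maximal_density x) * indicator {..a} x \<partial>lborel) = ennreal (1 - maximal_survival a)"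
proof (cases "0 < a")
  case True
  have "(\<integral>\<^sup>+x. ennreal (maximal_density x) * indicator {..a} x \<partial>lborel)
    = (\<integral>\<^sup>+x. ennreal (maximal_density x) * indicator {0..a} x \<partial>lborel)"
    by (intro nn_integral_cong) (auto simp: indicator_def maximal_density_def)
  also have "\<dots> = ennreal (- maximal_survival a - (- maximal_survival 0))"
  \<comment> \<open>The derivative is available for x > 0 only; at the end point 0 continuity of
    \<open>maximal_survival\<close> suffices.\<close>
  proof (rule nn_integral_has_integral_lebesgue'[OF nonneg], rule fundamental_theorem_of_calculus_interior)
    show "continuous_on {0..a} (\<lambda>x. - maximal_survival x)"
      by (intro continuous_intros continuous_on_subset[OF continuous_maximal_survival]) auto
    show "((\<lambda>x. - maximal_survival x) has_vector_derivative maximal_density x) (at x)" if "x \<in> {0<..<a}" for x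
      using DERIV_minus[OF DERIV_maximal_survival[of x]] that
      by (simp add: has_real_derivative_iff_has_vector_derivative)
  qed (use True in auto)
  also have "maximal_survival 0 = 1" by (simp add: maximal_survival_def)
  finally show ?thesis by simp
next
  case False
  have "(\<integral>\<^sup>+x. ennreal (maximal_density x) * indicator {..a} x \<partial>lborel) = (\<integral>\<^sup>+x. 0 \<partial>(lborel :: real measure))"
    using False by (intro nn_integral_cong) (auto simp: indicator_def maximal_density_def)
  then show ?thesis using False by (simp add: maximal_survival_def)
qed

text \<open>The alternating series does not show its sign. A negative value at y would make
  \<open>survival_series\<close> increase to the right of y, whereas it is the Laplace transform of
  the nonnegative variable A and so decreases. Only points to the right enter, so y = 0 is
  covered.\<close>

lemma (in brownian_motion) density_series_nonneg:
  assumes y: "0 \<le> y"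
  shows "0 \<le> density_series y"
proof (rule ccontr)
  assume "\<not> 0 \<le> density_series y"
  then have "0 < - (2/3) * density_series y" by simp
  from DERIV_pos_inc_right[OF DERIV_survival_series this]
  obtain d where d: "0 < d" "\<And>h. 0 < h \<Longrightarrow> h < d \<Longrightarrow> survival_series y < survival_series (y + h)" by blast
  have int: "integrable P (\<lambda>\<omega>. exp (- s * area_running_max B \<omega>))" if "0 \<le> s" for s
    by (rule integrable_const_bound[of _ 1]) (use area_running_max_nonneg that in auto)
  have "expectation (\<lambda>\<omega>. exp (- (y + d/2) * area_running_max B \<omega>)) \<le> expectation (\<lambda>\<omega>. exp (- y * area_running_max B \<omega>))"
  proof (rule integral_mono_AE)
    show "AE \<omega> in P. exp (- (y + d/2) * area_running_max B \<omega>) \<le> exp (- y * area_running_max B \<omega>)"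
      using area_running_max_nonneg
    proof eventually_elim
      case (elim \<omega>)
      have "y * area_running_max B \<omega> \<le> (y + d/2) * area_running_max B \<omega>"
        using d(1) elim by (intro mult_right_mono) auto
      then show ?case unfolding exp_le_cancel_iff mult_minus_left by simp
    qed
  qed (intro int; use y d in simp)+
  then have "survival_series (y + d/2) \<le> survival_series y"
    using y d(1) by (simp only: expectation_area_exp add_nonneg_nonneg less_imp_le half_gt_zero)
  then show False using d(2)[of "d/2"] d(1) by simp
qed

lemma maximal_density_sums:
  assumes x: "0 < x"
  shows "(\<lambda>n. (-1) ^ n * (Gamma (1 + real n / 2) * Gamma (4/3 + real n / 2)) / (Gamma (7/6 + real n / 2) * fact n) *
      (2/3) powr (real n / 2) * x powr (3 * real n / 2 + 1/2)) sums (maximal_density x / density_const)"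
proof -
  have "(-1) ^ n * density_coeff n * (x * sqrt x) ^ n * (sqrt x / density_const) =
    (-1) ^ n * (Gamma (1 + real n / 2) * Gamma (4/3 + real n / 2)) / (Gamma (7/6 + real n / 2) * fact n) *
      (2/3) powr (real n / 2) * x powr (3 * real n / 2 + 1/2)" for n
  proof -
    have "(x * sqrt x) ^ n = x powr (3 * real n / 2)"
      using x powr_power[of x "3/2" n] unfolding powr_three_halves[OF less_imp_le[OF x], symmetric]
      by (simp add: mult.commute)
    then have p: "(x * sqrt x) ^ n * sqrt x = x powr (3 * real n / 2 + 1/2)"
      unfolding powr_add using x by (simp only: powr_half_sqrt less_imp_le)
    show ?thesis
      unfolding density_coeff_def p[symmetric] using density_const_pos by simp
  qed
  moreover have "(\<lambda>n. (-1) ^ n * density_coeff n * (x * sqrt x) ^ n * (sqrt x / density_const)) sums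
      (density_series (x * sqrt x) * (sqrt x / density_const))"
    by (intro sums_mult2 density_series_sums)
  ultimately show ?thesis
    using x by (simp add: maximal_density_def mult.commute)
qed

lemma maximal_density_hypergeometric:
  assumes x: "0 < x"
  shows "maximal_density x = 2 powr (1/2) / pi powr (1/2) * x powr (1/2) *
      hypergeometric [4/3, 1] [7/6, 1/2] (x ^ 3 / 6) - 5/8 * x ^ 2 * hypergeometric [11/6] [5/3] (x ^ 3 / 6)"
proof -
  have y2: "(x * sqrt x)\<^sup>2 = x ^ 3"
    using x by (simp add: power_mult_distrib power2_eq_square power3_eq_cube)
  have sx: "sqrt x * (5/8 * (x * sqrt x) * c) = 5/8 * x ^ 2 * c" for c
  proof -
    have "sqrt x * (5/8 * (x * sqrt x) * c) = 5/8 * x * c * (sqrt x * sqrt x)" by (simp only: mult_ac)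
    also have "sqrt x * sqrt x = x" using x by simp
    finally show ?thesis by (simp add: power2_eq_square mult_ac)
  qed
  have "maximal_density x = sqrt x * density_series (x * sqrt x)"
    using x by (simp add: maximal_density_def)
  then show ?thesis
    unfolding density_series_hypergeometric y2 right_diff_distrib sx
    using x by (simp only: powr_half_sqrt less_imp_le pi_ge_zero zero_le_numeral mult_ac)
qed

theorem theorem1p13:
  fixes P :: "'a measure" and B :: "real \<Rightarrow> 'a \<Rightarrow> real"
    and N :: "'b measure" and M :: "'b \<Rightarrow> real"
  assumes "standard_brownian_motion P B"
    and "prob_space N"
    and "M \<in> borel_measurable N"
    and "AE \<omega> in N. 0 < M \<omega>"
    and "\<And>x::real. 0 < x \<Longrightarrow>
      measure N {\<omega> \<in> space N. x < M \<omega>} =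
        (LINT \<omega>|P. exp (- (x powr (3/2)) * area_running_max B \<omega>))"
  shows "\<exists>f :: real \<Rightarrow> real.
    continuous_on UNIV f \<and> (\<forall>x. 0 \<le> f x) \<and>
    distributed N lborel M (\<lambda>x. ennreal (f x)) \<and>
    (\<forall>x>0.
      summable (\<lambda>n::nat. (-1) ^ n *
          (Gamma (1 + real n / 2) * Gamma (4/3 + real n / 2)) /
          (Gamma (7/6 + real n / 2) * fact n) *
          (2/3) powr (real n / 2) * x powr (3 * real n / 2 + 1/2)) \<and>
      f x = 3 powr (1/2) * Gamma (1/3) / (2 powr (5/6) * pi) *
        (\<Sum>n. (-1) ^ n *
          (Gamma (1 + real n / 2) * Gamma (4/3 + real n / 2)) /
          (Gamma (7/6 + real n / 2) * fact n) *
          (2/3) powr (real n / 2) * x powr (3 * real n / 2 + 1/2)) \<and>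
      f x = 2 powr (1/2) / pi powr (1/2) * x powr (1/2) *
          hypergeometric [4/3, 1] [7/6, 1/2] (x ^ 3 / 6)
        - 5/8 * x ^ 2 * hypergeometric [11/6] [5/3] (x ^ 3 / 6))"
proof -
  interpret brownian_motion P B
    using assms(1) unfolding brownian_motion_def brownian_motion_axioms_def
    by (simp add: standard_brownian_motion_def)
  interpret N: prob_space N by (rule assms(2))
  note [measurable] = assms(3)
  have nonneg: "0 \<le> maximal_density x" for x
    unfolding maximal_density_def by (intro mult_nonneg_nonneg density_series_nonneg) auto
  \<comment> \<open>For a > 0 this is the assumed tail formula. For a <= 0 both sides are 0, since M
    is positive almost surely and \<open>maximal_survival\<close> equals 1 there.\<close>
  have cdf: "emeasure N {\<omega> \<in> space N. M \<omega> \<le> a} = ennreal (1 - maximal_survival a)" for a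
  proof (cases "0 < a")
    case True
    have "measure N {\<omega> \<in> space N. M \<omega> \<le> a} = 1 - measure N {\<omega> \<in> space N. a < M \<omega>}"
    proof -
      have "{\<omega> \<in> space N. M \<omega> \<le> a} = space N - {\<omega> \<in> space N. a < M \<omega>}" by auto
      then show ?thesis by (simp add: N.prob_compl)
    qed
    also have "measure N {\<omega> \<in> space N. a < M \<omega>} = maximal_survival a"
      using True by (simp only: assms(5) expectation_area_exp powr_ge_zero)
        (simp add: maximal_survival_def powr_three_halves)
    finally show ?thesis by (simp add: N.emeasure_eq_measure)
  next
    case False
    have "AE \<omega> in N. \<not> M \<omega> \<le> a"
      using assms(4) by eventually_elim (use False in simp)
    then have "emeasure N {\<omega> \<in> space N. M \<omega> \<le> a} = 0"
      by (subst (asm) AE_iff_measurable[OF _ refl]) auto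
    then show ?thesis using False by (simp add: maximal_survival_def)
  qed
  have [measurable]: "maximal_density \<in> borel_measurable borel"
    by (rule borel_measurable_continuous_onI[OF continuous_maximal_density])
  have "distributed N lborel M (\<lambda>x. ennreal (maximal_density x))"
  proof (rule distributedI_borel_atMost[OF _ _ _ _ cdf])
    show "(\<integral>\<^sup>+x. ennreal (maximal_density x * indicator {..a} x) \<partial>lborel) = ennreal (1 - maximal_survival a)" for a
      using nn_integral_maximal_density[OF nonneg, of a] by (simp only: nn_integral_set_ennreal)
  qed (use nonneg in auto)
  moreover have "maximal_density x = density_const * (maximal_density x / density_const)" for x
    using density_const_pos by simp
  ultimately show ?thesis
    using continuous_maximal_density nonneg maximal_density_sums maximal_density_hypergeometric
    unfolding sums_iff density_const_def by (intro exI[of _ maximal_density]) auto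
qed

end
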